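(* Let $\Psi_1,\dots,\Psi_m$ be bounded sets of nonnegative matrices that define operators on $\ell^2$, let $\alpha\ge\frac1m$ and $r\in\{\rho_{ess},\hat\rho_{ess}\}$. Indices are taken cyclically modulo $m$ (so $\Psi_{m+i}=\Psi_i$). If $m$ is even, let $\Sigma_\alpha=\{C_1^{(\alpha)}\circ\cdots\circ C_m^{(\alpha)}: C_j\in P_j\}$ where $P_j=\Psi_j^*\Psi_{j+1}\Psi_{j+2}^*\Psi_{j+3}\cdots\Psi_{j+m-2}^*\Psi_{j+m-1}$ ($m$ factors, adjoints on odd-numbered positions). Then $$\gamma(\Psi_1^{(\alpha)}\circ\cdots\circ\Psi_m^{(\alpha)})\le r(\Sigma_\alpha)^{1/m}\le\left(r(\Psi_1^*\Psi_2\Psi_3^*\Psi_4\cdots\Psi_{m-1}^*\Psi_m)\,r(\Psi_m\Psi_{m-1}^*\cdots\Psi_4\Psi_3^*\Psi_2\Psi_1^* )\right)^{\alpha/2}.$$ If $m$ is odd, let $\Omega_\alpha=\{C_1^{(\alpha)}\circ\cdots\circ C_m^{(\alpha)}:C_j\in Q_j\}$ where $Q_j=\Psi_j^*\Psi_{j+1}\Psi_{j+2}^*\cdots\Psi_{j+2m-2}^*\Psi_{j+2m-1}$ ($2m$ factors, adjoints on odd-numbered positions). Then $$\gamma(\Psi_1^{(\alpha)}\circ\cdots\circ\Psi_m^{(\alpha)})\le r(\Omega_\alpha)^{1/(2m)}\le r(\Psi_1\Psi_2^*\Psi_3\Psi_4^*\cdots\Psi_{m-2}\Psi_{m-1}^*\Psi_m\Psi_1^*\Psi_2\cdots\Psi_{m-1}\Psi_m^*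 )^{\alpha/2},$$ where the last product has $2m$ factors $\Psi_1,\dots,\Psi_m,\Psi_1,\dots,\Psi_m$ with adjoints on exactly the even-numbered positions.
   Context: A nonnegative matrix $A=[a_{ij}]_{i,j\in\mathbb{N}}$ defines an operator on $\ell^2$ if $(Ax)_i=\sum_j a_{ij}x_j$ converges absolutely and $Ax\in\ell^2$ for all $x\in\ell^2$; $A^*$ is the transpose. Hadamard power $A^{(t)}=[a_{ij}^t]$, Hadamard product $A\circ B=[a_{ij}b_{ij}]$. For sets: $\Psi^*=\{A^*:A\in\Psi\}$, $\Psi\Sigma=\{AB:A\in\Psi,B\in\Sigma\}$, $\Psi_1^{(\alpha)}\circ\cdots\circ\Psi_m^{(\alpha)}=\{A_1^{(\alpha)}\circ\cdots\circ A_m^{(\alpha)}:A_j\in\Psi_j\}$, $\Sigma^k=\{A_1\cdots A_k:A_i\in\Sigma\}$. For a bounded set $\Omega$: $\gamma(\Omega)=\sup_{T\in\Omega}\gamma(T)$ with $\gamma(T)$ the Hausdorff measure of noncompactness; $\rho_{ess}(\Omega)=\sup_k[\sup_{A\in\Omega^k}\rho_{ess}(A)]^{1/k}$ and $\hat\rho_{ess}(\Omega)=\lim_k[\sup_{A\in\Omega^k}\gamma(A)]^{1/k}$, with $\rho_{ess}$ the essential spectral radius. *)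

theory Defs
  imports "HOL-Analysis.Analysis"
begin

type_synonym mat = "nat \<Rightarrow> nat \<Rightarrow> real"

definition l2 :: "(nat \<Rightarrow> 'a::real_normed_vector) \<Rightarrow> bool" where
  "l2 x \<longleftrightarrow> summable (\<lambda>i. (norm (x i))^2)"

definition l2norm :: "(nat \<Rightarrow> 'a::real_normed_vector) \<Rightarrow> real" where
  "l2norm x = sqrt (\<Sum>i. (norm (x i))^2)"

definition mat_app :: "mat \<Rightarrow> (nat \<Rightarrow> real) \<Rightarrow> (nat \<Rightarrow> real)" where
  "mat_app A x = (\<lambda>i. \<Sum>j. A i j * x j)"

definition nonneg_mat :: "mat \<Rightarrow> bool" where
  "nonneg_mat A \<longleftrightarrow> (\<forall>i j. 0 \<le> A i j)"

definition defines_op :: "mat \<Rightarrow> bool" where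
  "defines_op A \<longleftrightarrow> (\<forall>x. l2 x \<longrightarrow>
      (\<forall>i. summable (\<lambda>j. \<bar>A i j * x j\<bar>)) \<and> l2 (mat_app A x))"

definition opnorm :: "mat \<Rightarrow> real" where
  "opnorm A = Sup {l2norm (mat_app A x) | x. l2 x \<and> l2norm x \<le> 1}"

definition bounded_op_set :: "mat set \<Rightarrow> bool" where
  "bounded_op_set \<Psi> \<longleftrightarrow> (\<forall>A\<in>\<Psi>. nonneg_mat A \<and> defines_op A) \<and>
      (\<exists>M. \<forall>A\<in>\<Psi>. opnorm A \<le> M)"

definition mmult :: "mat \<Rightarrow> mat \<Rightarrow> mat" where
  "mmult A B = (\<lambda>i k. \<Sum>j. A i j * B j k)"

definition mtrans :: "mat \<Rightarrow> mat" where
  "mtrans A = (\<lambda>i j. A j i)"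

definition id_mat :: mat where
  "id_mat = (\<lambda>i j. if i = j then 1 else 0)"

definition adjs :: "mat set \<Rightarrow> mat set" where
  "adjs \<Psi> = mtrans ` \<Psi>"

definition set_mult :: "mat set \<Rightarrow> mat set \<Rightarrow> mat set" where
  "set_mult \<Psi> \<Sigma> = {mmult A B | A B. A \<in> \<Psi> \<and> B \<in> \<Sigma>}"

fun set_prod_list :: "mat set list \<Rightarrow> mat set" where
  "set_prod_list [] = {id_mat}"
| "set_prod_list [S] = S"
| "set_prod_list (S # Ss) = set_mult S (set_prod_list Ss)"

definition set_pow :: "mat set \<Rightarrow> nat \<Rightarrow> mat set" where
  "set_pow \<Sigma> k = set_prod_list (replicate k \<Sigma>)"

definition hadamard_sets :: "real \<Rightarrow> nat \<Rightarrow> (nat \<Rightarrow> mat set) \<Rightarrow> mat set" where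
  "hadamard_sets \<alpha> m S = {(\<lambda>i k. \<Prod>j\<in>{1..m}. (C j i k) powr \<alpha>) | C.
       \<forall>j\<in>{1..m}. C j \<in> S j}"

definition gamma :: "mat \<Rightarrow> real" where
  "gamma A = Inf {e. e > 0 \<and> (\<exists>F. finite F \<and> (\<forall>y\<in>F. l2 y) \<and>
      (\<forall>x. l2 x \<and> l2norm x \<le> 1 \<longrightarrow>
         (\<exists>y\<in>F. l2norm (\<lambda>i. mat_app A x i - y i) \<le> e)))}"

text \<open>Sup over a set of nonnegative quantities, with sup of the empty set = 0.\<close>
definition gamma_set :: "mat set \<Rightarrow> real" where
  "gamma_set \<Omega> = Sup (insert 0 (gamma ` \<Omega>))"

definition capp :: "mat \<Rightarrow> (nat \<Rightarrow> complex) \<Rightarrow> (nat \<Rightarrow> complex)" where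
  "capp A z = (\<lambda>i. \<Sum>j. complex_of_real (A i j) * z j)"

definition shifted_op :: "mat \<Rightarrow> complex \<Rightarrow> (nat \<Rightarrow> complex) \<Rightarrow> (nat \<Rightarrow> complex)" where
  "shifted_op A \<mu> z = (\<lambda>i. capp A z i - \<mu> * z i)"

definition fin_dim_c :: "(nat \<Rightarrow> complex) set \<Rightarrow> bool" where
  "fin_dim_c S \<longleftrightarrow> (\<exists>F. finite F \<and> F \<subseteq> S \<and>
      (\<forall>z\<in>S. \<exists>c. z = (\<lambda>i. \<Sum>f\<in>F. c f * f i)))"

definition op_kernel :: "mat \<Rightarrow> complex \<Rightarrow> (nat \<Rightarrow> complex) set" where
  "op_kernel A \<mu> = {z. l2 z \<and> shifted_op A \<mu> z = (\<lambda>i. 0)}"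

definition op_range :: "mat \<Rightarrow> complex \<Rightarrow> (nat \<Rightarrow> complex) set" where
  "op_range A \<mu> = {shifted_op A \<mu> z | z. l2 z}"

definition fredholm :: "mat \<Rightarrow> complex \<Rightarrow> bool" where
  "fredholm A \<mu> \<longleftrightarrow>
     fin_dim_c (op_kernel A \<mu>) \<and>
     (\<forall>s y. (\<forall>n. s n \<in> op_range A \<mu>) \<and> l2 y \<and>
            (\<lambda>n. l2norm (\<lambda>i. s n i - y i)) \<longlonglongrightarrow> 0 \<longrightarrow> y \<in> op_range A \<mu>) \<and>
     (\<exists>F. finite F \<and> (\<forall>f\<in>F. l2 f) \<and>
        (\<forall>y. l2 y \<longrightarrow> (\<exists>z c. l2 z \<and> y = (\<lambda>i. shifted_op A \<mu> z i + (\<Sum>f\<in>F. c f * f i)))))"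

definition ess_spectrum :: "mat \<Rightarrow> complex set" where
  "ess_spectrum A = {\<mu>. \<not> fredholm A \<mu>}"

definition rho_ess :: "mat \<Rightarrow> real" where
  "rho_ess A = Sup (insert 0 (cmod ` ess_spectrum A))"

definition rho_ess_set :: "mat set \<Rightarrow> real" where
  "rho_ess_set \<Omega> = (SUP k\<in>{1..}. (Sup (insert 0 (rho_ess ` set_pow \<Omega> k))) powr (1 / real k))"

definition rho_hat_ess_set :: "mat set \<Rightarrow> real" where
  "rho_hat_ess_set \<Omega> = lim (\<lambda>k. (gamma_set (set_pow \<Omega> (Suc k))) powr (1 / real (Suc k)))"

text \<open>Families are indexed by 1..m; index k >= 1 is read cyclically modulo m.\<close>
definition cyc :: "nat \<Rightarrow> (nat \<Rightarrow> mat set) \<Rightarrow> nat \<Rightarrow> mat set" where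
  "cyc m \<Psi> k = \<Psi> ((k - 1) mod m + 1)"

definition alt_prod :: "nat \<Rightarrow> (nat \<Rightarrow> mat set) \<Rightarrow> nat \<Rightarrow> nat \<Rightarrow> mat set" where
  "alt_prod m \<Psi> j n = set_prod_list
     (map (\<lambda>p. if odd p then adjs (cyc m \<Psi> (j + p - 1)) else cyc m \<Psi> (j + p - 1)) [1..<n+1])"

end

theory Submission
  imports Defs
begin

text \<open>
  For nonnegative matrices on \<open>\<ell>\<^sup>2\<close>, \<open>gamma A\<close> is the limit of the norms of the tails of \<open>A\<close>. It is
  therefore monotone in the entries, invariant under transposition and submultiplicative, it satisfies
  \<open>(gamma A)\<^sup>2 \<le> gamma (A\<^sup>* A)\<close>, and by the inequality of arithmetic and geometric means a Hadamard
  product \<open>A\<^sub>1\<^sup>(\<^sup>\<alpha>\<^sup>) \<circ> \<dots> \<circ> A\<^sub>m\<^sup>(\<^sup>\<alpha>\<^sup>)\<close> with \<open>m \<alpha> \<ge> 1\<close> has \<open>gamma\<close> at most the product of the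
  \<open>(gamma A\<^sub>j)\<^sup>\<alpha>\<close>. Since a product of such Hadamard products is dominated by the Hadamard product of the
  products, \<open>(A\<^sup>* A)\<^sup>q\<close> is dominated by a Hadamard product of alternating products, which gives the
  first inequality; the second one follows from \<open>r(S T) = r(T S)\<close> and \<open>r(S\<^sup>*) = r(S)\<close>.

  All this concerns the growth rate \<open>rho A = lim (gamma (A\<^sup>k))\<^sup>1\<^sup>/\<^sup>k\<close>. For nonnegative \<open>A\<close> it equals the
  essential spectral radius: outside the circle of radius \<open>rho A\<close> a Neumann series for a tail of \<open>A\<close> shows that
  \<open>A - \<mu>\<close> is Fredholm. Were \<open>A - rho A\<close> Fredholm as well, the resolvents of the tails would have
  bounded essential norm as \<open>\<mu>\<close> decreases to \<open>rho A\<close>, and by positivity their powers dominate the single terms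
  of their power series, so that \<open>gamma (A\<^sup>k)\<close> would grow more slowly than \<open>(rho A)\<^sup>k\<close>.
\<close>

section \<open>Square-summable sequences\<close>

text \<open>Entrywise domination is visible in \<open>gamma\<close> and \<open>rho\<close> but not
  in the Fredholm definition of \<open>rho_ess\<close>; identifying \<open>rho_ess\<close> with
  \<open>rho\<close> lets one argument serve both choices of \<open>r\<close>. The obstacle there is
  that the spectrum may contain points outside the circle of radius \<open>rho A\<close>, so the
  Neumann series of A itself can diverge for \<mu> near \<open>rho A\<close>. Deleting finitely many
  rows does not reduce \<open>gamma\<close> of any power and cures the divergence, but the number of
  rows depends on \<mu>; hence the insistence on bounds uniform in \<mu>. The lengths m and 2 m come
  from rotating alternating products: the length must be a multiple of m for the indices to wrap
  around and even for the adjoints to do so. A rotation by one place moves start index and adjoints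
  together. For even m the parity of the start index therefore splits the m products into two
  classes, which gives two radii; for odd m a rotation by m places moves only the adjoints, and a
  single radius remains.\<close>

lemma infsum_UNIV_eq_suminf:
  fixes f :: "nat \<Rightarrow> 'a::banach"
  assumes "summable (\<lambda>n. norm (f n))"
  shows "infsum f UNIV = (\<Sum>n. f n)"
  using norm_summable_imp_has_sum[OF assms summable_sums[OF summable_norm_cancel[OF assms]]]
  by (rule infsumI)

text \<open>Fubini for absolutely convergent double series. The order-free \<open>infsum\<close>
  carries it: summability over the product set is symmetric and so also yields the absolute
  summability in the other index, which is not among the assumptions.\<close>

lemma suminf_swap_banach:
  fixes f :: "nat \<Rightarrow> nat \<Rightarrow> 'a::banach"
  assumes 1: "\<And>i. summable (\<lambda>j. norm (f i j))"
    and 2: "summable (\<lambda>i. \<Sum>j. norm (f i j))"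
  shows "(\<Sum>i. \<Sum>j. f i j) = (\<Sum>j. \<Sum>i. f i j)"
proof -
  define g where "g = (\<lambda>(i, j). f i j)"
  have n1: "(\<Sum>\<^sub>\<infinity>j. norm (f i j)) = (\<Sum>j. norm (f i j))" for i
    using 1 by (intro infsum_UNIV_eq_suminf) simp
  have pos: "0 \<le> (\<Sum>j. norm (f i j))" for i
    using 1 by (intro suminf_nonneg) auto
  have abs: "(\<lambda>p. norm (g p)) summable_on (UNIV \<times> UNIV)"
    by (rule iffD2[OF Infinite_Sum.abs_summable_on_Sigma_iff])
      (use 1 2 in \<open>auto simp: g_def n1 pos intro!: norm_summable_imp_summable_on\<close>)
  then have "(\<lambda>(x, y). norm (g (y, x))) summable_on (UNIV \<times> UNIV)"
    by (subst (asm) summable_on_swap)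
  moreover have "(\<lambda>(x, y). norm (g (y, x))) = (\<lambda>p. norm (case p of (x, y) \<Rightarrow> g (y, x)))"
    by auto
  ultimately have abs2: "(\<lambda>p. norm (case p of (x, y) \<Rightarrow> g (y, x))) summable_on (UNIV \<times> UNIV)"
    by simp
  have 3: "summable (\<lambda>i. norm (f i j))" for j
    using iffD1[OF Infinite_Sum.abs_summable_on_Sigma_iff abs2]
    by (auto simp: g_def intro: summable_on_imp_summable)
  have n2: "(\<Sum>\<^sub>\<infinity>i. norm (f i j)) = (\<Sum>i. norm (f i j))" for j
    using 3 by (intro infsum_UNIV_eq_suminf) simp
  have pos2: "0 \<le> (\<Sum>i. norm (f i j))" for j
    using 3 by (intro suminf_nonneg) auto
  have 4: "summable (\<lambda>j. \<Sum>i. norm (f i j))"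
    using iffD1[OF Infinite_Sum.abs_summable_on_Sigma_iff abs2]
    by (auto simp: g_def n2 pos2 intro: summable_on_imp_summable)
  have i1: "(\<Sum>\<^sub>\<infinity>j. f i j) = (\<Sum>j. f i j)" for i
    using 1 by (intro infsum_UNIV_eq_suminf)
  have i2: "(\<Sum>\<^sub>\<infinity>i. f i j) = (\<Sum>i. f i j)" for j
    using 3 by (intro infsum_UNIV_eq_suminf)
  have s1: "summable (\<lambda>i. norm (\<Sum>j. f i j))"
    by (rule summable_comparison_test'[OF 2, of 0]) (use summable_norm[OF 1] in auto)
  have s2: "summable (\<lambda>j. norm (\<Sum>i. f i j))"
    by (rule summable_comparison_test'[OF 4, of 0]) (use summable_norm[OF 3] in auto)
  have "(\<Sum>\<^sub>\<infinity>i. \<Sum>\<^sub>\<infinity>j. f i j) = (\<Sum>\<^sub>\<infinity>j. \<Sum>\<^sub>\<infinity>i. f i j)"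
    by (rule infsum_swap_banach) (use abs_summable_summable[OF abs] in \<open>simp add: g_def\<close>)
  then show "(\<Sum>i. \<Sum>j. f i j) = (\<Sum>j. \<Sum>i. f i j)"
    using s1 s2 by (simp add: i1 i2 infsum_UNIV_eq_suminf)
qed

text \<open>Partial sums of squares increase, so a bound on all initial sections gives membership
  and norm bound at once. Limits are handled through this rule, because on a section the norm
  depends on finitely many coordinates.\<close>

lemma l2I:
  fixes x :: "nat \<Rightarrow> 'a::real_normed_vector"
  assumes "\<And>n. L2_set (\<lambda>i. norm (x i)) {..<n} \<le> c"
  shows "l2 x" and "l2norm x \<le> c"
proof -
  have c: "0 \<le> c"
    using assms[of 0] by simp
  have b: "(\<Sum>i<n. (norm (x i))\<^sup>2) \<le> c\<^sup>2" for n
    using assms[of n] c unfolding L2_set_def by (simp add: real_le_lsqrt sqrt_le_D)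
  show 1: "l2 x"
    unfolding l2_def by (rule bounded_imp_summable[of _ "c\<^sup>2"]) (use b[of "Suc _"] in \<open>auto simp: lessThan_Suc_atMost\<close>)
  have "(\<Sum>i. (norm (x i))\<^sup>2) \<le> c\<^sup>2"
    by (rule suminf_le_const) (use 1 b in \<open>auto simp: l2_def\<close>)
  then show "l2norm x \<le> c"
    unfolding l2norm_def using c by (simp add: real_le_lsqrt suminf_nonneg[OF 1[unfolded l2_def]])
qed

lemma L2_set_le_l2norm:
  assumes "l2 x"
  shows "L2_set (\<lambda>i. norm (x i)) I \<le> l2norm x"
proof (cases "finite I")
  case True
  then show ?thesis
    unfolding l2norm_def L2_set_def using assms
    by (auto simp: l2_def intro!: sum_le_suminf)
next
  case False
  then show ?thesis
    using assms by (simp add: l2norm_def l2_def suminf_nonneg)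
qed

lemma l2norm_nonneg: "l2 x \<Longrightarrow> 0 \<le> l2norm x"
  using L2_set_le_l2norm[of x "{}"] by simp

lemma norm_le_l2norm: "l2 x \<Longrightarrow> norm (x i) \<le> l2norm x"
  using L2_set_le_l2norm[of x "{i}"] by simp

lemma l2norm_norm: "l2norm (\<lambda>i. norm (x i)) = l2norm x"
  by (simp add: l2norm_def)

lemma l2_norm_iff: "l2 (\<lambda>i. norm (x i)) \<longleftrightarrow> l2 x"
  by (simp add: l2_def)

lemma
  assumes "l2 y" "\<And>i. norm (x i) \<le> norm (y i)"
  shows l2_mono: "l2 x" and l2norm_mono: "l2norm x \<le> l2norm y"
proof -
  have "L2_set (\<lambda>i. norm (x i)) {..<n} \<le> l2norm y" for n
    by (rule order_trans[OF L2_set_mono L2_set_le_l2norm]) (use assms in auto)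
  then show "l2 x" "l2norm x \<le> l2norm y"
    by (auto intro: l2I)
qed

lemma
  assumes "l2 x" "l2 y"
  shows l2_add: "l2 (\<lambda>i. x i + y i)" and l2norm_add: "l2norm (\<lambda>i. x i + y i) \<le> l2norm x + l2norm y"
proof -
  have "L2_set (\<lambda>i. norm (x i + y i)) {..<n} \<le> l2norm x + l2norm y" for n
  proof -
    have "L2_set (\<lambda>i. norm (x i + y i)) {..<n} \<le> L2_set (\<lambda>i. norm (x i) + norm (y i)) {..<n}"
      by (rule L2_set_mono) (auto simp: norm_triangle_ineq)
    also have "\<dots> \<le> L2_set (\<lambda>i. norm (x i)) {..<n} + L2_set (\<lambda>i. norm (y i)) {..<n}"
      by (rule L2_set_triangle_ineq)
    also have "\<dots> \<le> l2norm x + l2norm y"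
      by (intro add_mono L2_set_le_l2norm assms)
    finally show ?thesis .
  qed
  then show "l2 (\<lambda>i. x i + y i)" "l2norm (\<lambda>i. x i + y i) \<le> l2norm x + l2norm y"
    by (auto intro: l2I)
qed

lemma l2_mult:
  fixes c :: "'a::real_normed_field"
  assumes "l2 x"
  shows "l2 (\<lambda>i. c * x i)"
  using assms by (simp add: l2_def norm_mult power_mult_distrib summable_mult)

lemma l2_zero [simp]: "l2 (\<lambda>i. 0)" and l2norm_zero [simp]: "l2norm (\<lambda>i. 0) = 0"
  by (auto simp: l2_def l2norm_def)

lemma l2norm_mult:
  fixes c :: "'a::real_normed_field"
  assumes "l2 x"
  shows "l2norm (\<lambda>i. c * x i) = norm c * l2norm x"
proof -
  have "(\<Sum>i. (norm (c * x i))\<^sup>2) = (norm c)\<^sup>2 * (\<Sum>i. (norm (x i))\<^sup>2)"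
    using assms by (simp add: l2_def norm_mult power_mult_distrib suminf_mult)
  then show ?thesis
    by (simp add: l2norm_def real_sqrt_mult)
qed

lemma l2_uminus: "l2 x \<Longrightarrow> l2 (\<lambda>i. - x i)"
  by (simp add: l2_def)

lemma l2norm_uminus: "l2norm (\<lambda>i. - x i) = l2norm x"
  by (simp add: l2norm_def)

lemma l2_diff: "l2 x \<Longrightarrow> l2 y \<Longrightarrow> l2 (\<lambda>i. x i - y i)"
  using l2_add[of x "\<lambda>i. - y i"] by (simp add: l2_uminus)

lemma l2norm_diff: "l2 x \<Longrightarrow> l2 y \<Longrightarrow> l2norm (\<lambda>i. x i - y i) \<le> l2norm x + l2norm y"
  using l2norm_add[of x "\<lambda>i. - y i"] by (simp add: l2_uminus l2norm_uminus)

lemma l2_sum: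
  assumes "\<And>f. f \<in> F \<Longrightarrow> l2 (x f)"
  shows "l2 (\<lambda>i. \<Sum>f\<in>F. x f i)"
  using assms by (induction F rule: infinite_finite_induct) (auto intro: l2_add)

lemma
  assumes "\<And>i. i \<notin> I \<Longrightarrow> x i = 0" "finite I"
  shows l2_finite_support: "l2 x"
    and l2norm_finite_support: "l2norm x = L2_set (\<lambda>i. norm (x i)) I"
  using assms suminf_finite[of I "\<lambda>i. (norm (x i))\<^sup>2"] summable_finite[of I "\<lambda>i. (norm (x i))\<^sup>2"]
  by (auto simp: l2_def l2norm_def L2_set_def)

lemma l2norm_eq_0D:
  assumes "l2 x" "l2norm x \<le> 0"
  shows "x i = 0"
  using order_trans[OF norm_le_l2norm[OF assms(1), of i] assms(2)] by simp

lemma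
  fixes x y :: "nat \<Rightarrow> real"
  assumes "l2 x" "l2 y"
  shows summable_l2_mult: "summable (\<lambda>i. \<bar>x i\<bar> * \<bar>y i\<bar>)"
    and suminf_l2_mult: "(\<Sum>i. \<bar>x i\<bar> * \<bar>y i\<bar>) \<le> l2norm x * l2norm y"
proof -
  have b: "(\<Sum>i<n. \<bar>x i\<bar> * \<bar>y i\<bar>) \<le> l2norm x * l2norm y" for n
  proof -
    have "(\<Sum>i<n. \<bar>x i\<bar> * \<bar>y i\<bar>) \<le> L2_set (\<lambda>i. norm (x i)) {..<n} * L2_set (\<lambda>i. norm (y i)) {..<n}"
      using L2_set_mult_ineq[of "\<lambda>i. norm (x i)" "\<lambda>i. norm (y i)" "{..<n}"] by simp
    also have "\<dots> \<le> l2norm x * l2norm y"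
      by (intro mult_mono L2_set_le_l2norm l2norm_nonneg assms) auto
    finally show ?thesis .
  qed
  then show 1: "summable (\<lambda>i. \<bar>x i\<bar> * \<bar>y i\<bar>)"
    by (intro bounded_imp_summable[of _ "l2norm x * l2norm y"])
      (use b[of "Suc _"] in \<open>simp_all add: lessThan_Suc_atMost\<close>)
  show "(\<Sum>i. \<bar>x i\<bar> * \<bar>y i\<bar>) \<le> l2norm x * l2norm y"
    by (rule suminf_le_const) (use 1 b in auto)
qed

lemma
  fixes x y :: "nat \<Rightarrow> real"
  assumes "l2 x" "l2 y"
  shows summable_inner_l2: "summable (\<lambda>i. x i * y i)"
    and abs_inner_l2_le: "\<bar>\<Sum>i. x i * y i\<bar> \<le> l2norm x * l2norm y"
proof -
  have 1: "summable (\<lambda>i. norm (x i * y i))"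
    using summable_l2_mult[OF assms] by (simp add: abs_mult)
  then show "summable (\<lambda>i. x i * y i)"
    by (rule summable_norm_cancel)
  show "\<bar>\<Sum>i. x i * y i\<bar> \<le> l2norm x * l2norm y"
    using summable_norm[OF 1] suminf_l2_mult[OF assms] by (simp add: abs_mult)
qed

text \<open>Completeness in the form used below: a series with summable norms converges in every
  coordinate, and its sum inherits the bound on each initial section. \<open>c\<close> is any
  summable majorant of the norms.\<close>

lemma
  fixes x :: "nat \<Rightarrow> nat \<Rightarrow> 'a::banach"
  assumes x: "\<And>k. l2 (x k)" and le: "\<And>k. l2norm (x k) \<le> c k" and c: "summable c"
  shows summable_l2_series: "summable (\<lambda>k. norm (x k i))"
    and l2_series: "l2 (\<lambda>i. \<Sum>k. x k i)"
    and l2norm_series: "l2norm (\<lambda>i. \<Sum>k. x k i) \<le> (\<Sum>k. c k)"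
proof -
  have s: "summable (\<lambda>k. norm (x k i))" for i
    by (rule summable_comparison_test'[OF c, of 0])
      (use order_trans[OF norm_le_l2norm[OF x] le] in auto)
  then show "summable (\<lambda>k. norm (x k i))" .
  have c0: "0 \<le> c k" for k
    using order_trans[OF l2norm_nonneg[OF x] le] .
  have "L2_set (\<lambda>i. norm (\<Sum>k. x k i)) {..<n} \<le> (\<Sum>k. c k)" for n
  proof -
    have fin: "L2_set (\<lambda>i. norm (\<Sum>k<m. x k i)) {..<n} \<le> (\<Sum>k. c k)" for m
    proof -
      have "L2_set (\<lambda>i. norm (\<Sum>k<m. x k i)) {..<n} \<le> (\<Sum>k<m. c k)"
      proof (induction m)
        case (Suc m)
        have "L2_set (\<lambda>i. norm (\<Sum>k<Suc m. x k i)) {..<n}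
            \<le> L2_set (\<lambda>i. norm (\<Sum>k<m. x k i) + norm (x m i)) {..<n}"
          by (rule L2_set_mono) (auto simp: norm_triangle_ineq)
        also have "\<dots> \<le> L2_set (\<lambda>i. norm (\<Sum>k<m. x k i)) {..<n} + L2_set (\<lambda>i. norm (x m i)) {..<n}"
          by (rule L2_set_triangle_ineq)
        also have "\<dots> \<le> (\<Sum>k<m. c k) + c m"
          by (intro add_mono Suc order_trans[OF L2_set_le_l2norm le] x)
        finally show ?case by simp
      qed (simp add: L2_set_def)
      also have "\<dots> \<le> (\<Sum>k. c k)"
        by (rule sum_le_suminf[OF c]) (auto simp: c0)
      finally show ?thesis .
    qed
    have "(\<lambda>m. L2_set (\<lambda>i. norm (\<Sum>k<m. x k i)) {..<n}) \<longlonglongrightarrow> L2_set (\<lambda>i. norm (\<Sum>k. x k i)) {..<n}"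
      unfolding L2_set_def
      by (intro tendsto_real_sqrt tendsto_sum tendsto_power tendsto_norm summable_LIMSEQ)
        (use summable_norm_cancel[OF s] in auto)
    then show ?thesis
      by (rule LIMSEQ_le_const2) (use fin in auto)
  qed
  then show "l2 (\<lambda>i. \<Sum>k. x k i)" "l2norm (\<lambda>i. \<Sum>k. x k i) \<le> (\<Sum>k. c k)"
    by (auto intro: l2I)
qed

lemma l2_tail_small:
  assumes x: "l2 x" and e: "0 < e"
  obtains N where "\<And>L. N \<le> L \<Longrightarrow> l2norm (\<lambda>i. if L \<le> i then x i else 0) \<le> e"
proof -
  from e have "0 < e\<^sup>2" by simp
  with x[unfolded l2_def] obtain N where N: "\<And>m n. N \<le> m \<Longrightarrow> norm (\<Sum>i=m..<n. (norm (x i))\<^sup>2) < e\<^sup>2"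
    unfolding summable_Cauchy by meson
  have "l2norm (\<lambda>i. if L \<le> i then x i else 0) \<le> e" if L: "N \<le> L" for L
  proof (rule l2I(2))
    fix n
    have "(\<Sum>i<n. (norm (if L \<le> i then x i else 0))\<^sup>2) = (\<Sum>i=L..<n. (norm (x i))\<^sup>2)"
      by (rule sum.mono_neutral_cong_right) auto
    also have "\<dots> \<le> e\<^sup>2"
      using N[OF L, of n] by simp
    finally show "L2_set (\<lambda>i. norm (if L \<le> i then x i else 0)) {..<n} \<le> e"
      unfolding L2_set_def using e by (intro real_le_lsqrt) (auto intro: sum_nonneg)
  qed
  then show ?thesis by (rule that)
qed

section \<open>Nonnegative matrices bounded on square-summable sequences\<close>

text \<open>For nonnegative entries this says that the operator norm is at most \<open>c\<close>.
  The bilinear form on finite sections and nonnegative vectors makes monotonicity in the entries and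
  invariance under transposition immediate, and raises no question of convergence.\<close>

definition op_bound :: "mat \<Rightarrow> real \<Rightarrow> bool" where
  "op_bound A c \<longleftrightarrow> nonneg_mat A \<and>
     (\<forall>I J x y. finite I \<longrightarrow> finite J \<longrightarrow> (\<forall>i. 0 \<le> x i) \<longrightarrow> (\<forall>i. 0 \<le> y i) \<longrightarrow>
        (\<Sum>i\<in>I. \<Sum>j\<in>J. y i * A i j * x j) \<le> c * L2_set y I * L2_set x J)"

text \<open>\<open>scaleR\<close> lets one real matrix act on real and on complex sequences, so that
  \<open>mat_app\<close> and \<open>capp\<close> share all estimates.\<close>

definition mapp :: "mat \<Rightarrow> (nat \<Rightarrow> 'a::banach) \<Rightarrow> nat \<Rightarrow> 'a" where
  "mapp A x = (\<lambda>i. \<Sum>j. A i j *\<^sub>R x j)"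

definition mle :: "mat \<Rightarrow> mat \<Rightarrow> bool" where
  "mle A B \<longleftrightarrow> (\<forall>i j. A i j \<le> B i j)"

lemma mat_app_eq_mapp: "mat_app = mapp"
  by (auto simp: mat_app_def mapp_def fun_eq_iff)

lemma capp_eq_mapp: "capp = mapp"
  by (auto simp: capp_def mapp_def fun_eq_iff scaleR_conv_of_real)

lemma mmult_eq_mapp: "mmult A B i k = mapp A (\<lambda>j. B j k) i"
  by (simp add: mmult_def mapp_def)

lemma mle_refl [simp]: "mle A A"
  by (simp add: mle_def)

lemma mle_trans: "mle A B \<Longrightarrow> mle B C \<Longrightarrow> mle A C"
  unfolding mle_def using order_trans by blast

lemma op_boundD:
  assumes "op_bound A c"
  shows "nonneg_mat A"
    and "finite I \<Longrightarrow> finite J \<Longrightarrow> (\<And>i. 0 \<le> x i) \<Longrightarrow> (\<And>i. 0 \<le> y i) \<Longrightarrow>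
        (\<Sum>i\<in>I. \<Sum>j\<in>J. y i * A i j * x j) \<le> c * L2_set y I * L2_set x J"
    and "0 \<le> A i j"
  using assms by (auto simp: op_bound_def nonneg_mat_def)

lemma op_bound_entry: "op_bound A c \<Longrightarrow> A i j \<le> c"
  using op_boundD(2)[of A c "{i}" "{j}" "\<lambda>_. 1" "\<lambda>_. 1"] by simp

lemma op_bound_nonneg: "op_bound A c \<Longrightarrow> 0 \<le> c"
  using op_bound_entry[of A c 0 0] op_boundD(3)[of A c 0 0] by linarith

lemma op_bound_weaken: "op_bound A c \<Longrightarrow> c \<le> d \<Longrightarrow> op_bound A d"
  unfolding op_bound_def
  by (meson L2_set_nonneg mult_right_mono order_trans)

lemma op_bound_mono:
  assumes B: "op_bound B c" and A: "nonneg_mat A" "mle A B"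
  shows "op_bound A c"
  unfolding op_bound_def
proof (intro conjI allI impI)
  fix I J :: "nat set" and x y :: "nat \<Rightarrow> real"
  assume *: "finite I" "finite J" "\<forall>i. 0 \<le> x i" "\<forall>i. 0 \<le> y i"
  have "(\<Sum>i\<in>I. \<Sum>j\<in>J. y i * A i j * x j) \<le> (\<Sum>i\<in>I. \<Sum>j\<in>J. y i * B i j * x j)"
    using A * by (intro sum_mono mult_right_mono mult_left_mono) (auto simp: mle_def)
  also have "\<dots> \<le> c * L2_set y I * L2_set x J"
    using * by (intro op_boundD(2)[OF B]) auto
  finally show "(\<Sum>i\<in>I. \<Sum>j\<in>J. y i * A i j * x j) \<le> c * L2_set y I * L2_set x J" .
qed (fact A)

lemma op_bound_mtrans:
  assumes "op_bound A c"
  shows "op_bound (mtrans A) c"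
  unfolding op_bound_def
proof (intro conjI allI impI)
  show "nonneg_mat (mtrans A)"
    using op_boundD(1)[OF assms] by (simp add: nonneg_mat_def mtrans_def)
  fix I J :: "nat set" and x y :: "nat \<Rightarrow> real"
  assume *: "finite I" "finite J" "\<forall>i. 0 \<le> x i" "\<forall>i. 0 \<le> y i"
  have "(\<Sum>i\<in>I. \<Sum>j\<in>J. y i * mtrans A i j * x j) = (\<Sum>j\<in>J. \<Sum>i\<in>I. x j * A j i * y i)"
    unfolding mtrans_def by (subst sum.swap) (simp add: mult_ac)
  also have "\<dots> \<le> c * L2_set x J * L2_set y I"
    using * by (intro op_boundD(2)[OF assms]) auto
  finally show "(\<Sum>i\<in>I. \<Sum>j\<in>J. y i * mtrans A i j * x j) \<le> c * L2_set y I * L2_set x J"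
    by (simp add: mult_ac)
qed

lemma op_bound_add:
  assumes A: "op_bound A c" and B: "op_bound B d"
  shows "op_bound (\<lambda>i j. A i j + B i j) (c + d)"
  unfolding op_bound_def
proof (intro conjI allI impI)
  show "nonneg_mat (\<lambda>i j. A i j + B i j)"
    using op_boundD(1)[OF A] op_boundD(1)[OF B] by (simp add: nonneg_mat_def)
  fix I J :: "nat set" and x y :: "nat \<Rightarrow> real"
  assume *: "finite I" "finite J" "\<forall>i. 0 \<le> x i" "\<forall>i. 0 \<le> y i"
  have "(\<Sum>i\<in>I. \<Sum>j\<in>J. y i * (A i j + B i j) * x j)
      = (\<Sum>i\<in>I. \<Sum>j\<in>J. y i * A i j * x j) + (\<Sum>i\<in>I. \<Sum>j\<in>J. y i * B i j * x j)"
    by (simp add: algebra_simps sum.distrib)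
  also have "\<dots> \<le> c * L2_set y I * L2_set x J + d * L2_set y I * L2_set x J"
    using * by (intro add_mono op_boundD(2)[OF A] op_boundD(2)[OF B]) auto
  finally show "(\<Sum>i\<in>I. \<Sum>j\<in>J. y i * (A i j + B i j) * x j) \<le> (c + d) * L2_set y I * L2_set x J"
    by (simp add: algebra_simps)
qed

lemma op_bound_scale:
  assumes A: "op_bound A c" and t: "0 \<le> t"
  shows "op_bound (\<lambda>i j. t * A i j) (t * c)"
  unfolding op_bound_def
proof (intro conjI allI impI)
  show "nonneg_mat (\<lambda>i j. t * A i j)"
    using op_boundD(1)[OF A] t by (simp add: nonneg_mat_def)
  fix I J :: "nat set" and x y :: "nat \<Rightarrow> real"
  assume *: "finite I" "finite J" "\<forall>i. 0 \<le> x i" "\<forall>i. 0 \<le> y i"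
  have "(\<Sum>i\<in>I. \<Sum>j\<in>J. y i * (t * A i j) * x j) = t * (\<Sum>i\<in>I. \<Sum>j\<in>J. y i * A i j * x j)"
    by (simp add: sum_distrib_left mult_ac)
  also have "\<dots> \<le> t * (c * L2_set y I * L2_set x J)"
    using * t by (intro mult_left_mono op_boundD(2)[OF A]) auto
  finally show "(\<Sum>i\<in>I. \<Sum>j\<in>J. y i * (t * A i j) * x j) \<le> t * c * L2_set y I * L2_set x J"
    by (simp add: mult_ac)
qed

lemma op_bound_zero: "op_bound (\<lambda>i j. 0) 0"
  by (simp add: op_bound_def nonneg_mat_def)

lemma op_bound_sum:
  assumes "finite F" "\<And>l. l \<in> F \<Longrightarrow> op_bound (A l) (c l)"
  shows "op_bound (\<lambda>i j. \<Sum>l\<in>F. A l i j) (\<Sum>l\<in>F. c l)"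
  using assms by (induction F rule: finite_induct) (auto intro: op_bound_zero op_bound_add)

text \<open>Testing the bilinear form with y = A x itself bounds the square of the norm of A x by
  that norm times \<open>c * L2_set x J\<close>; one factor cancels unless it is zero.\<close>

lemma op_bound_apply_finite:
  assumes A: "op_bound A c" and IJ: "finite I" "finite J" and x: "\<And>j. 0 \<le> x j"
  shows "L2_set (\<lambda>i. \<Sum>j\<in>J. A i j * x j) I \<le> c * L2_set x J"
proof -
  define w where "w i = (\<Sum>j\<in>J. A i j * x j)" for i
  have w: "0 \<le> w i" for i
    unfolding w_def by (intro sum_nonneg mult_nonneg_nonneg x op_boundD(3)[OF A])
  have "(L2_set w I)\<^sup>2 = (\<Sum>i\<in>I. w i * w i)"
    unfolding L2_set_def by (simp add: sum_nonneg power2_eq_square)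
  also have "\<dots> = (\<Sum>i\<in>I. \<Sum>j\<in>J. w i * A i j * x j)"
    by (rule sum.cong[OF refl], subst (2) w_def) (simp add: sum_distrib_left mult_ac)
  also have "\<dots> \<le> c * L2_set w I * L2_set x J"
    by (intro op_boundD(2)[OF A] IJ x w)
  finally have "L2_set w I * L2_set w I \<le> L2_set w I * (c * L2_set x J)"
    by (simp add: power2_eq_square mult_ac)
  then have "L2_set w I = 0 \<or> L2_set w I \<le> c * L2_set x J"
    using L2_set_nonneg[of w I] by (auto simp: mult_le_cancel_left order.order_iff_strict)
  then show ?thesis
    using op_bound_nonneg[OF A] unfolding w_def[symmetric] by auto
qed

lemma op_boundI_finite:
  assumes A: "nonneg_mat A"
    and le: "\<And>I J x. finite I \<Longrightarrow> finite J \<Longrightarrow> (\<And>j. 0 \<le> x j) \<Longrightarrow>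
      L2_set (\<lambda>i. \<Sum>j\<in>J. A i j * x j) I \<le> c * L2_set x J"
  shows "op_bound A c"
  unfolding op_bound_def
proof (intro conjI allI impI)
  fix I J :: "nat set" and x y :: "nat \<Rightarrow> real"
  assume *: "finite I" "finite J" "\<forall>i. 0 \<le> x i" "\<forall>i. 0 \<le> y i"
  define w where "w i = (\<Sum>j\<in>J. A i j * x j)" for i
  have w: "0 \<le> w i" for i
    unfolding w_def using * A by (intro sum_nonneg mult_nonneg_nonneg) (auto simp: nonneg_mat_def)
  have "(\<Sum>i\<in>I. \<Sum>j\<in>J. y i * A i j * x j) = (\<Sum>i\<in>I. \<bar>y i\<bar> * \<bar>w i\<bar>)"
    using * w by (simp add: w_def sum_distrib_left mult_ac)
  also have "\<dots> \<le> L2_set y I * L2_set w I"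
    by (rule L2_set_mult_ineq)
  also have "\<dots> \<le> L2_set y I * (c * L2_set x J)"
    unfolding w_def using * by (intro mult_left_mono le) auto
  finally show "(\<Sum>i\<in>I. \<Sum>j\<in>J. y i * A i j * x j) \<le> c * L2_set y I * L2_set x J"
    by (simp add: mult_ac)
qed (fact A)

lemma mapp_finite_support:
  fixes x :: "nat \<Rightarrow> 'a::banach"
  shows "finite J \<Longrightarrow> (\<And>j. j \<notin> J \<Longrightarrow> x j = 0) \<Longrightarrow> mapp A x i = (\<Sum>j\<in>J. A i j *\<^sub>R x j)"
  unfolding mapp_def by (rule suminf_finite) auto

lemma op_boundI_l2:
  assumes A: "nonneg_mat A"
    and le: "\<And>(x :: nat \<Rightarrow> real) J. (\<And>j. 0 \<le> x j) \<Longrightarrow> finite J \<Longrightarrow> (\<And>j. j \<notin> J \<Longrightarrow> x j = 0) \<Longrightarrow>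
      l2 (mapp A x) \<and> l2norm (mapp A x) \<le> c * l2norm x"
  shows "op_bound A c"
proof (rule op_boundI_finite[OF A])
  fix I J :: "nat set" and x :: "nat \<Rightarrow> real"
  assume *: "finite I" "finite J" "\<And>j. 0 \<le> x j"
  define x' where "x' j = (if j \<in> J then x j else 0)" for j
  have x': "mapp A x' = (\<lambda>i. \<Sum>j\<in>J. A i j * x j)"
    using mapp_finite_support[OF *(2), where x = x' and A = A] by (auto simp: x'_def fun_eq_iff)
  have 1: "l2 (mapp A x')" "l2norm (mapp A x') \<le> c * l2norm x'"
    using le[of x' J] * by (auto simp: x'_def)
  have 2: "l2norm x' = L2_set x J"
    using l2norm_finite_support[of J x'] * by (auto simp: x'_def intro!: L2_set_cong)
  have "L2_set (\<lambda>i. mapp A x' i) I \<le> l2norm (mapp A x')"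
    using L2_set_le_l2norm[OF 1(1), of I] * A
    by (simp add: x' sum_nonneg nonneg_mat_def)
  with 1 2 show "L2_set (\<lambda>i. \<Sum>j\<in>J. A i j * x j) I \<le> c * L2_set x J"
    unfolding x' by simp
qed

text \<open>Entries are nonnegative, so each partial sum of A x is bounded in norm by the same
  partial sum for the norms of the coordinates of x. Everything reduces to nonnegative vectors on
  finite sections.\<close>

lemma
  fixes x :: "nat \<Rightarrow> 'a::banach"
  assumes A: "op_bound A c" and x: "l2 x"
  shows summable_mapp: "summable (\<lambda>j. norm (A i j *\<^sub>R x j))"
    and l2_mapp: "l2 (mapp A x)"
    and l2norm_mapp: "l2norm (mapp A x) \<le> c * l2norm x"
proof -
  note A0 = op_boundD(3)[OF A]
  have fin: "L2_set (\<lambda>i. \<Sum>j<m. A i j * norm (x j)) I \<le> c * l2norm x" if "finite I" for I m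
    by (rule order_trans[OF op_bound_apply_finite[OF A that]])
      (auto intro!: mult_left_mono L2_set_le_l2norm x op_bound_nonneg[OF A])
  have s: "summable (\<lambda>j. norm (A i j *\<^sub>R x j))" for i
  proof (rule bounded_imp_summable[of _ "c * l2norm x"])
    fix n
    show "(\<Sum>j\<le>n. norm (A i j *\<^sub>R x j)) \<le> c * l2norm x"
      using fin[of "{i}" "Suc n"] A0 by (simp add: sum_nonneg lessThan_Suc_atMost)
  qed auto
  then show "summable (\<lambda>j. norm (A i j *\<^sub>R x j))" .
  have "L2_set (\<lambda>i. norm (mapp A x i)) {..<n} \<le> c * l2norm x" for n
  proof -
    have "(\<lambda>m. L2_set (\<lambda>i. norm (\<Sum>j<m. A i j *\<^sub>R x j)) {..<n}) \<longlonglongrightarrow> L2_set (\<lambda>i. norm (mapp A x i)) {..<n}"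
      unfolding L2_set_def mapp_def
      by (intro tendsto_real_sqrt tendsto_sum tendsto_power tendsto_norm summable_LIMSEQ)
        (use summable_norm_cancel[OF s] in auto)
    moreover have "L2_set (\<lambda>i. norm (\<Sum>j<m. A i j *\<^sub>R x j)) {..<n} \<le> c * l2norm x" for m
      by (rule order_trans[OF L2_set_mono fin[of "{..<n}" m]])
        (auto intro!: order_trans[OF norm_sum] simp: A0)
    ultimately show ?thesis
      by (intro LIMSEQ_le_const2) auto
  qed
  then show "l2 (mapp A x)" "l2norm (mapp A x) \<le> c * l2norm x"
    by (auto intro: l2I)
qed

lemma mapp_add:
  assumes A: "op_bound A c" "l2 x" "l2 y"
  shows "mapp A (\<lambda>j. x j + y j) i = mapp A x i + mapp A y i"
  unfolding mapp_def
  using suminf_add[OF summable_norm_cancel[OF summable_mapp[OF A(1,2)]] summable_norm_cancel[OF summable_mapp[OF A(1,3)]]]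
  by (simp add: scaleR_right_distrib)

lemma mapp_mult:
  fixes x :: "nat \<Rightarrow> 'a::{banach, real_normed_field}"
  assumes A: "op_bound A c" "l2 x"
  shows "mapp A (\<lambda>j. t * x j) i = t * mapp A x i"
  unfolding mapp_def
  using suminf_mult[OF summable_norm_cancel[OF summable_mapp[OF A]], of t]
  by simp

lemma l2_col:
  assumes "op_bound A c"
  shows "l2 (\<lambda>i. A i j)"
proof -
  have *: "L2_set (\<lambda>i. norm (A i j)) {..<n} \<le> c" for n
    using op_bound_apply_finite[OF assms, of "{..<n}" "{j}" "\<lambda>_. 1"] op_boundD(3)[OF assms] by simp
  from l2I(1)[OF *] show ?thesis .
qed

lemma summable_mmult: "op_bound A c \<Longrightarrow> op_bound B d \<Longrightarrow> summable (\<lambda>j. A i j * B j k)"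
  using summable_norm_cancel[OF summable_mapp[OF _ l2_col]] by fastforce

text \<open>An exchange of two infinite sums. Its absolute convergence is that of A applied to B
  applied to the norms of the coordinates of x.\<close>

lemma mapp_mmult:
  fixes x :: "nat \<Rightarrow> 'a::banach"
  assumes A: "op_bound A c" and B: "op_bound B d" and x: "l2 x"
  shows "mapp (mmult A B) x = mapp A (mapp B x)"
proof
  fix i
  note A0 = op_boundD(3)[OF A] and B0 = op_boundD(3)[OF B]
  have xn: "l2 (\<lambda>j. norm (x j))"
    using x by (simp add: l2_norm_iff)
  have s: "summable (\<lambda>k. B j k *\<^sub>R x k)" for j
    by (rule summable_norm_cancel[OF summable_mapp[OF B x]])
  have s1: "summable (\<lambda>k. norm ((A i j * B j k) *\<^sub>R x k))" for j
    using summable_mult[OF summable_mapp[OF B x, of j], of "A i j"] A0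
    by (simp add: abs_mult mult_ac)
  have e: "(\<Sum>k. norm ((A i j * B j k) *\<^sub>R x k)) = A i j * mapp B (\<lambda>k. norm (x k)) j" for j
    using suminf_mult[OF summable_mapp[OF B x, of j], of "A i j"] A0 B0
    by (simp add: mapp_def mult_ac)
  have s2: "summable (\<lambda>j. \<Sum>k. norm ((A i j * B j k) *\<^sub>R x k))"
    unfolding e using summable_norm_cancel[OF summable_mapp[OF A l2_mapp[OF B xn], of i]] by simp
  have "mapp A (mapp B x) i = (\<Sum>j. \<Sum>k. (A i j * B j k) *\<^sub>R x k)"
    unfolding mapp_def using bounded_linear.suminf[OF bounded_linear_scaleR_right s] by simp
  also have "\<dots> = (\<Sum>k. \<Sum>j. (A i j * B j k) *\<^sub>R x k)"
    by (rule suminf_swap_banach[OF s1 s2])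
  also have "\<dots> = mapp (mmult A B) x i"
    unfolding mapp_def mmult_def
    by (simp add: bounded_linear.suminf[OF bounded_linear_scaleR_left summable_mmult[OF A B]])
  finally show "mapp (mmult A B) x i = mapp A (mapp B x) i" by simp
qed

lemma op_bound_mmult:
  assumes A: "op_bound A c" and B: "op_bound B d"
  shows "op_bound (mmult A B) (c * d)"
proof (rule op_boundI_l2)
  show "nonneg_mat (mmult A B)"
    unfolding nonneg_mat_def mmult_def
    by (auto intro!: suminf_nonneg summable_mmult[OF A B] mult_nonneg_nonneg op_boundD(3)[OF A] op_boundD(3)[OF B])
  fix x :: "nat \<Rightarrow> real" and J
  assume "finite J" "\<And>j. j \<notin> J \<Longrightarrow> x j = 0"
  then have x: "l2 x" by (intro l2_finite_support[of J]) auto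
  have "l2norm (mapp A (mapp B x)) \<le> c * (d * l2norm x)"
    by (rule order_trans[OF l2norm_mapp[OF A l2_mapp[OF B x]]])
      (intro mult_left_mono l2norm_mapp[OF B x] op_bound_nonneg[OF A])
  then show "l2 (mapp (mmult A B) x) \<and> l2norm (mapp (mmult A B) x) \<le> c * d * l2norm x"
    unfolding mapp_mmult[OF A B x] using l2_mapp[OF A l2_mapp[OF B x]] by (simp add: mult_ac)
qed

text \<open>Products of infinite matrices need not associate; boundedness justifies exchanging the
  sums, which is why bounds accompany all the algebra below. The columns of C are square-summable,
  so \<open>mapp_mmult\<close> applies to each of them.\<close>

lemma mmult_assoc:
  assumes A: "op_bound A c" and B: "op_bound B d" and C: "op_bound C e"
  shows "mmult (mmult A B) C = mmult A (mmult B C)"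
proof (intro ext)
  fix i k
  have "mmult (mmult A B) C i k = mapp A (mapp B (\<lambda>j. C j k)) i"
    by (simp add: mmult_eq_mapp[of _ C] mapp_mmult[OF A B l2_col[OF C]])
  also have "mapp B (\<lambda>j. C j k) = (\<lambda>j. mmult B C j k)"
    by (simp add: fun_eq_iff mmult_eq_mapp)
  finally show "mmult (mmult A B) C i k = mmult A (mmult B C) i k"
    by (simp add: mmult_eq_mapp[of A _ i])
qed

lemma mmult_mono:
  assumes AB: "op_bound A c" "op_bound B d" "op_bound A' c'" "op_bound B' d'"
    and le: "mle A A'" "mle B B'"
  shows "mle (mmult A B) (mmult A' B')"
  unfolding mle_def mmult_def
  using le op_boundD(3)[OF AB(1)] op_boundD(3)[OF AB(2)] op_boundD(3)[OF AB(3)]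
  by (auto simp: mle_def intro!: suminf_le mult_mono summable_mmult[OF AB(1,2)] summable_mmult[OF AB(3,4)])

lemma mmult_add_left:
  assumes "op_bound A c" "op_bound B d" "op_bound C e"
  shows "mmult (\<lambda>i j. A i j + B i j) C = (\<lambda>i j. mmult A C i j + mmult B C i j)"
  unfolding mmult_def
  using suminf_add[OF summable_mmult[OF assms(1,3)] summable_mmult[OF assms(2,3)]]
  by (auto simp: fun_eq_iff distrib_right)

lemma mmult_add_right:
  assumes "op_bound A c" "op_bound B d" "op_bound C e"
  shows "mmult C (\<lambda>i j. A i j + B i j) = (\<lambda>i j. mmult C A i j + mmult C B i j)"
  unfolding mmult_def
  using suminf_add[OF summable_mmult[OF assms(3,1)] summable_mmult[OF assms(3,2)]]
  by (auto simp: fun_eq_iff distrib_left)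

lemma mmult_scale_right:
  assumes "op_bound A c" "op_bound B d"
  shows "mmult A (\<lambda>i j. t * B i j) = (\<lambda>i j. t * mmult A B i j)"
  unfolding mmult_def using suminf_mult[OF summable_mmult[OF assms], of t]
  by (auto simp: fun_eq_iff mult_ac)

lemma mmult_scale_left:
  assumes "op_bound A c" "op_bound B d"
  shows "mmult (\<lambda>i j. t * A i j) B = (\<lambda>i j. t * mmult A B i j)"
  unfolding mmult_def using suminf_mult[OF summable_mmult[OF assms], of t]
  by (auto simp: fun_eq_iff mult_ac)

lemma mtrans_mmult: "mtrans (mmult A B) = mmult (mtrans B) (mtrans A)"
  by (auto simp: mtrans_def mmult_def fun_eq_iff mult_ac)

lemma mtrans_mtrans [simp]: "mtrans (mtrans A) = A"
  by (simp add: mtrans_def)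

lemma mtrans_id [simp]: "mtrans id_mat = id_mat"
  by (auto simp: mtrans_def id_mat_def fun_eq_iff)

lemma mmult_id_right [simp]: "mmult A id_mat = A"
proof (intro ext)
  fix i k
  show "mmult A id_mat i k = A i k"
    unfolding mmult_def id_mat_def
    by (subst suminf_finite[of "{k}"]) auto
qed

lemma mmult_id_left [simp]: "mmult id_mat A = A"
proof (intro ext)
  fix i k
  show "mmult id_mat A i k = A i k"
    unfolding mmult_def id_mat_def
    by (subst suminf_finite[of "{i}"]) auto
qed

lemma op_bound_id: "op_bound id_mat 1"
proof (rule op_boundI_l2)
  show "nonneg_mat id_mat" by (simp add: nonneg_mat_def id_mat_def)
  fix x :: "nat \<Rightarrow> real" and J
  assume "finite J" "\<And>j. j \<notin> J \<Longrightarrow> x j = 0"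
  moreover have "mapp id_mat x = x"
  proof
    fix i show "mapp id_mat x i = x i"
      unfolding mapp_def id_mat_def by (subst suminf_finite[of "{i}"]) auto
  qed
  ultimately show "l2 (mapp id_mat x) \<and> l2norm (mapp id_mat x) \<le> 1 * l2norm x"
    using l2_finite_support[of J x] by simp
qed

text \<open>Positivity replaces the uniform boundedness principle here: if unit vectors \<open>x\<^sub>n \<ge> 0\<close> had
  images of norm above \<open>4\<^sup>n\<close>, then the image of \<open>\<Sum>n. 2\<^sup>-\<^sup>n x\<^sub>n\<close> would dominate all of \<open>2\<^sup>-\<^sup>n A x\<^sub>n\<close>.\<close>

lemma defines_op_imp_op_bound:
  assumes A: "nonneg_mat A" "defines_op A"
  shows "\<exists>c. op_bound A c"
proof (rule ccontr)
  assume no: "\<not> ?thesis"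
  have A0: "0 \<le> A i j" for i j
    using A by (simp add: nonneg_mat_def)
  have D1: "summable (\<lambda>j. A i j * x j)" if "l2 x" for x i
    using A(2)[unfolded defines_op_def, rule_format, OF that]
    by (blast intro: summable_rabs_cancel)
  have D2: "l2 (mapp A x)" if "l2 x" for x :: "nat \<Rightarrow> real"
    using A(2)[unfolded defines_op_def, rule_format, OF that] by (simp add: mat_app_eq_mapp)
  have "\<exists>x :: nat \<Rightarrow> real. (\<forall>j. 0 \<le> x j) \<and> l2 x \<and> l2norm x \<le> (1/2)^n \<and> 2^n < l2norm (mapp A x)" for n :: nat
  proof -
    have "\<exists>(x :: nat \<Rightarrow> real) J. (\<forall>j. 0 \<le> x j) \<and> finite J \<and> (\<forall>j. j \<notin> J \<longrightarrow> x j = 0) \<and>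
        \<not> (l2 (mapp A x) \<and> l2norm (mapp A x) \<le> 4^n * l2norm x)"
    proof (rule ccontr)
      assume neg: "\<not> ?thesis"
      have "op_bound A (4^n)"
      proof (rule op_boundI_l2[OF A(1)])
        fix x :: "nat \<Rightarrow> real" and J :: "nat set"
        assume *: "\<And>j. 0 \<le> x j" "finite J" "\<And>j. j \<notin> J \<Longrightarrow> x j = 0"
        show "l2 (mapp A x) \<and> l2norm (mapp A x) \<le> 4^n * l2norm x"
        proof (rule ccontr)
          assume **: "\<not> ?thesis"
          show False
            by (rule notE[OF neg], rule exI[of _ x], rule exI[of _ J]) (intro conjI allI impI * **)
        qed
      qed
      with no show False by blast
    qed
    then obtain x :: "nat \<Rightarrow> real" and J where X: "(\<forall>j. 0 \<le> x j) \<and> finite J \<and> (\<forall>j. j \<notin> J \<longrightarrow> x j = 0) \<and>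
        \<not> (l2 (mapp A x) \<and> l2norm (mapp A x) \<le> 4^n * l2norm x)"
      by (elim exE)
    from X have x: "\<And>j. 0 \<le> x j" "finite J" "\<And>j. j \<notin> J \<Longrightarrow> x j = 0"
      by simp_all
    from X have neg: "\<not> (l2 (mapp A x) \<and> l2norm (mapp A x) \<le> 4^n * l2norm x)"
      by (elim conjE)
    have l: "l2 x"
      using x by (intro l2_finite_support[of J]) auto
    have gt: "4^n * l2norm x < l2norm (mapp A x)"
      using neg D2[OF l] by (simp add: not_le)
    have pos: "0 < l2norm x"
    proof (rule ccontr)
      assume "\<not> ?thesis"
      then have "x j = 0" for j
        using l2norm_eq_0D[OF l, of j] by simp
      then have "mapp A x = (\<lambda>i. 0)"
        by (simp add: mapp_def)
      then show False
        using gt l2norm_nonneg[OF l] by (simp add: mult_less_0_iff)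
    qed
    define t where "t = (1/2)^n / l2norm x"
    have t: "0 < t" using pos by (simp add: t_def)
    have m: "mapp A (\<lambda>j. t * x j) = (\<lambda>i. t * mapp A x i)"
      unfolding mapp_def using suminf_mult[OF D1[OF l], of t] by (simp add: mult_ac)
    have "t * (4^n * l2norm x) = ((1/2) * 4)^n"
      unfolding power_mult_distrib using pos by (simp add: t_def)
    then have "2^n = t * (4^n * l2norm x)"
      by simp
    also have "\<dots> < t * l2norm (mapp A x)"
      using gt t by simp
    also have "\<dots> = l2norm (mapp A (\<lambda>j. t * x j))"
      using t by (simp add: m l2norm_mult[OF D2[OF l]])
    finally have r1: "2^n < l2norm (mapp A (\<lambda>j. t * x j))" .
    have r2: "l2norm (\<lambda>j. t * x j) \<le> (1/2)^n"
      using t pos by (simp add: l2norm_mult[OF l]) (simp add: t_def)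
    have r3: "\<forall>j. 0 \<le> t * x j"
      using x(1) t by simp
    show ?thesis
      by (rule exI[of _ "\<lambda>j. t * x j"]) (intro conjI r1 r2 r3 l2_mult[OF l])
  qed
  then have "\<forall>n. \<exists>x :: nat \<Rightarrow> real. (\<forall>j. 0 \<le> x j) \<and> l2 x \<and> l2norm x \<le> (1/2)^n \<and> 2^n < l2norm (mapp A x)"
    by (rule allI)
  from choice[OF this] obtain x :: "nat \<Rightarrow> nat \<Rightarrow> real" where X: "\<forall>n. (\<forall>j. 0 \<le> x n j) \<and> l2 (x n) \<and>
      l2norm (x n) \<le> (1/2)^n \<and> 2^n < l2norm (mapp A (x n))" by (elim exE)
  have x: "\<And>n j. 0 \<le> x n j" "\<And>n. l2 (x n)" "\<And>n. l2norm (x n) \<le> (1/2)^n"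
    and big: "\<And>n. 2^n < l2norm (mapp A (x n))" using X by auto
  have sg: "summable (\<lambda>n. (1/2)^n :: real)" by (simp add: summable_geometric)
  define z where "z j = (\<Sum>n. x n j)" for j
  have z: "l2 z"
    unfolding z_def by (rule l2_series[OF x(2,3) sg])
  have xz: "x n j \<le> z j" for n j
    using sum_le_suminf[OF summable_norm_cancel[OF summable_l2_series[OF x(2,3) sg]], of "{n}" j] x(1)
    by (simp add: z_def)
  have "l2norm (mapp A (x n)) \<le> l2norm (mapp A z)" for n
  proof (rule l2norm_mono[OF D2[OF z]])
    fix i
    have "0 \<le> mapp A (x n) i" "mapp A (x n) i \<le> mapp A z i"
      unfolding mapp_def using D1[OF x(2)[of n], of i] D1[OF z, of i] A0 x(1) xz
      by (auto intro!: suminf_nonneg suminf_le mult_left_mono)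
    then show "norm (mapp A (x n) i) \<le> norm (mapp A z i)" by simp
  qed
  then have "2^n < l2norm (mapp A z)" for n
    by (rule less_le_trans[OF big])
  moreover obtain n :: nat where "l2norm (mapp A z) < 2^n"
    using real_arch_pow[of 2 "l2norm (mapp A z)"] by auto
  ultimately show False
    by (metis less_asym)
qed

definition bop :: "mat \<Rightarrow> bool" where
  "bop A \<longleftrightarrow> (\<exists>c. op_bound A c)"

text \<open>\<open>opnorm\<close> and \<open>gamma\<close> see only the unit ball. Homogeneity of
  \<open>mapp\<close>, which \<open>bop A\<close> provides, carries the bound to all
  vectors.\<close>

lemma op_boundI_unit:
  assumes A: "nonneg_mat A" "0 \<le> c" and bop: "bop A"
    and le: "\<And>x :: nat \<Rightarrow> real. (\<And>j. 0 \<le> x j) \<Longrightarrow> l2 x \<Longrightarrow> l2norm x \<le> 1 \<Longrightarrow> l2norm (mapp A x) \<le> c"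
  shows "op_bound A c"
proof (rule op_boundI_l2[OF A(1)])
  from bop obtain d where d: "op_bound A d" by (auto simp: bop_def)
  fix x :: "nat \<Rightarrow> real" and J
  assume J: "\<And>j. 0 \<le> x j" "finite J" "\<And>j. j \<notin> J \<Longrightarrow> x j = 0"
  then have x: "l2 x" by (intro l2_finite_support[of J]) auto
  have "l2norm (mapp A x) \<le> c * l2norm x"
  proof (cases "l2norm x = 0")
    case True
    then show ?thesis
      using l2norm_mapp[OF d x] by simp
  next
    case False
    then have pos: "0 < l2norm x"
      using l2norm_nonneg[OF x] by simp
    define t where "t = inverse (l2norm x)"
    have t: "0 < t" using pos by (simp add: t_def)
    have "l2norm (mapp A (\<lambda>j. t * x j)) \<le> c"
      using t J(1) pos by (intro le) (simp_all add: l2_mult[OF x] l2norm_mult[OF x], simp add: t_def)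
    moreover have "mapp A (\<lambda>j. t * x j) = (\<lambda>i. t * mapp A x i)"
      by (rule ext) (rule mapp_mult[OF d x])
    ultimately have "t * l2norm (mapp A x) \<le> c"
      using t l2norm_mult[OF l2_mapp[OF d x], of t] by simp
    then show ?thesis
      using pos by (simp add: t_def field_simps)
  qed
  then show "l2 (mapp A x) \<and> l2norm (mapp A x) \<le> c * l2norm x"
    using l2_mapp[OF d x] by simp
qed

text \<open>\<open>opnorm\<close> is a supremum of reals and informative only for a set bounded
  above; the a priori bound \<open>c\<close>, however large, supplies this.\<close>

lemma op_bound_opnorm:
  assumes A: "op_bound A c"
  shows "op_bound A (opnorm A)"
proof (rule op_boundI_unit)
  let ?N = "{l2norm (mat_app A x) |x. l2 x \<and> l2norm x \<le> 1}"
  have bdd: "bdd_above ?N"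
  proof (rule bdd_aboveI[of _ c])
    fix t assume "t \<in> ?N"
    then obtain x :: "nat \<Rightarrow> real" where x: "t = l2norm (mapp A x)" "l2 x" "l2norm x \<le> 1"
      by (auto simp: mat_app_eq_mapp)
    then show "t \<le> c"
      using l2norm_mapp[OF A x(2)] mult_left_mono[OF x(3) op_bound_nonneg[OF A]] by simp
  qed
  show le: "l2norm (mapp A x) \<le> opnorm A" if "l2 x" "l2norm x \<le> 1" for x :: "nat \<Rightarrow> real"
    unfolding opnorm_def by (rule cSup_upper[OF _ bdd]) (use that in \<open>auto simp: mat_app_eq_mapp\<close>)
  show "0 \<le> opnorm A"
    using le[of "\<lambda>i. 0"] l2norm_nonneg[OF l2_mapp[OF A l2_zero, where 'a = real]] by simp
qed (use A op_boundD(1) in \<open>auto simp: bop_def\<close>)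

definition bdd_mats :: "mat set \<Rightarrow> bool" where
  "bdd_mats S \<longleftrightarrow> (\<exists>M. \<forall>A\<in>S. op_bound A M)"

lemma bounded_op_set_imp_bdd_mats:
  assumes "bounded_op_set S"
  shows "bdd_mats S"
proof -
  obtain M where "\<forall>A\<in>S. opnorm A \<le> M" and S: "\<And>A. A \<in> S \<Longrightarrow> nonneg_mat A \<and> defines_op A"
    using assms unfolding bounded_op_set_def by blast
  then have "op_bound A M" if "A \<in> S" for A
    using op_bound_weaken[OF op_bound_opnorm] defines_op_imp_op_bound[of A] that by blast
  then show ?thesis
    unfolding bdd_mats_def by blast
qed

section \<open>The Hausdorff measure of noncompactness as an asymptotic norm\<close>

text \<open>Three forms of the tail with the same limit of norms. The corner \<open>cortl\<close> is
  the smallest and is compatible with transposition, so upper bounds for \<open>gamma\<close> ask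
  only for it. \<open>rowtl\<close> differs from A by finitely many rows and commutes with
  multiplication from the right.\<close>

definition rowtl :: "nat \<Rightarrow> mat \<Rightarrow> mat" where
  "rowtl N A = (\<lambda>i j. if N \<le> i then A i j else 0)"

definition coltl :: "nat \<Rightarrow> mat \<Rightarrow> mat" where
  "coltl N A = (\<lambda>i j. if N \<le> j then A i j else 0)"

definition cortl :: "nat \<Rightarrow> mat \<Rightarrow> mat" where
  "cortl N A = (\<lambda>i j. if N \<le> i \<and> N \<le> j then A i j else 0)"

lemma bop_nonneg: "bop A \<Longrightarrow> 0 \<le> A i j"
  using op_boundD(3) by (auto simp: bop_def)

lemma bop_nonneg_mat: "bop A \<Longrightarrow> nonneg_mat A"
  using op_boundD(1) by (auto simp: bop_def)

lemma bopI: "op_bound A c \<Longrightarrow> bop A"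
  by (auto simp: bop_def)

lemma bop_mmult: "bop A \<Longrightarrow> bop B \<Longrightarrow> bop (mmult A B)"
  unfolding bop_def by (blast intro: op_bound_mmult)

lemma bop_mtrans: "bop A \<Longrightarrow> bop (mtrans A)"
  using op_bound_mtrans by (auto simp: bop_def)

lemma bop_mono: "bop B \<Longrightarrow> nonneg_mat A \<Longrightarrow> mle A B \<Longrightarrow> bop A"
  using op_bound_mono by (auto simp: bop_def)

lemma bop_add: "bop A \<Longrightarrow> bop B \<Longrightarrow> bop (\<lambda>i j. A i j + B i j)"
  unfolding bop_def by (blast intro: op_bound_add)

lemma bop_scale: "bop A \<Longrightarrow> 0 \<le> t \<Longrightarrow> bop (\<lambda>i j. t * A i j)"
  using op_bound_scale by (auto simp: bop_def)

lemma bop_id: "bop id_mat"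
  using op_bound_id by (rule bopI)

lemma bop_tails: "bop A \<Longrightarrow> bop (rowtl N A)" "bop A \<Longrightarrow> bop (coltl N A)" "bop A \<Longrightarrow> bop (cortl N A)"
  using bop_nonneg[of A]
  by (auto elim!: bop_mono simp: nonneg_mat_def mle_def rowtl_def coltl_def cortl_def)

lemma op_bound_single_column:
  assumes A: "nonneg_mat A" "\<And>i j. j \<noteq> k \<Longrightarrow> A i j = 0"
    and c: "l2 (\<lambda>i. A i k)" "l2norm (\<lambda>i. A i k) \<le> c"
  shows "op_bound A c"
proof (rule op_boundI_finite[OF A(1)])
  fix I J :: "nat set" and x :: "nat \<Rightarrow> real"
  assume *: "finite I" "finite J" "\<And>j. 0 \<le> x j"
  have c0: "0 \<le> c" using l2norm_nonneg[OF c(1)] c(2) by simp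
  show "L2_set (\<lambda>i. \<Sum>j\<in>J. A i j * x j) I \<le> c * L2_set x J"
  proof (cases "k \<in> J")
    case True
    have "(\<Sum>j\<in>J. A i j * x j) = x k * A i k" for i
      using A(2) True * by (subst sum.mono_neutral_right[of J "{k}"]) auto
    then have "L2_set (\<lambda>i. \<Sum>j\<in>J. A i j * x j) I = x k * L2_set (\<lambda>i. A i k) I"
      using * by (simp add: L2_set_right_distrib)
    also have "\<dots> \<le> L2_set x J * c"
      using * True c0 order_trans[OF L2_set_le_l2norm[OF c(1), of I] c(2)] A(1)
      by (intro mult_mono member_le_L2_set) (auto simp: nonneg_mat_def)
    finally show ?thesis by (simp add: mult_ac)
  next
    case False
    then have "(\<Sum>j\<in>J. A i j * x j) = 0" for i
      using A(2) by (intro sum.neutral) (metis mult_zero_left)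
    then show ?thesis
      using c0 by (simp add: L2_set_def sum_nonneg)
  qed
qed

text \<open>Every column is square-summable and therefore has a small tail; the budget
  \<open>e\<close> is halved each time a column is split off.\<close>

lemma few_columns_tail_small:
  assumes A: "bop A" and e: "0 < e"
  shows "\<exists>L. op_bound (\<lambda>i j. if L \<le> i \<and> j < M then A i j else 0) e"
  using e
proof (induction M arbitrary: e)
  case 0
  then show ?case
    using op_bound_weaken[OF op_bound_zero, of e] by simp
next
  case (Suc M)
  from A obtain c where c: "op_bound A c" by (auto simp: bop_def)
  obtain L1 where L1: "op_bound (\<lambda>i j. if L1 \<le> i \<and> j < M then A i j else 0) (e / 2)"
    using Suc.IH[of "e / 2"] Suc.prems by auto
  obtain L2 where L2: "l2norm (\<lambda>i. if L2 \<le> i then A i M else 0) \<le> e / 2"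
    using l2_tail_small[OF l2_col[OF c], of "e / 2"] Suc.prems by (metis half_gt_zero order_refl)
  have "op_bound (\<lambda>i j. if L2 \<le> i \<and> j = M then A i j else 0) (e / 2)"
    using L2 bop_nonneg[OF A]
    by (intro op_bound_single_column[of _ M]) (auto simp: nonneg_mat_def intro: l2_mono[OF l2_col[OF c, of M]])
  from op_bound_add[OF L1 this]
  have "op_bound (\<lambda>i j. if max L1 L2 \<le> i \<and> j < Suc M then A i j else 0) (e / 2 + e / 2)"
    by (rule op_bound_mono) (use bop_nonneg[OF A] in \<open>auto simp: nonneg_mat_def mle_def less_Suc_eq\<close>)
  then show ?case by (intro exI[of _ "max L1 L2"]) simp
qed

text \<open>A row tail exceeds the corner only in the first M columns, and these are small far
  enough down. So the smallest tail is asymptotically as good as the largest.\<close>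

lemma op_bound_cortl_imp_rowtl:
  assumes A: "bop A" and c: "op_bound (cortl M A) c" and e: "0 < e"
  shows "\<exists>L. op_bound (rowtl L A) (c + e)"
proof -
  obtain L where "op_bound (\<lambda>i j. if L \<le> i \<and> j < M then A i j else 0) e"
    using few_columns_tail_small[OF A e] by blast
  from op_bound_add[OF c this] have "op_bound (rowtl (max L M) A) (c + e)"
    by (rule op_bound_mono) (use bop_nonneg[OF A] in \<open>auto simp: nonneg_mat_def mle_def rowtl_def cortl_def\<close>)
  then show ?thesis by blast
qed

section \<open>Finite nets and tails\<close>

definition covers :: "mat \<Rightarrow> real \<Rightarrow> (nat \<Rightarrow> real) set \<Rightarrow> bool" where
  "covers A e F \<longleftrightarrow> finite F \<and> (\<forall>y\<in>F. l2 y) \<and>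
      (\<forall>x. l2 x \<and> l2norm x \<le> 1 \<longrightarrow> (\<exists>y\<in>F. l2norm (\<lambda>i. mapp A x i - y i) \<le> e))"

lemma gamma_eq: "gamma A = Inf {e. 0 < e \<and> (\<exists>F. covers A e F)}"
  by (simp add: gamma_def covers_def mat_app_eq_mapp)

lemma mapp_rowtl: "mapp (rowtl N A) x = (\<lambda>i. if N \<le> i then mapp A x i else 0)"
  by (auto simp: mapp_def rowtl_def fun_eq_iff)

text \<open>The first L coordinates of the image of the unit ball form a bounded set in finite
  dimension and are covered by a grid; the coordinates from L on have norm at most
  \<open>c\<close>.\<close>

lemma covers_of_rowtl:
  assumes A: "op_bound A K" and c: "op_bound (rowtl L A) c" and d: "0 < d"
  shows "\<exists>F. covers A (c + d) F"
proof -
  \<comment> \<open>With this mesh the L coordinate errors add up to at most d; the added 1 keeps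
    the mesh positive for L = 0.\<close>
  define h where "h = d / (real L + 1)"
  have h: "0 < h" using d by (simp add: h_def)
  \<comment> \<open>Coordinates of the image lie in [-K, K], so the quotients by \<open>h\<close>
    round down to finitely many integers; the 1 absorbs the rounding.\<close>
  define B where "B = \<lceil>K / h\<rceil> + 1"
  define G where "G k i = (if i < L then h * real_of_int (k i) else 0)" for k :: "nat \<Rightarrow> int" and i
  define F where "F = G ` (PiE {..<L} (\<lambda>_. {-B..B}))"
  have "finite F"
    unfolding F_def by (intro finite_imageI finite_PiE) auto
  moreover have "l2 y" if "y \<in> F" for y
  proof -
    obtain k where "y = G k"
      using \<open>y \<in> F\<close> unfolding F_def by (elim imageE)
    then show ?thesis
      by (intro l2_finite_support[of "{..<L}"]) (simp_all add: G_def)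
  qed
  moreover have "\<exists>y\<in>F. l2norm (\<lambda>i. mapp A x i - y i) \<le> c + d" if x: "l2 x" "l2norm x \<le> 1" for x
  proof -
    define u where "u = mapp A x"
    have u: "l2 u" "l2norm u \<le> K"
      using l2_mapp[OF A x(1)] l2norm_mapp[OF A x(1)] mult_left_mono[OF x(2) op_bound_nonneg[OF A]]
      by (auto simp: u_def)
    define k where "k = restrict (\<lambda>i. \<lfloor>u i / h\<rfloor>) {..<L}"
    have "\<bar>u i\<bar> \<le> K" for i
      using order_trans[OF norm_le_l2norm[OF u(1)] u(2), of i] by simp
    then have "-K \<le> u i" "u i \<le> K" for i
      by (simp_all add: abs_le_iff minus_le_iff)
    then have *: "- (K / h) \<le> u i / h" "u i / h \<le> K / h" for i
      using divide_right_mono[of "-K" "u i" h] divide_right_mono[of "u i" K h] h by simp_all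
    have k: "k \<in> PiE {..<L} (\<lambda>_. {-B..B})"
    proof (rule PiE_I)
      fix i assume "i \<in> {..<L}"
      have "- \<lceil>K / h\<rceil> - 1 \<le> \<lfloor>u i / h\<rfloor>" "\<lfloor>u i / h\<rfloor> \<le> \<lceil>K / h\<rceil> + 1"
        using *[of i] by linarith+
      then show "k i \<in> {-B..B}"
        using \<open>i \<in> {..<L}\<close> by (simp add: k_def B_def)
    qed (simp add: k_def)
    have "l2norm (\<lambda>i. u i - G k i) = l2norm (\<lambda>i. mapp (rowtl L A) x i + (if i < L then u i - G k i else 0))"
      by (rule arg_cong[of _ _ l2norm]) (auto simp: mapp_rowtl u_def G_def fun_eq_iff)
    also have "\<dots> \<le> l2norm (mapp (rowtl L A) x) + l2norm (\<lambda>i. if i < L then u i - G k i else 0)"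
      by (rule l2norm_add[OF l2_mapp[OF c x(1)]]) (rule l2_finite_support[of "{..<L}"]; simp)
    also have "l2norm (mapp (rowtl L A) x) \<le> c"
      using l2norm_mapp[OF c x(1)] mult_left_mono[OF x(2) op_bound_nonneg[OF c]] by simp
    also have "l2norm (\<lambda>i. if i < L then u i - G k i else 0)
        = L2_set (\<lambda>i. norm (if i < L then u i - G k i else 0)) {..<L}"
      by (rule l2norm_finite_support) auto
    also have "\<dots> \<le> (\<Sum>i<L. norm (if i < L then u i - G k i else 0))"
      by (rule L2_set_le_sum) auto
    also have "\<dots> \<le> (\<Sum>i<L. h)"
    proof (rule sum_mono)
      fix i assume i: "i \<in> {..<L}"
      have "h * real_of_int \<lfloor>u i / h\<rfloor> \<le> h * (u i / h)" "h * (u i / h) \<le> h * (real_of_int \<lfloor>u i / h\<rfloor> + 1)"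
        using h by (intro mult_left_mono; linarith)+
      then have "h * real_of_int \<lfloor>u i / h\<rfloor> \<le> u i" "u i \<le> h * real_of_int \<lfloor>u i / h\<rfloor> + h"
        using h by (simp_all add: distrib_left)
      then show "norm (if i < L then u i - G k i else 0) \<le> h"
        using i h by (simp add: G_def k_def abs_le_iff)
    qed
    also have "\<dots> \<le> d"
      using d by (simp add: h_def field_simps)
    finally show ?thesis
      using k by (intro bexI[of _ "G k"]) (auto simp: u_def F_def)
  qed
  ultimately show ?thesis
    unfolding covers_def by blast
qed

lemma gamma_cover_set:
  assumes "bop A"
  shows "bdd_below {e. 0 < e \<and> (\<exists>F. covers A e F)}" and "{e. 0 < e \<and> (\<exists>F. covers A e F)} \<noteq> {}"
proof -
  show "bdd_below {e. 0 < e \<and> (\<exists>F. covers A e F)}"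
    by (rule bdd_belowI[of _ 0]) auto
  obtain K where K: "op_bound A K" using assms by (auto simp: bop_def)
  moreover have "op_bound (rowtl 0 A) K"
    using K by (simp add: rowtl_def)
  ultimately have "\<exists>F. covers A (K + 1) F"
    by (rule covers_of_rowtl) simp
  moreover have "0 < K + 1"
    using op_bound_nonneg[OF K] by simp
  ultimately show "{e. 0 < e \<and> (\<exists>F. covers A e F)} \<noteq> {}"
    by blast
qed

lemma gamma_nonneg: "bop A \<Longrightarrow> 0 \<le> gamma A"
  unfolding gamma_eq by (rule cInf_greatest[OF gamma_cover_set(2)]) auto

lemma gamma_leI:
  assumes A: "bop A" and c: "op_bound (cortl M A) c"
  shows "gamma A \<le> c"
proof (rule field_le_epsilon)
  fix e :: real assume e: "0 < e"
  obtain L where L: "op_bound (rowtl L A) (c + e / 2)"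
    using op_bound_cortl_imp_rowtl[OF A c, of "e / 2"] e by auto
  obtain K where "op_bound A K" using A by (auto simp: bop_def)
  from covers_of_rowtl[OF this L, of "e / 2"] e obtain F where "covers A (c + e / 2 + e / 2) F"
    by auto
  then have "covers A (c + e) F"
    by (simp only: add.assoc field_sum_of_halves)
  then show "gamma A \<le> c + e"
    unfolding gamma_eq using e op_bound_nonneg[OF c]
    by (intro cInf_lower gamma_cover_set A) (auto intro: add_nonneg_pos)
qed

lemma gamma_le: "op_bound A c \<Longrightarrow> gamma A \<le> c"
  by (rule gamma_leI[OF bopI, of _ _ 0]) (auto simp: cortl_def)

lemma gamma_coversD:
  assumes A: "bop A" and c: "gamma A < c"
  obtains e F where "0 < e" "e < c" "covers A e F"
  using cInf_lessD[OF gamma_cover_set(2)[OF A] c[unfolded gamma_eq]] by blast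

text \<open>The finitely many centres of a net have small tails beyond a common row L. Beyond that
  row an image of the unit ball is bounded by the radius of the net plus the tail of a
  centre.\<close>

lemma gamma_lessD_rowtl:
  assumes A: "bop A" and c: "gamma A < c"
  shows "\<exists>L. op_bound (rowtl L A) c"
proof -
  obtain e F where e: "0 < e" "e < c" and F: "covers A e F"
    using gamma_coversD[OF A c] .
  define d where "d = c - e"
  have d: "0 < d" using e by (simp add: d_def)
  obtain K where K: "op_bound A K" using A by (auto simp: bop_def)
  have "\<forall>y\<in>F. eventually (\<lambda>L. l2norm (\<lambda>i. if L \<le> i then y i else 0) \<le> d) sequentially"
  proof
    fix y assume "y \<in> F"
    then have "l2 y" using F by (auto simp: covers_def)
    from l2_tail_small[OF this d] obtain N where "\<And>L. N \<le> L \<Longrightarrow> l2norm (\<lambda>i. if L \<le> i then y i else 0) \<le> d"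
      by metis
    then show "eventually (\<lambda>L. l2norm (\<lambda>i. if L \<le> i then y i else 0) \<le> d) sequentially"
      by (auto simp: eventually_sequentially)
  qed
  then have "eventually (\<lambda>L. \<forall>y\<in>F. l2norm (\<lambda>i. if L \<le> i then y i else 0) \<le> d) sequentially"
    using F by (intro eventually_ball_finite) (auto simp: covers_def)
  then obtain L where L: "\<And>y. y \<in> F \<Longrightarrow> l2norm (\<lambda>i. if L \<le> i then y i else 0) \<le> d"
    by (auto simp: eventually_sequentially)
  have "op_bound (rowtl L A) c"
  proof (rule op_boundI_unit)
    fix x :: "nat \<Rightarrow> real" assume x: "l2 x" "l2norm x \<le> 1"
    then obtain y where y: "y \<in> F" "l2norm (\<lambda>i. mapp A x i - y i) \<le> e"
      using F by (auto simp: covers_def)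
    have ly: "l2 y" using y F by (auto simp: covers_def)
    have l1: "l2 (\<lambda>i. mapp A x i - y i)"
      by (rule l2_diff[OF l2_mapp[OF K x(1)] ly])
    have "l2norm (mapp (rowtl L A) x)
        = l2norm (\<lambda>i. (if L \<le> i then mapp A x i - y i else 0) + (if L \<le> i then y i else 0))"
      by (rule arg_cong[of _ _ l2norm]) (auto simp: mapp_rowtl fun_eq_iff)
    also have "\<dots> \<le> l2norm (\<lambda>i. if L \<le> i then mapp A x i - y i else 0) + l2norm (\<lambda>i. if L \<le> i then y i else 0)"
      by (rule l2norm_add) (auto intro: l2_mono[OF l1] l2_mono[OF ly])
    also have "l2norm (\<lambda>i. if L \<le> i then mapp A x i - y i else 0) \<le> l2norm (\<lambda>i. mapp A x i - y i)"
      by (rule l2norm_mono[OF l1]) auto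
    also have "l2norm (\<lambda>i. if L \<le> i then y i else 0) \<le> d" by (rule L[OF y(1)])
    finally show "l2norm (mapp (rowtl L A) x) \<le> c"
      using y(2) by (simp add: d_def)
  qed (use e A in \<open>auto intro: bop_tails bop_nonneg_mat\<close>)
  then show ?thesis by blast
qed

lemma gamma_lessD_cortl:
  assumes A: "bop A" and c: "gamma A < c"
  shows "\<exists>L. \<forall>M\<ge>L. op_bound (cortl M A) c"
proof -
  obtain L where L: "op_bound (rowtl L A) c"
    using gamma_lessD_rowtl[OF assms] by blast
  have "op_bound (cortl M A) c" if "L \<le> M" for M
    by (rule op_bound_mono[OF L]) (use that bop_nonneg[OF A] in \<open>auto simp: nonneg_mat_def mle_def cortl_def rowtl_def\<close>)
  then show ?thesis by blast
qed

lemma gamma_mono: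
  assumes B: "bop B" and A: "nonneg_mat A" "mle A B"
  shows "gamma A \<le> gamma B"
proof (rule dense_ge)
  fix c assume "gamma B < c"
  then obtain M where M: "op_bound (cortl M B) c"
    using gamma_lessD_cortl[OF B] by blast
  have "op_bound (cortl M A) c"
    by (rule op_bound_mono[OF M]) (use A in \<open>auto simp: nonneg_mat_def mle_def cortl_def\<close>)
  then show "gamma A \<le> c"
    by (rule gamma_leI[OF bop_mono[OF B A]])
qed

lemma gamma_mtrans:
  assumes A: "bop A"
  shows "gamma (mtrans A) = gamma A"
proof -
  have *: "gamma (mtrans A) \<le> gamma A" if A: "bop A" for A
  proof (rule dense_ge)
    fix c assume "gamma A < c"
    then obtain M where M: "op_bound (cortl M A) c"
      using gamma_lessD_cortl[OF A] by blast
    have "mtrans (cortl M A) = cortl M (mtrans A)"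
      by (auto simp: mtrans_def cortl_def fun_eq_iff)
    with op_bound_mtrans[OF M] show "gamma (mtrans A) \<le> c"
      by (intro gamma_leI[of _ M] bop_mtrans A) simp
  qed
  show ?thesis
    using *[OF A] *[OF bop_mtrans[OF A]] by simp
qed

lemma gamma_lessD_coltl:
  assumes A: "bop A" and c: "gamma A < c"
  shows "\<exists>L. op_bound (coltl L A) c"
proof -
  obtain L where L: "op_bound (rowtl L (mtrans A)) c"
    using gamma_lessD_rowtl[OF bop_mtrans[OF A], of c] c by (auto simp: gamma_mtrans[OF A])
  have "mtrans (rowtl L (mtrans A)) = coltl L A"
    by (auto simp: mtrans_def rowtl_def coltl_def fun_eq_iff)
  with op_bound_mtrans[OF L] show ?thesis by auto
qed

lemma gamma_add:
  assumes A: "bop A" and B: "bop B"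
  shows "gamma (\<lambda>i j. A i j + B i j) \<le> gamma A + gamma B"
proof (rule field_le_epsilon)
  fix e :: real assume e: "0 < e"
  obtain L1 L2 where L: "\<And>M. L1 \<le> M \<Longrightarrow> op_bound (cortl M A) (gamma A + e / 2)"
      "\<And>M. L2 \<le> M \<Longrightarrow> op_bound (cortl M B) (gamma B + e / 2)"
    using gamma_lessD_cortl[OF A, of "gamma A + e / 2"] gamma_lessD_cortl[OF B, of "gamma B + e / 2"] e by auto
  have "op_bound (\<lambda>i j. cortl (max L1 L2) A i j + cortl (max L1 L2) B i j) (gamma A + e / 2 + (gamma B + e / 2))"
    by (intro op_bound_add L) auto
  also have "(\<lambda>i j. cortl (max L1 L2) A i j + cortl (max L1 L2) B i j) = cortl (max L1 L2) (\<lambda>i j. A i j + B i j)"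
    by (auto simp: cortl_def fun_eq_iff)
  finally have "op_bound (cortl (max L1 L2) (\<lambda>i j. A i j + B i j)) (gamma A + gamma B + e)"
    by (simp add: algebra_simps)
  then show "gamma (\<lambda>i j. A i j + B i j) \<le> gamma A + gamma B + e"
    by (rule gamma_leI[OF bop_add[OF A B]])
qed

lemma gamma_scale:
  assumes A: "bop A" and t: "0 < t"
  shows "gamma (\<lambda>i j. t * A i j) = t * gamma A"
proof -
  have *: "gamma (\<lambda>i j. t * A i j) \<le> t * gamma A" if A: "bop A" and t: "0 < t" for A t
  proof (rule dense_ge)
    fix c assume "t * gamma A < c"
    then have "gamma A < c / t"
      using t by (simp add: field_simps)
    then obtain M where M: "op_bound (cortl M A) (c / t)"
      using gamma_lessD_cortl[OF A] by blast
    have "(\<lambda>i j. t * cortl M A i j) = cortl M (\<lambda>i j. t * A i j)"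
      by (auto simp: cortl_def fun_eq_iff)
    with op_bound_scale[OF M, of t] t have "op_bound (cortl M (\<lambda>i j. t * A i j)) c"
      by simp
    then show "gamma (\<lambda>i j. t * A i j) \<le> c"
      using t by (intro gamma_leI[of _ M] bop_scale A) auto
  qed
  have "gamma (\<lambda>i j. inverse t * (t * A i j)) \<le> inverse t * gamma (\<lambda>i j. t * A i j)"
    using t by (intro * bop_scale A) auto
  moreover have "(\<lambda>i j. inverse t * (t * A i j)) = A"
    using t by (simp add: fun_eq_iff)
  ultimately have "t * gamma A \<le> gamma (\<lambda>i j. t * A i j)"
    using t by (simp add: field_simps)
  with *[OF A t] show ?thesis by simp
qed

lemma le_mult_of_greater:
  fixes x y z :: real
  assumes "\<And>a b. x < a \<Longrightarrow> y < b \<Longrightarrow> z \<le> a * b"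
  shows "z \<le> x * y"
proof -
  have "(\<lambda>n. (x + inverse (real (Suc n))) * (y + inverse (real (Suc n)))) \<longlonglongrightarrow> (x + 0) * (y + 0)"
    by (intro tendsto_intros LIMSEQ_inverse_real_of_nat)
  then show ?thesis
    by (intro LIMSEQ_le_const[of _ "x * y" z]) (auto intro!: assms)
qed

text \<open>Nets compose: B x is a centre y plus b times a vector v of the unit ball, and A v is
  within a of a centre w, so b w + A y is within a b of A B x.\<close>

lemma covers_mmult:
  assumes A: "bop A" and B: "bop B" and a: "0 < a" "covers A a F" and b: "0 < b" "covers B b G"
  shows "\<exists>H. covers (mmult A B) (a * b) H"
proof -
  obtain K1 K2 where K: "op_bound A K1" "op_bound B K2" using A B by (auto simp: bop_def)
  define H where "H = (\<lambda>(w, y) i. b * w i + mapp A y i) ` (F \<times> G)"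
  have F: "finite F" "\<And>y. y \<in> F \<Longrightarrow> l2 y" and G: "finite G" "\<And>y. y \<in> G \<Longrightarrow> l2 y"
    using a b by (auto simp: covers_def)
  have "covers (mmult A B) (a * b) H"
    unfolding covers_def
  proof (intro conjI allI impI ballI)
    show "finite H" unfolding H_def using F G by simp
    show "l2 h" if "h \<in> H" for h
      using that F G by (auto simp: H_def intro!: l2_add l2_mult l2_mapp[OF K(1)])
    fix x :: "nat \<Rightarrow> real" assume x: "l2 x \<and> l2norm x \<le> 1"
    with b obtain y where y: "y \<in> G" "l2norm (\<lambda>i. mapp B x i - y i) \<le> b"
      by (auto simp: covers_def)
    have ld: "l2 (\<lambda>i. mapp B x i - y i)"
      using x y G by (intro l2_diff l2_mapp[OF K(2)]) auto
    define v where "v i = inverse b * (mapp B x i - y i)" for i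
    have "l2norm v = norm (inverse b) * l2norm (\<lambda>i. mapp B x i - y i)"
      unfolding v_def by (rule l2norm_mult[OF ld])
    also have "\<dots> \<le> norm (inverse b) * b"
      by (intro mult_left_mono y) auto
    finally have v: "l2 v" "l2norm v \<le> 1"
      unfolding v_def using b by (auto intro: l2_mult[OF ld])
    with a obtain w where w: "w \<in> F" "l2norm (\<lambda>i. mapp A v i - w i) \<le> a"
      by (auto simp: covers_def)
    have lw: "l2 (\<lambda>i. mapp A v i - w i)"
      using v w F by (intro l2_diff l2_mapp[OF K(1)]) auto
    have Bx: "mapp B x = (\<lambda>i. b * v i + y i)"
      using b by (auto simp: v_def fun_eq_iff field_simps)
    have "mapp (mmult A B) x i - (b * w i + mapp A y i) = b * (mapp A v i - w i)" for i
    proof -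
      have "mapp (mmult A B) x i = mapp A (\<lambda>i. b * v i + y i) i"
        using mapp_mmult[OF K, of x] x by (simp add: Bx)
      also have "\<dots> = mapp A (\<lambda>i. b * v i) i + mapp A y i"
        using v y G by (intro mapp_add[OF K(1)] l2_mult) auto
      also have "mapp A (\<lambda>i. b * v i) i = b * mapp A v i"
        by (rule mapp_mult[OF K(1) v(1)])
      finally show ?thesis by (simp add: algebra_simps)
    qed
    then have "l2norm (\<lambda>i. mapp (mmult A B) x i - (b * w i + mapp A y i)) \<le> a * b"
      using w(2) b by (simp add: l2norm_mult[OF lw] mult_ac)
    then show "\<exists>h\<in>H. l2norm (\<lambda>i. mapp (mmult A B) x i - h i) \<le> a * b"
      using w y by (intro bexI[of _ "\<lambda>i. b * w i + mapp A y i"]) (auto simp: H_def)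
  qed
  then show ?thesis by blast
qed

lemma gamma_mmult:
  assumes A: "bop A" and B: "bop B"
  shows "gamma (mmult A B) \<le> gamma A * gamma B"
proof (rule le_mult_of_greater)
  fix a' b' assume *: "gamma A < a'" "gamma B < b'"
  obtain a F where a: "0 < a" "a < a'" "covers A a F"
    using gamma_coversD[OF A *(1)] .
  obtain b G where b: "0 < b" "b < b'" "covers B b G"
    using gamma_coversD[OF B *(2)] .
  have "gamma (mmult A B) \<le> a * b"
    unfolding gamma_eq
    using covers_mmult[OF A B a(1,3) b(1,3)] a b
    by (intro cInf_lower gamma_cover_set(1)[OF bop_mmult[OF A B]]) auto
  also have "\<dots> \<le> a' * b'"
    using a b by (intro mult_mono) auto
  finally show "gamma (mmult A B) \<le> a' * b'" .
qed

text \<open>For \<open>x\<close> supported in a tail, \<open>\<parallel>A x\<parallel>\<^sup>2 = \<langle>x, A\<^sup>* A x\<rangle>\<close>.\<close>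

lemma gamma_square_le:
  assumes A: "bop A"
  shows "(gamma A)\<^sup>2 \<le> gamma (mmult (mtrans A) A)"
proof (rule dense_ge)
  obtain K where K: "op_bound A K" using A by (auto simp: bop_def)
  let ?Y = "mmult (mtrans A) A"
  have Y: "bop ?Y" by (intro bop_mmult bop_mtrans A)
  fix c assume c: "gamma ?Y < c"
  obtain M where M: "op_bound (cortl M ?Y) c"
    using gamma_lessD_cortl[OF Y c] by blast
  have c0: "0 < c" using gamma_nonneg[OF Y] c by simp
  have cb: "bop (coltl M A)" by (rule bop_tails[OF A])
  obtain K' where K': "op_bound (coltl M A) K'" using cb by (auto simp: bop_def)
  have "op_bound (coltl M A) (sqrt c)"
  proof (rule op_boundI_l2[OF bop_nonneg_mat[OF cb]])
    fix x :: "nat \<Rightarrow> real" and J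
    assume x: "\<And>j. 0 \<le> x j" "finite J" "\<And>j. j \<notin> J \<Longrightarrow> x j = 0"
    have lx: "l2 x" using x by (intro l2_finite_support[of J]) auto
    define u where "u = mapp (coltl M A) x"
    have u: "u i = (\<Sum>j\<in>J. coltl M A i j * x j)" for i
      unfolding u_def using mapp_finite_support[OF x(2), where x = x] x(3) by simp
    have lu: "l2 u" unfolding u_def by (rule l2_mapp[OF K' lx])
    have s1: "summable (\<lambda>i. coltl M A i j * u i)" for j
      by (rule summable_inner_l2[OF l2_col[OF K'] lu])
    have s2: "summable (\<lambda>i. coltl M A i j * coltl M A i k)" for j k
      by (rule summable_inner_l2[OF l2_col[OF K'] l2_col[OF K']])
    have "(l2norm u)\<^sup>2 = (\<Sum>i. u i * u i)"
      using lu by (simp add: l2norm_def l2_def suminf_nonneg power2_eq_square)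
    also have "\<dots> = (\<Sum>i. \<Sum>j\<in>J. x j * (coltl M A i j * u i))"
      by (subst (2) u) (simp add: sum_distrib_left mult_ac)
    also have "\<dots> = (\<Sum>j\<in>J. \<Sum>i. x j * (coltl M A i j * u i))"
      by (rule suminf_sum) (intro summable_mult s1)
    also have "\<dots> = (\<Sum>j\<in>J. x j * (\<Sum>i. coltl M A i j * u i))"
      by (intro sum.cong refl suminf_mult s1)
    also have "(\<lambda>j. \<Sum>i. coltl M A i j * u i) = (\<lambda>j. \<Sum>k\<in>J. cortl M ?Y j k * x k)"
    proof
      fix j
      have "(\<Sum>i. coltl M A i j * u i) = (\<Sum>i. \<Sum>k\<in>J. x k * (coltl M A i j * coltl M A i k))"
        by (subst u) (simp add: sum_distrib_left mult_ac)
      also have "\<dots> = (\<Sum>k\<in>J. \<Sum>i. x k * (coltl M A i j * coltl M A i k))"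
        by (rule suminf_sum) (intro summable_mult s2)
      also have "\<dots> = (\<Sum>k\<in>J. x k * (\<Sum>i. coltl M A i j * coltl M A i k))"
        by (intro sum.cong refl suminf_mult s2)
      \<comment> \<open>For indices from M on, the Gram matrix of \<open>coltl M A\<close> is
        \<open>?Y\<close>; if either index is below M, it vanishes. This is exactly the corner of
        \<open>?Y\<close>.\<close>
      also have "\<dots> = (\<Sum>k\<in>J. cortl M ?Y j k * x k)"
        by (intro sum.cong refl) (auto simp: cortl_def coltl_def mmult_def mtrans_def mult_ac)
      finally show "(\<Sum>i. coltl M A i j * u i) = (\<Sum>k\<in>J. cortl M ?Y j k * x k)" .
    qed
    also have "(\<Sum>j\<in>J. x j * (\<Sum>k\<in>J. cortl M ?Y j k * x k)) = (\<Sum>j\<in>J. \<Sum>k\<in>J. x j * cortl M ?Y j k * x k)"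
      by (simp add: sum_distrib_left mult_ac)
    also have "\<dots> \<le> c * L2_set x J * L2_set x J"
      by (intro op_boundD(2)[OF M] x)
    also have "L2_set x J = l2norm x"
      using l2norm_finite_support[of J x] x by simp
    finally have "(l2norm u)\<^sup>2 \<le> (sqrt c * l2norm x)\<^sup>2"
      using c0 by (simp add: power_mult_distrib mult.assoc flip: power2_eq_square)
    then have "l2norm u \<le> sqrt c * l2norm x"
      by (rule power2_le_imp_le) (use c0 l2norm_nonneg[OF lx] in auto)
    then show "l2 (mapp (coltl M A) x) \<and> l2norm (mapp (coltl M A) x) \<le> sqrt c * l2norm x"
      using lu by (simp add: u_def)
  qed
  then have "op_bound (cortl M A) (sqrt c)"
    by (rule op_bound_mono) (use bop_nonneg[OF A] in \<open>auto simp: nonneg_mat_def mle_def cortl_def coltl_def\<close>)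
  then have "gamma A \<le> sqrt c"
    by (rule gamma_leI[OF A])
  then have "(gamma A)\<^sup>2 \<le> (sqrt c)\<^sup>2"
    by (rule power_mono) (rule gamma_nonneg[OF A])
  then show "(gamma A)\<^sup>2 \<le> c"
    using c0 by simp
qed

section \<open>Hadamard powers\<close>

definition had :: "real \<Rightarrow> 'i set \<Rightarrow> ('i \<Rightarrow> mat) \<Rightarrow> mat" where
  "had \<alpha> F A = (\<lambda>i k. \<Prod>l\<in>F. (A l i k) powr \<alpha>)"

text \<open>After division by \<open>c l\<close> every factor lies in [0,1], where lowering the
  exponent from \<alpha> to 1 / card F only increases the value; then geometric and arithmetic means
  are compared. The result is linear in \<open>f\<close>, so it can be summed and serves as a matrix
  majorant.\<close>

lemma prod_powr_le_average:
  fixes f c :: "'i \<Rightarrow> real"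
  assumes F: "finite F" "F \<noteq> {}" and \<alpha>: "1 \<le> real (card F) * \<alpha>"
    and f: "\<And>l. l \<in> F \<Longrightarrow> 0 \<le> f l" "\<And>l. l \<in> F \<Longrightarrow> f l \<le> c l" and c: "\<And>l. l \<in> F \<Longrightarrow> 0 < c l"
  shows "(\<Prod>l\<in>F. f l powr \<alpha>) \<le> (\<Prod>l\<in>F. c l powr \<alpha>) * ((\<Sum>l\<in>F. f l / c l) / real (card F))"
proof -
  define g where "g l = f l / c l" for l
  have g: "0 \<le> g l" "g l \<le> 1" if "l \<in> F" for l
    using f[OF that] c[OF that] by (simp_all add: g_def)
  have m: "0 < card F" using F by (simp add: card_gt_0_iff)
  have \<alpha>': "1 / real (card F) \<le> \<alpha>"
    using \<alpha> m by (simp add: field_simps)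
  have "(\<Prod>l\<in>F. f l powr \<alpha>) = (\<Prod>l\<in>F. c l powr \<alpha> * g l powr \<alpha>)"
  proof (rule prod.cong[OF refl])
    fix l assume l: "l \<in> F"
    have "f l = c l * g l" using c[OF l] by (simp add: g_def)
    then show "f l powr \<alpha> = c l powr \<alpha> * g l powr \<alpha>"
      using c[OF l] g(1)[OF l] by (simp add: powr_mult)
  qed
  also have "\<dots> = (\<Prod>l\<in>F. c l powr \<alpha>) * (\<Prod>l\<in>F. g l powr \<alpha>)"
    by (rule prod.distrib)
  also have "(\<Prod>l\<in>F. g l powr \<alpha>) \<le> (\<Prod>l\<in>F. g l powr (1 / real (card F)))"
    using g \<alpha>' by (intro prod_mono) (auto intro: powr_mono')
  also have "\<dots> = (\<Prod>l\<in>F. g l) powr (1 / real (card F))"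
    by (rule prod_powr_distrib[symmetric])
  also have "\<dots> \<le> (\<Sum>l\<in>F. g l / real (card F))"
    using F g by (intro arith_geom_mean) auto
  finally show ?thesis
    by (simp add: g_def mult_left_mono prod_nonneg sum_divide_distrib)
qed

text \<open>Entries are at most the norm bound, so the Hadamard product is dominated entrywise by a
  multiple of the average of the matrices \<open>A l\<close> divided by \<open>c l\<close>, each of
  norm at most 1.\<close>

lemma op_bound_had:
  assumes F: "finite F" "F \<noteq> {}" and \<alpha>: "1 \<le> real (card F) * \<alpha>"
    and A: "\<And>l. l \<in> F \<Longrightarrow> op_bound (A l) (c l)" and c: "\<And>l. l \<in> F \<Longrightarrow> 0 < c l"
  shows "op_bound (had \<alpha> F A) (\<Prod>l\<in>F. c l powr \<alpha>)"
proof -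
  have m: "0 < card F" using F by (simp add: card_gt_0_iff)
  let ?C = "\<Prod>l\<in>F. c l powr \<alpha>"
  have "op_bound (\<lambda>i j. \<Sum>l\<in>F. inverse (c l) * A l i j) (\<Sum>l\<in>F. inverse (c l) * c l)"
    using F A c by (intro op_bound_sum op_bound_scale) (auto simp: less_imp_le)
  moreover have "(\<Sum>l\<in>F. inverse (c l) * c l) = (\<Sum>l\<in>F. 1)"
    by (intro sum.cong refl) (use c in force)
  ultimately have "op_bound (\<lambda>i j. \<Sum>l\<in>F. inverse (c l) * A l i j) (real (card F))"
    by simp
  from op_bound_scale[OF this, of "?C / real (card F)"]
  have "op_bound (\<lambda>i j. ?C / real (card F) * (\<Sum>l\<in>F. inverse (c l) * A l i j)) ?C"
    using m by (simp add: prod_nonneg)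
  then show ?thesis
  proof (rule op_bound_mono)
    show "nonneg_mat (had \<alpha> F A)"
      by (simp add: nonneg_mat_def had_def prod_nonneg)
    have "(\<Prod>l\<in>F. (A l i j) powr \<alpha>) \<le> ?C * ((\<Sum>l\<in>F. A l i j / c l) / real (card F))" for i j
      by (rule prod_powr_le_average[OF F \<alpha>]) (use A c op_bound_entry op_boundD(3) in blast)+
    then show "mle (had \<alpha> F A) (\<lambda>i j. ?C / real (card F) * (\<Sum>l\<in>F. inverse (c l) * A l i j))"
      by (simp add: mle_def had_def divide_inverse mult_ac)
  qed
qed

lemma bop_had:
  assumes F: "finite F" "F \<noteq> {}" and \<alpha>: "1 \<le> real (card F) * \<alpha>" and A: "\<And>l. l \<in> F \<Longrightarrow> bop (A l)"
  shows "bop (had \<alpha> F A)"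
proof -
  have "\<forall>l\<in>F. \<exists>c. op_bound (A l) c"
    using A by (auto simp: bop_def)
  then obtain c where c: "\<And>l. l \<in> F \<Longrightarrow> op_bound (A l) (c l)"
    using bchoice[of F "\<lambda>l c. op_bound (A l) c"] by blast
  \<comment> \<open>The normalisation divides by the bounds, which may be 0; hence
    \<open>c l + 1\<close>.\<close>
  have "op_bound (had \<alpha> F A) (\<Prod>l\<in>F. (c l + 1) powr \<alpha>)"
    by (rule op_bound_had[OF F \<alpha>])
      (use op_bound_weaken[OF c] op_bound_nonneg[OF c] in \<open>auto intro: add_nonneg_pos\<close>)
  then show ?thesis by (rule bopI)
qed

text \<open>The Hadamard product of corners is the corner of the Hadamard product, so the norm
  inequality applies beyond a common truncation index. The margin \<open>e\<close> keeps the bounds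
  positive where some \<open>gamma (A l)\<close> is 0 and is removed by a limit.\<close>

lemma gamma_had:
  assumes F: "finite F" "F \<noteq> {}" and \<alpha>: "1 \<le> real (card F) * \<alpha>" and A: "\<And>l. l \<in> F \<Longrightarrow> bop (A l)"
  shows "gamma (had \<alpha> F A) \<le> (\<Prod>l\<in>F. gamma (A l) powr \<alpha>)"
proof -
  have m: "0 < card F" using F by (simp add: card_gt_0_iff)
  have \<alpha>0: "0 < \<alpha>"
    using \<alpha> m by (metis less_le_trans mult_nonneg_nonpos not_less of_nat_0_le_iff zero_less_one)
  have le: "gamma (had \<alpha> F A) \<le> (\<Prod>l\<in>F. (gamma (A l) + e) powr \<alpha>)" if e: "0 < e" for e
  proof -
    have "\<forall>l\<in>F. \<exists>L. \<forall>M\<ge>L. op_bound (cortl M (A l)) (gamma (A l) + e)"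
      using gamma_lessD_cortl[OF A] e by simp
    then obtain L where L: "\<And>l M. l \<in> F \<Longrightarrow> L l \<le> M \<Longrightarrow> op_bound (cortl M (A l)) (gamma (A l) + e)"
      using bchoice[of F "\<lambda>l L. \<forall>M\<ge>L. op_bound (cortl M (A l)) (gamma (A l) + e)"] by blast
    define M where "M = Max (L ` F)"
    have "op_bound (had \<alpha> F (\<lambda>l. cortl M (A l))) (\<Prod>l\<in>F. (gamma (A l) + e) powr \<alpha>)"
      using F e by (intro op_bound_had \<alpha> L) (auto simp: M_def add_nonneg_pos gamma_nonneg A)
    also have "had \<alpha> F (\<lambda>l. cortl M (A l)) = cortl M (had \<alpha> F A)"
      using F by (auto simp: had_def cortl_def fun_eq_iff)
    finally show ?thesis
      by (rule gamma_leI[rotated]) (intro bop_had F \<alpha> A)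
  qed
  have "(\<lambda>n. \<Prod>l\<in>F. (gamma (A l) + inverse (real (Suc n))) powr \<alpha>) \<longlonglongrightarrow> (\<Prod>l\<in>F. (gamma (A l) + 0) powr \<alpha>)"
  proof (intro tendsto_prod tendsto_powr2 tendsto_add tendsto_const LIMSEQ_inverse_real_of_nat)
    fix l assume l: "l \<in> F"
    show "\<forall>\<^sub>F n in sequentially. 0 \<le> gamma (A l) + inverse (real (Suc n))"
      using gamma_nonneg[OF A[OF l]] by (intro always_eventually) (auto intro: add_nonneg_nonneg)
  qed (rule \<alpha>0)
  then show ?thesis
    using le by (intro LIMSEQ_le_const[of _ "\<Prod>l\<in>F. gamma (A l) powr \<alpha>"]) (simp, auto)
qed

text \<open>A form of Hoelder's inequality: a sum of products of powers is at most the product of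
  the powers of the sums. Each term is normalised by the full sum \<open>S l\<close>, which
  dominates it, and the normalised series then sum to 1.\<close>

lemma mle_mmult_had:
  assumes F: "finite F" "F \<noteq> {}" and \<alpha>: "1 \<le> real (card F) * \<alpha>"
    and A: "\<And>l. l \<in> F \<Longrightarrow> bop (A l)" and B: "\<And>l. l \<in> F \<Longrightarrow> bop (B l)"
  shows "mle (mmult (had \<alpha> F A) (had \<alpha> F B)) (had \<alpha> F (\<lambda>l. mmult (A l) (B l)))"
  unfolding mle_def
proof (intro allI)
  fix i j
  have m: "0 < card F" using F by (simp add: card_gt_0_iff)
  define f where "f l k = A l i k * B l k j" for l k
  have f0: "0 \<le> f l k" if "l \<in> F" for l k
    using bop_nonneg[OF A[OF that]] bop_nonneg[OF B[OF that]] by (simp add: f_def)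
  have s: "summable (f l)" if "l \<in> F" for l
    using summable_mmult A[OF that] B[OF that] unfolding f_def bop_def by blast
  define S where "S l = suminf (f l)" for l
  have S0: "0 \<le> S l" if "l \<in> F" for l
    using s f0 that unfolding S_def by (intro suminf_nonneg) auto
  have fS: "f l k \<le> S l" if "l \<in> F" for l k
    using sum_le_suminf[OF s[OF that], of "{k}"] f0 that by (simp add: S_def)
  have factor: "had \<alpha> F A i k * had \<alpha> F B k j = (\<Prod>l\<in>F. f l k powr \<alpha>)" for k
    unfolding had_def prod.distrib[symmetric]
    using bop_nonneg[OF A] bop_nonneg[OF B] by (intro prod.cong refl) (simp add: f_def powr_mult)
  have bhA: "bop (had \<alpha> F A)" and bhB: "bop (had \<alpha> F B)"
    by (intro bop_had F \<alpha> A B; assumption)+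
  have sh: "summable (\<lambda>k. had \<alpha> F A i k * had \<alpha> F B k j)"
    using bhA bhB summable_mmult unfolding bop_def by blast
  have "(\<Sum>k. \<Prod>l\<in>F. f l k powr \<alpha>) \<le> (\<Prod>l\<in>F. S l powr \<alpha>)"
  proof (cases "\<exists>l\<in>F. S l = 0")
    case True
    then obtain l where l: "l \<in> F" "S l = 0" by blast
    then have "f l k = 0" for k
      using fS[OF l(1), of k] f0[OF l(1), of k] by simp
    then have "(\<Prod>l\<in>F. f l k powr \<alpha>) = 0" for k
      using F l by (intro prod_zero) auto
    then show ?thesis by (simp add: prod_nonneg)
  next
    case False
    then have pos: "0 < S l" if "l \<in> F" for l
      using S0[OF that] that by force
    let ?C = "\<Prod>l\<in>F. S l powr \<alpha>"
    have le: "(\<Prod>l\<in>F. f l k powr \<alpha>) \<le> ?C * ((\<Sum>l\<in>F. f l k / S l) / real (card F))" for k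
      by (rule prod_powr_le_average[OF F \<alpha>]) (auto simp: f0 fS pos)
    have sd: "summable (\<lambda>k. f l k / S l)" if "l \<in> F" for l
      by (rule summable_divide[OF s[OF that]])
    have ss: "summable (\<lambda>k. \<Sum>l\<in>F. f l k / S l)"
      by (rule summable_sum) (rule sd)
    have "(\<Sum>k. \<Prod>l\<in>F. f l k powr \<alpha>) \<le> (\<Sum>k. ?C * ((\<Sum>l\<in>F. f l k / S l) / real (card F)))"
      by (intro suminf_le le summable_mult summable_divide ss sh[unfolded factor])
    also have "\<dots> = ?C * ((\<Sum>k. \<Sum>l\<in>F. f l k / S l) / real (card F))"
      using suminf_mult[OF summable_divide[OF ss, of "real (card F)"], of ?C] suminf_divide[OF ss, of "real (card F)"]
      by simp
    also have "(\<Sum>k. \<Sum>l\<in>F. f l k / S l) = (\<Sum>l\<in>F. \<Sum>k. f l k / S l)"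
      by (rule suminf_sum) (rule sd)
    also have "\<dots> = (\<Sum>l\<in>F. 1)"
    proof (rule sum.cong[OF refl])
      fix l assume l: "l \<in> F"
      show "(\<Sum>k. f l k / S l) = 1"
        using suminf_divide[OF s[OF l], of "S l"] pos[OF l] by (simp add: S_def)
    qed
    finally show ?thesis using m by simp
  qed
  then show "mmult (had \<alpha> F A) (had \<alpha> F B) i j \<le> had \<alpha> F (\<lambda>l. mmult (A l) (B l)) i j"
    unfolding mmult_def factor unfolding had_def S_def f_def[abs_def] .
qed

section \<open>Growth rates of submultiplicative sequences\<close>

text \<open>An infimum, so that nothing has to be shown to converge; for submultiplicative sequences
  it is the limit of the roots. Index 0 is left out here and in \<open>submult\<close>, as it has no
  root.\<close>

definition growth_rate :: "(nat \<Rightarrow> real) \<Rightarrow> real" where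
  "growth_rate a = (INF k\<in>{1..}. a k powr (1 / real k))"

definition submult :: "(nat \<Rightarrow> real) \<Rightarrow> bool" where
  "submult a \<longleftrightarrow> (\<forall>k\<ge>1. 0 \<le> a k) \<and> (\<forall>j\<ge>1. \<forall>k\<ge>1. a (j + k) \<le> a j * a k)"

lemma growth_bdd: "bdd_below ((\<lambda>k. a k powr (1 / real k)) ` {1..})" for a :: "nat \<Rightarrow> real"
  by (rule bdd_belowI[of _ 0]) auto

lemma growth_rate_nonneg: "0 \<le> growth_rate a"
  unfolding growth_rate_def by (rule cINF_greatest) auto

lemma growth_rate_le_root: "1 \<le> k \<Longrightarrow> growth_rate a \<le> a k powr (1 / real k)"
  unfolding growth_rate_def by (rule cINF_lower[OF growth_bdd]) auto

lemma powr_inverse_le_iff: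
  fixes x t :: real
  assumes "0 \<le> x" "0 \<le> t" "1 \<le> k"
  shows "x powr (1 / real k) \<le> t \<longleftrightarrow> x \<le> t ^ k"
proof -
  have r: "x powr (1 / real k) = root k x"
    using assms by (cases "x = 0") (auto simp: root_powr_inverse)
  have "root k x \<le> t \<longleftrightarrow> root k x \<le> root k (t ^ k)"
    using assms by (simp add: real_root_power_cancel)
  then show ?thesis
    using assms by (simp add: r)
qed

lemma powr_root_of_power: "0 \<le> x \<Longrightarrow> 1 \<le> k \<Longrightarrow> (x ^ k) powr (1 / real k) = x"
  by (cases "x = 0") (auto simp: powr_powr zero_power simp flip: powr_realpow)

lemma power_of_powr_root: "0 \<le> x \<Longrightarrow> 1 \<le> k \<Longrightarrow> (x powr (1 / real k)) ^ k = x"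
  by (cases "x = 0") (auto simp: powr_powr zero_power simp flip: powr_realpow)

lemma growth_rate_power_le:
  assumes "submult a" "1 \<le> k"
  shows "growth_rate a ^ k \<le> a k"
proof -
  have a: "0 \<le> a k" using assms by (auto simp: submult_def)
  have "growth_rate a ^ k \<le> (a k powr (1 / real k)) ^ k"
    by (intro power_mono growth_rate_le_root growth_rate_nonneg assms)
  also have "\<dots> = a k"
    by (rule power_of_powr_root[OF a assms(2)])
  finally show ?thesis .
qed

text \<open>Fekete's argument: some k has \<open>a k \<le> t ^ k\<close>, and removing k from the
  index repeatedly leaves a remainder of at most k, whose finitely many values the constant
  covers.\<close>

lemma growth_boundedE:
  assumes a: "submult a" and t: "growth_rate a < t"
  obtains C where "0 < C" "\<And>n. 1 \<le> n \<Longrightarrow> a n \<le> C * t ^ n"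
proof -
  note a0 = a[unfolded submult_def, THEN conjunct1, rule_format]
  note am = a[unfolded submult_def, THEN conjunct2, rule_format]
  have t0: "0 < t" using growth_rate_nonneg[of a] t by simp
  obtain k where k: "1 \<le> k" "a k powr (1 / real k) < t"
    using cINF_less_iff[OF _ growth_bdd, of a t] t unfolding growth_rate_def by auto
  have ak: "a k \<le> t ^ k"
    using powr_inverse_le_iff[of "a k" t k] a0[OF k(1)] t0 k by simp
  define C where "C = (\<Sum>r\<le>k. a (Suc r) / t ^ Suc r) + 1"
  have nn: "0 \<le> a (Suc r) / t ^ Suc r" for r using a0[of "Suc r"] t0 by simp
  have "0 \<le> (\<Sum>r\<le>k. a (Suc r) / t ^ Suc r)"
    by (intro sum_nonneg nn)
  then have C: "0 < C" unfolding C_def by linarith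
  have "a n \<le> C * t ^ n" if "1 \<le> n" for n
    using that
  proof (induction n rule: less_induct)
    case (less n)
    show ?case
    proof (cases "n \<le> k")
      case True
      obtain r where r: "n = Suc r" using less.prems by (cases n) auto
      have "a (Suc r) / t ^ Suc r \<le> (\<Sum>r\<le>k. a (Suc r) / t ^ Suc r)"
        using True nn r by (intro member_le_sum) auto
      then have "a n / t ^ n \<le> C" unfolding C_def r by linarith
      then show ?thesis using t0 by (simp add: field_simps)
    next
      case False
      have "a n \<le> a k * a (n - k)"
        using am[OF k(1), of "n - k"] False by simp
      also have "\<dots> \<le> t ^ k * (C * t ^ (n - k))"
        using False k a0 t0 C ak by (intro mult_mono less.IH) auto
      also have "\<dots> = C * t ^ n"
        using False by (simp add: mult_ac flip: power_add)
      finally show ?thesis .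
    qed
  qed
  with C show ?thesis by (rule that)
qed

lemma const_root_tendsto_1: "0 < C \<Longrightarrow> (\<lambda>n. C powr (1 / real (Suc n))) \<longlonglongrightarrow> 1" for C :: real
proof -
  assume C: "0 < C"
  have "(\<lambda>n. C powr (1 / real (Suc n))) \<longlonglongrightarrow> C powr 0"
    using C LIMSEQ_inverse_real_of_nat
    by (intro tendsto_powr tendsto_const) (auto simp: inverse_eq_divide)
  then show ?thesis using C by simp
qed

lemma root_of_growth:
  fixes t :: real
  assumes "0 \<le> x" "x \<le> C * t ^ Suc n" "0 < C" "0 < t"
  shows "x powr (1 / real (Suc n)) \<le> C powr (1 / real (Suc n)) * t"
proof -
  have "x powr (1 / real (Suc n)) \<le> (C * t ^ Suc n) powr (1 / real (Suc n))"
    using assms by (intro powr_mono2) auto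
  also have "\<dots> = C powr (1 / real (Suc n)) * (t ^ Suc n) powr (1 / real (Suc n))"
    by (rule powr_mult)
  also have "(t ^ Suc n) powr (1 / real (Suc n)) = t"
    using assms by (subst powr_realpow[symmetric]) (auto simp: powr_powr simp del: of_nat_Suc)
  finally show ?thesis .
qed

lemma growth_rate_leI:
  assumes a: "\<And>n. 1 \<le> n \<Longrightarrow> 0 \<le> a n" and le: "\<And>n. 1 \<le> n \<Longrightarrow> a n \<le> C * t ^ n" and t: "0 < t" "0 < C"
  shows "growth_rate a \<le> t"
proof -
  have "(\<lambda>n. C powr (1 / real (Suc n)) * t) \<longlonglongrightarrow> 1 * t"
    by (intro tendsto_intros const_root_tendsto_1 t)
  moreover have "growth_rate a \<le> C powr (1 / real (Suc n)) * t" for n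
    by (rule order_trans[OF growth_rate_le_root[of "Suc n"] root_of_growth])
      (use a[of "Suc n"] le[of "Suc n"] t in auto)
  ultimately show ?thesis
    using LIMSEQ_le_const[of "\<lambda>n. C powr (1 / real (Suc n)) * t" "1 * t" "growth_rate a"] by auto
qed

text \<open>Fekete's lemma: the infimum bounds every root from below, and the geometric bound does
  so from above up to the n-th root of a constant, which tends to 1. It makes the \<open>lim\<close>
  in \<open>rho_hat_ess_set\<close> a genuine limit.\<close>

lemma growth_rate_LIMSEQ:
  assumes a: "submult a"
  shows "(\<lambda>k. a (Suc k) powr (1 / real (Suc k))) \<longlonglongrightarrow> growth_rate a"
proof (rule LIMSEQ_I)
  fix e :: real assume e: "0 < e"
  have a0: "0 \<le> a (Suc k)" for k using a by (auto simp: submult_def)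
  define t where "t = growth_rate a + e / 2"
  have t: "growth_rate a < t" "0 < t" using e growth_rate_nonneg[of a] by (auto simp: t_def)
  obtain C where C: "0 < C" "\<And>n. 1 \<le> n \<Longrightarrow> a n \<le> C * t ^ n"
    using growth_boundedE[OF a t(1)] by metis
  have "(\<lambda>n. C powr (1 / real (Suc n)) * t) \<longlonglongrightarrow> 1 * t"
    by (intro tendsto_intros const_root_tendsto_1 C)
  from LIMSEQ_D[OF this, of "e / 2"] e obtain N where N: "\<And>n. N \<le> n \<Longrightarrow> \<bar>C powr (1 / real (Suc n)) * t - t\<bar> < e / 2"
    by auto
  have "norm (a (Suc n) powr (1 / real (Suc n)) - growth_rate a) < e" if "N \<le> n" for n
  proof -
    have "growth_rate a \<le> a (Suc n) powr (1 / real (Suc n))"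
      by (rule growth_rate_le_root) simp
    moreover have "a (Suc n) powr (1 / real (Suc n)) \<le> C powr (1 / real (Suc n)) * t"
      by (rule root_of_growth) (use a0 C(1) C(2)[of "Suc n"] t in auto)
    ultimately show ?thesis
      using N[OF that] unfolding real_norm_def t_def by linarith
  qed
  then show "\<exists>N. \<forall>n\<ge>N. norm (a (Suc n) powr (1 / real (Suc n)) - growth_rate a) < e"
    by blast
qed

lemma growth_rate_mono:
  assumes "\<And>k. 1 \<le> k \<Longrightarrow> 0 \<le> a k" "\<And>k. 1 \<le> k \<Longrightarrow> a k \<le> b k"
  shows "growth_rate a \<le> growth_rate b"
  unfolding growth_rate_def
proof (rule cINF_mono)
  fix k :: nat assume k: "k \<in> {1..}"
  then have "a k powr (1 / real k) \<le> b k powr (1 / real k)"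
    using assms by (intro powr_mono2) auto
  with k show "\<exists>n\<in>{1..}. a n powr (1 / real n) \<le> b k powr (1 / real k)" by blast
qed (use growth_bdd in auto)

text \<open>Passing from the power k + 1 of S T to the power k of T S costs one index and a constant
  factor; neither affects the growth rate.\<close>

lemma growth_rate_shift:
  assumes a: "submult a" and b: "submult b" and K: "0 \<le> K" "\<And>k. 1 \<le> k \<Longrightarrow> a (Suc k) \<le> K * b k"
  shows "growth_rate a \<le> growth_rate b"
proof (rule dense_ge)
  fix t assume t: "growth_rate b < t"
  have t0: "0 < t" using t growth_rate_nonneg[of b] by linarith
  obtain C where C: "0 < C" "\<And>n. 1 \<le> n \<Longrightarrow> b n \<le> C * t ^ n"
    using growth_boundedE[OF b t] by metis
  have a0: "0 \<le> a n" if "1 \<le> n" for n using a that by (auto simp: submult_def)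
  \<comment> \<open>The first summand pays for the shifted index, the second for n = 1, and the last
    makes D positive.\<close>
  define D where "D = K * C / t + a 1 / t + 1"
  have nn: "0 \<le> K * C / t" "0 \<le> a 1 / t" using K(1) C(1) t0 a0[of 1] by simp_all
  then have D: "0 < D" unfolding D_def by linarith
  have Dt: "K * C \<le> D * t" "a 1 \<le> D * t"
  proof -
    have "D * t = K * C + a 1 + t" using t0 by (simp add: D_def field_simps)
    moreover have "0 \<le> K * C" using K(1) C(1) by simp
    ultimately show "K * C \<le> D * t" "a 1 \<le> D * t" using a0[of 1] t0 by simp_all
  qed
  have "a n \<le> D * t ^ n" if n: "1 \<le> n" for n
  proof (cases "n = 1")
    case True
    then show ?thesis using Dt by simp
  next
    case False
    then obtain k where k: "n = Suc k" "1 \<le> k" using n by (cases n) auto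
    have "a n \<le> K * (C * t ^ k)"
      unfolding k(1) by (intro order_trans[OF K(2)[OF k(2)]] mult_left_mono C(2) K(1) k)
    also have "\<dots> = K * C * t ^ k" by simp
    also have "\<dots> \<le> D * t * t ^ k"
      using Dt t0 by (intro mult_right_mono) auto
    finally show ?thesis by (simp add: k mult_ac)
  qed
  then show "growth_rate a \<le> t"
    by (intro growth_rate_leI[of a D t] a0 t0 D)
qed

lemma growth_rate_prod:
  assumes a: "submult a" and b: "\<And>l. l \<in> F \<Longrightarrow> submult (b l)" and \<alpha>: "0 < \<alpha>"
    and le: "\<And>k. 1 \<le> k \<Longrightarrow> a k \<le> (\<Prod>l\<in>F. b l k powr \<alpha>)"
  shows "growth_rate a \<le> (\<Prod>l\<in>F. growth_rate (b l) powr \<alpha>)"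
proof (rule LIMSEQ_le)
  show "(\<lambda>k. a (Suc k) powr (1 / real (Suc k))) \<longlonglongrightarrow> growth_rate a"
    by (rule growth_rate_LIMSEQ[OF a])
  show "(\<lambda>k. \<Prod>l\<in>F. (b l (Suc k) powr (1 / real (Suc k))) powr \<alpha>) \<longlonglongrightarrow> (\<Prod>l\<in>F. growth_rate (b l) powr \<alpha>)"
    by (intro tendsto_prod tendsto_powr2 growth_rate_LIMSEQ b tendsto_const \<alpha> always_eventually) auto
  have "a (Suc k) powr (1 / real (Suc k)) \<le> (\<Prod>l\<in>F. (b l (Suc k) powr (1 / real (Suc k))) powr \<alpha>)" for k
  proof -
    have "a (Suc k) powr (1 / real (Suc k)) \<le> (\<Prod>l\<in>F. b l (Suc k) powr \<alpha>) powr (1 / real (Suc k))"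
      using a le[of "Suc k"] by (intro powr_mono2) (auto simp: submult_def)
    also have "\<dots> = (\<Prod>l\<in>F. (b l (Suc k) powr (1 / real (Suc k))) powr \<alpha>)"
      by (simp add: prod_powr_distrib powr_powr mult.commute)
    finally show ?thesis .
  qed
  then show "\<exists>N. \<forall>k\<ge>N. a (Suc k) powr (1 / real (Suc k)) \<le> (\<Prod>l\<in>F. (b l (Suc k) powr (1 / real (Suc k))) powr \<alpha>)"
    by blast
qed

section \<open>Products of matrices and of sets of matrices\<close>

definition mprod :: "mat list \<Rightarrow> mat" where
  "mprod As = foldr mmult As id_mat"

definition mpow :: "mat \<Rightarrow> nat \<Rightarrow> mat" where
  "mpow A k = mprod (replicate k A)"

lemma mprod_simps [simp]:
  "mprod [] = id_mat" "mprod (A # As) = mmult A (mprod As)"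
  by (simp_all add: mprod_def)

lemma mpow_simps [simp]:
  "mpow A 0 = id_mat" "mpow A (Suc k) = mmult A (mpow A k)"
  by (simp_all add: mpow_def)

lemma bop_mmult_assoc: "bop A \<Longrightarrow> bop B \<Longrightarrow> bop C \<Longrightarrow> mmult (mmult A B) C = mmult A (mmult B C)"
  unfolding bop_def using mmult_assoc by blast

lemma bop_mmult_mono: "bop A \<Longrightarrow> bop B \<Longrightarrow> bop A' \<Longrightarrow> bop B' \<Longrightarrow> mle A A' \<Longrightarrow> mle B B' \<Longrightarrow>
    mle (mmult A B) (mmult A' B')"
  unfolding bop_def using mmult_mono by blast

lemma bop_mprod: "(\<And>A. A \<in> set As \<Longrightarrow> bop A) \<Longrightarrow> bop (mprod As)"
  by (induction As) (auto intro: bop_id bop_mmult)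

lemma bop_mpow: "bop A \<Longrightarrow> bop (mpow A k)"
  unfolding mpow_def by (rule bop_mprod) auto

lemma mprod_append:
  assumes "\<And>A. A \<in> set As \<Longrightarrow> bop A" "\<And>B. B \<in> set Bs \<Longrightarrow> bop B"
  shows "mprod (As @ Bs) = mmult (mprod As) (mprod Bs)"
  using assms
  by (induction As) (auto simp: bop_mmult_assoc bop_mprod)

lemma mpow_add: "bop A \<Longrightarrow> mpow A (j + k) = mmult (mpow A j) (mpow A k)"
  unfolding mpow_def replicate_add by (rule mprod_append) auto

lemma mpow_1 [simp]: "mpow A (Suc 0) = A"
  by simp

lemma mpow_mult: "bop A \<Longrightarrow> mpow A (j * k) = mpow (mpow A j) k"
  by (induction k) (auto simp: mpow_add)

lemma mpow_mono:
  assumes "bop A" "bop B" "mle A B"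
  shows "mle (mpow A k) (mpow B k)"
  using assms by (induction k) (auto intro: bop_mmult_mono bop_mpow)

lemma mtrans_mprod:
  assumes "\<And>A. A \<in> set As \<Longrightarrow> bop A"
  shows "mtrans (mprod As) = mprod (rev (map mtrans As))"
  using assms
proof (induction As)
  case (Cons A As)
  have "mprod (rev (map mtrans As) @ [mtrans A]) = mmult (mprod (rev (map mtrans As))) (mprod [mtrans A])"
    by (rule mprod_append) (use Cons.prems in \<open>auto intro: bop_mtrans\<close>)
  then show ?case
    using Cons by (simp add: mtrans_mmult)
qed simp

lemma mtrans_mpow: "bop A \<Longrightarrow> mtrans (mpow A k) = mpow (mtrans A) k"
  unfolding mpow_def by (subst mtrans_mprod) auto

lemma op_bound_mprod:
  assumes "\<And>A. A \<in> set As \<Longrightarrow> op_bound A M"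
  shows "op_bound (mprod As) (M ^ length As)"
  using assms by (induction As) (auto intro: op_bound_id op_bound_mmult)

lemma set_prod_list_Cons: "set_prod_list (S # Ss) = set_mult S (set_prod_list Ss)"
  by (cases Ss) (auto simp: set_mult_def)

lemma set_prod_list_eq: "set_prod_list Ss = {mprod As |As. list_all2 (\<in>) As Ss}"
proof (induction Ss)
  case (Cons S Ss)
  show ?case
    unfolding set_prod_list_Cons Cons.IH set_mult_def
    by (auto simp: list_all2_Cons2) (metis mprod_simps(2))+
qed simp

lemma list_all2_mem_replicate: "list_all2 (\<in>) As (replicate k S) \<longleftrightarrow> length As = k \<and> set As \<subseteq> S"
  by (auto simp: list_all2_conv_all_nth set_conv_nth subset_iff)

lemma set_pow_eq: "set_pow S k = {mprod As |As. length As = k \<and> set As \<subseteq> S}"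
  unfolding set_pow_def set_prod_list_eq list_all2_mem_replicate ..

lemma set_pow_1: "set_pow S (Suc 0) = S"
  by (simp add: set_pow_def)

lemma bdd_matsD: "bdd_mats S \<Longrightarrow> A \<in> S \<Longrightarrow> bop A"
  by (auto simp: bdd_mats_def bop_def)

lemma bdd_mats_singleton: "bop A \<Longrightarrow> bdd_mats {A}"
  by (auto simp: bdd_mats_def bop_def)

lemma bdd_mats_set_mult: "bdd_mats S \<Longrightarrow> bdd_mats T \<Longrightarrow> bdd_mats (set_mult S T)"
  unfolding bdd_mats_def set_mult_def by (blast intro: op_bound_mmult)

lemma bdd_mats_adjs: "bdd_mats S \<Longrightarrow> bdd_mats (adjs S)"
  unfolding bdd_mats_def adjs_def by (blast intro: op_bound_mtrans)

lemma bdd_mats_set_prod_list: "(\<And>S. S \<in> set Ss \<Longrightarrow> bdd_mats S) \<Longrightarrow> bdd_mats (set_prod_list Ss)"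
proof (induction Ss)
  case Nil
  then show ?case using bdd_mats_singleton[OF bop_id] by simp
next
  case (Cons S Ss)
  then show ?case by (auto simp: set_prod_list_Cons intro: bdd_mats_set_mult)
qed

lemma bdd_mats_set_pow: "bdd_mats S \<Longrightarrow> bdd_mats (set_pow S k)"
  unfolding set_pow_def by (rule bdd_mats_set_prod_list) auto

lemma set_prod_list_append:
  assumes "\<And>S. S \<in> set Ss \<union> set Ts \<Longrightarrow> bdd_mats S"
  shows "set_prod_list (Ss @ Ts) = set_mult (set_prod_list Ss) (set_prod_list Ts)"
  using assms
proof (induction Ss)
  case Nil
  then show ?case by (auto simp: set_mult_def)
next
  case (Cons S Ss)
  have bS: "bop A" if "A \<in> S" for A
    using that Cons.prems[of S] bdd_matsD by auto
  have b1: "bop A" if "A \<in> set_prod_list Ss" for A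
    using that bdd_mats_set_prod_list[of Ss] Cons.prems bdd_matsD by auto
  have b2: "bop A" if "A \<in> set_prod_list Ts" for A
    using that bdd_mats_set_prod_list[of Ts] Cons.prems bdd_matsD by auto
  have "set_mult S (set_mult (set_prod_list Ss) (set_prod_list Ts))
      = set_mult (set_mult S (set_prod_list Ss)) (set_prod_list Ts)"
    unfolding set_mult_def using bS b1 b2 by (auto; metis bop_mmult_assoc)
  then show ?case
    using Cons by (simp add: set_prod_list_Cons)
qed

lemma adjs_set_mult: "adjs (set_mult S T) = set_mult (adjs T) (adjs S)"
proof
  show "adjs (set_mult S T) \<subseteq> set_mult (adjs T) (adjs S)"
    unfolding adjs_def set_mult_def by (auto simp: mtrans_mmult; blast)
  show "set_mult (adjs T) (adjs S) \<subseteq> adjs (set_mult S T)"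
    unfolding adjs_def set_mult_def by (auto simp flip: mtrans_mmult intro!: imageI; blast)
qed

lemma adjs_set_prod_list:
  assumes "\<And>S. S \<in> set Ss \<Longrightarrow> bdd_mats S"
  shows "adjs (set_prod_list Ss) = set_prod_list (rev (map adjs Ss))"
  using assms
proof (induction Ss)
  case Nil
  then show ?case by (simp add: adjs_def)
next
  case (Cons S Ss)
  have "set_prod_list (rev (map adjs Ss) @ [adjs S])
      = set_mult (set_prod_list (rev (map adjs Ss))) (set_prod_list [adjs S])"
    by (rule set_prod_list_append) (use Cons.prems in \<open>auto intro: bdd_mats_adjs\<close>)
  then show ?case
    using Cons by (simp add: set_prod_list_Cons[of S] adjs_set_mult)
qed

lemma adjs_adjs [simp]: "adjs (adjs S) = S"
  by (auto simp: adjs_def image_image)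

text \<open>The common shape of the suprema over sets of matrices. The inserted 0 is the value on
  the empty set and does not change the supremum of a nonnegative function on any other set.\<close>

definition sup0 :: "(mat \<Rightarrow> real) \<Rightarrow> mat set \<Rightarrow> real" where
  "sup0 \<phi> S = Sup (insert 0 (\<phi> ` S))"

lemma gamma_set_eq: "gamma_set S = sup0 gamma S"
  by (simp add: gamma_set_def sup0_def)

lemma sup0_least: "0 \<le> c \<Longrightarrow> (\<And>A. A \<in> S \<Longrightarrow> \<phi> A \<le> c) \<Longrightarrow> sup0 \<phi> S \<le> c"
  unfolding sup0_def by (rule cSup_least) auto

lemma sup0_upper: "bdd_above (\<phi> ` S) \<Longrightarrow> A \<in> S \<Longrightarrow> \<phi> A \<le> sup0 \<phi> S"
  unfolding sup0_def by (rule cSup_upper) auto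

lemma sup0_nonneg: "bdd_above (\<phi> ` S) \<Longrightarrow> 0 \<le> sup0 \<phi> S"
  unfolding sup0_def by (rule cSup_upper) auto

lemma bdd_above_gamma:
  assumes "bdd_mats S"
  shows "bdd_above (gamma ` S)"
proof -
  obtain M where "\<forall>A\<in>S. op_bound A M" using assms by (auto simp: bdd_mats_def)
  then have "gamma A \<le> M" if "A \<in> S" for A
    using gamma_le that by blast
  then show ?thesis by (auto intro: bdd_aboveI[of _ M])
qed

section \<open>The essential growth rate of a matrix\<close>

definition rho :: "mat \<Rightarrow> real" where
  "rho A = growth_rate (\<lambda>k. gamma (mpow A k))"

lemma submult_mpow: "bop A \<Longrightarrow> submult (\<lambda>k. gamma (mpow A k))"
  unfolding submult_def by (auto intro: gamma_nonneg bop_mpow gamma_mmult simp: mpow_add)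

lemma rho_nonneg: "0 \<le> rho A"
  unfolding rho_def by (rule growth_rate_nonneg)

lemma rho_power_le: "bop A \<Longrightarrow> 1 \<le> k \<Longrightarrow> rho A ^ k \<le> gamma (mpow A k)"
  unfolding rho_def by (rule growth_rate_power_le[OF submult_mpow])

lemma rho_le_gamma: "bop A \<Longrightarrow> rho A \<le> gamma A"
  using rho_power_le[of A 1] by simp

lemma rho_growth:
  assumes "bop A" "rho A < t"
  obtains C where "0 < C" "\<And>n. 1 \<le> n \<Longrightarrow> gamma (mpow A n) \<le> C * t ^ n"
  using growth_boundedE[OF submult_mpow[OF assms(1)], of t] assms(2) unfolding rho_def by metis

lemma rho_leI:
  assumes "bop A" "0 < t" "0 < C" "\<And>n. 1 \<le> n \<Longrightarrow> gamma (mpow A n) \<le> C * t ^ n"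
  shows "rho A \<le> t"
  unfolding rho_def by (rule growth_rate_leI[of _ C]) (use assms in \<open>auto intro: gamma_nonneg bop_mpow\<close>)

lemma rho_mono:
  assumes A: "bop A" and B: "bop B" and le: "mle A B"
  shows "rho A \<le> rho B"
proof (rule dense_ge)
  fix t assume t: "rho B < t"
  obtain C where C: "0 < C" "\<And>n. 1 \<le> n \<Longrightarrow> gamma (mpow B n) \<le> C * t ^ n"
    using rho_growth[OF B t] by metis
  have "gamma (mpow A n) \<le> gamma (mpow B n)" for n
    by (intro gamma_mono bop_mpow B bop_nonneg_mat A mpow_mono le)
  then have "gamma (mpow A n) \<le> C * t ^ n" if "1 \<le> n" for n
    using C(2)[OF that] order_trans by blast
  then show "rho A \<le> t"
    using C t rho_nonneg[of B] by (intro rho_leI[OF A, of t C]) auto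
qed

lemma rho_mtrans: "bop A \<Longrightarrow> rho (mtrans A) = rho A"
  unfolding rho_def by (simp add: mtrans_mpow[symmetric] gamma_mtrans bop_mpow)

lemma mpow_mmult_commute:
  assumes A: "bop A" and B: "bop B"
  shows "mpow (mmult A B) (Suc k) = mmult A (mmult (mpow (mmult B A) k) B)"
proof (induction k)
  case (Suc k)
  have "mpow (mmult A B) (Suc (Suc k)) = mmult (mmult A B) (mmult A (mmult (mpow (mmult B A) k) B))"
    using Suc by simp
  also have "\<dots> = mmult A (mmult (mpow (mmult B A) (Suc k)) B)"
    using A B by (simp add: bop_mmult_assoc bop_mmult bop_mpow)
  finally show ?case .
qed simp

text \<open>In A (B A)^k B the outer factors contribute only the constant
  \<open>gamma A * gamma B\<close>.\<close>

lemma rho_mmult_commute: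
  assumes A: "bop A" and B: "bop B"
  shows "rho (mmult A B) = rho (mmult B A)"
proof -
  have *: "rho (mmult A B) \<le> rho (mmult B A)" if A: "bop A" and B: "bop B" for A B
    unfolding rho_def
  proof (rule growth_rate_shift)
    show "0 \<le> gamma A * gamma B"
      by (intro mult_nonneg_nonneg gamma_nonneg A B)
    fix k :: nat
    have "gamma (mpow (mmult A B) (Suc k)) \<le> gamma A * (gamma (mpow (mmult B A) k) * gamma B)"
      unfolding mpow_mmult_commute[OF A B]
      by (intro order_trans[OF gamma_mmult] mult_left_mono gamma_mmult gamma_nonneg bop_mmult bop_mpow A B)
    then show "gamma (mpow (mmult A B) (Suc k)) \<le> gamma A * gamma B * gamma (mpow (mmult B A) k)"
      by (simp add: mult_ac)
  qed (intro submult_mpow bop_mmult A B)+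
  show ?thesis
    using *[OF A B] *[OF B A] by simp
qed

section \<open>The Fredholm property outside the essential growth rate\<close>

lemma rowtl_mmult: "mmult (rowtl N A) X = rowtl N (mmult A X)"
  by (auto simp: mmult_def rowtl_def fun_eq_iff)

lemma mle_rowtl: "bop A \<Longrightarrow> mle (rowtl N A) A"
  using bop_nonneg[of A] by (auto simp: mle_def rowtl_def)

text \<open>Truncating the leftmost factor truncates the whole product; in the other factors the
  tail is merely enlarged to A.\<close>

lemma mle_mpow_rowtl:
  assumes A: "bop A"
  shows "mle (mpow (rowtl N A) (Suc k)) (rowtl N (mpow A (Suc k)))"
proof -
  have "mle (mmult (rowtl N A) (mpow (rowtl N A) k)) (mmult (rowtl N A) (mpow A k))"
    by (intro bop_mmult_mono bop_tails bop_mpow A mle_refl mpow_mono mle_rowtl)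
  then show ?thesis by (simp add: rowtl_mmult)
qed

lemma op_bound_mpow_geometric:
  assumes B: "op_bound B b" and k: "1 \<le> k" and Bk: "op_bound (mpow B k) (\<nu> ^ k)" and \<nu>: "0 < \<nu>"
  obtains C where "0 < C" "\<And>n. op_bound (mpow B n) (C * \<nu> ^ n)"
proof -
  have b: "0 \<le> b" by (rule op_bound_nonneg[OF B])
  define C where "C = (\<Sum>r<k. b ^ r / \<nu> ^ r) + 1"
  have nn: "0 \<le> b ^ r / \<nu> ^ r" for r using b \<nu> by simp
  have "0 \<le> (\<Sum>r<k. b ^ r / \<nu> ^ r)" by (intro sum_nonneg nn)
  then have C: "0 < C" unfolding C_def by linarith
  have Bn: "op_bound (mpow B n) (b ^ n)" for n
    using op_bound_mprod[of "replicate n B" b] B by (simp add: mpow_def)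
  have "op_bound (mpow B n) (C * \<nu> ^ n)" for n
  proof (induction n rule: less_induct)
    case (less n)
    show ?case
    proof (cases "n < k")
      case True
      have "b ^ n / \<nu> ^ n \<le> (\<Sum>r<k. b ^ r / \<nu> ^ r)"
        using True nn by (intro member_le_sum) auto
      then have "b ^ n / \<nu> ^ n \<le> C" unfolding C_def by linarith
      then have "b ^ n \<le> C * \<nu> ^ n" using \<nu> by (simp add: field_simps)
      then show ?thesis by (rule op_bound_weaken[OF Bn])
    next
      case False
      then have "op_bound (mmult (mpow B k) (mpow B (n - k))) (\<nu> ^ k * (C * \<nu> ^ (n - k)))"
        using k by (intro op_bound_mmult Bk less.IH) auto
      moreover have "mmult (mpow B k) (mpow B (n - k)) = mpow B n"
        using mpow_add[OF bopI[OF B], of k "n - k"] False by simp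
      moreover have "\<nu> ^ k * (C * \<nu> ^ (n - k)) = C * \<nu> ^ n"
        using False by (simp add: mult_ac flip: power_add)
      ultimately show ?thesis by simp
    qed
  qed
  with C show ?thesis by (rule that)
qed

text \<open>The passage from \<open>gamma\<close> to norms:
  \<open>gamma (mpow A k) < \<nu> ^ k\<close> bounds the norm of a row tail of A^k, which dominates
  the k-th power of the row tail of A. One constant serves all M \<ge> N because tails
  decrease.\<close>

lemma rowtl_powers_geometric:
  assumes A: "bop A" and \<nu>: "rho A < \<nu>"
  obtains N C where "0 < C" "\<And>M n. N \<le> M \<Longrightarrow> op_bound (mpow (rowtl M A) n) (C * \<nu> ^ n)"
proof -
  have \<nu>0: "0 < \<nu>" using \<nu> rho_nonneg[of A] by linarith
  obtain k where k: "1 \<le> k" "gamma (mpow A k) powr (1 / real k) < \<nu>"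
    using cINF_less_iff[OF _ growth_bdd, of "\<lambda>k. gamma (mpow A k)" \<nu>] \<nu> unfolding rho_def growth_rate_def by auto
  have g0: "0 \<le> gamma (mpow A k)" by (intro gamma_nonneg bop_mpow A)
  have "gamma (mpow A k) < \<nu> ^ k"
  proof -
    have "(gamma (mpow A k) powr (1 / real k)) ^ k = gamma (mpow A k)"
      by (rule power_of_powr_root[OF g0 k(1)])
    then show ?thesis
      using power_strict_mono[OF k(2), of k] k(1) by simp
  qed
  then obtain N where N: "op_bound (rowtl N (mpow A k)) (\<nu> ^ k)"
    using gamma_lessD_rowtl[OF bop_mpow[OF A]] by blast
  obtain j where j: "k = Suc j" using k(1) by (cases k) auto
  have NB: "op_bound (mpow (rowtl N A) k) (\<nu> ^ k)"
    using op_bound_mono[OF N] mle_mpow_rowtl[OF A, of N j] bop_nonneg_mat bop_mpow bop_tails(1) A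
    unfolding j by blast
  obtain b where b: "op_bound (rowtl N A) b"
    using bop_tails(1)[OF A, of N] by (auto simp: bop_def)
  obtain C where C: "0 < C" "\<And>n. op_bound (mpow (rowtl N A) n) (C * \<nu> ^ n)"
    using op_bound_mpow_geometric[OF b k(1) NB \<nu>0] by metis
  have "op_bound (mpow (rowtl M A) n) (C * \<nu> ^ n)" if "N \<le> M" for M n
  proof (rule op_bound_mono[OF C(2)[of n]])
    show "nonneg_mat (mpow (rowtl M A) n)"
      by (intro bop_nonneg_mat bop_mpow bop_tails A)
    have "mle (rowtl M A) (rowtl N A)"
      using that bop_nonneg[OF A] by (auto simp: mle_def rowtl_def)
    then show "mle (mpow (rowtl M A) n) (mpow (rowtl N A) n)"
      by (intro mpow_mono bop_tails A)
  qed
  with C(1) show ?thesis by (rule that)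
qed

lemma summable_neumann_bound:
  fixes \<nu> \<mu> :: real
  assumes "0 \<le> \<nu>" "\<nu> < \<mu>"
  shows "summable (\<lambda>k. C * \<nu> ^ k / \<mu> ^ Suc k)"
proof -
  have "summable (\<lambda>k. C / \<mu> * (\<nu> / \<mu>) ^ k)"
    using assms by (intro summable_mult summable_geometric) auto
  then show ?thesis by (simp add: power_divide mult.commute mult.left_commute)
qed

text \<open>z is the sum of B^k y / \<mu>^(k+1). Its norm bound, linear in the norm of y, is
  recorded because closedness of the range needs solutions that tend to 0 together with y.\<close>

lemma neumann_solve:
  fixes \<mu> :: complex
  assumes B: "\<And>k. op_bound (mpow B k) (C * \<nu> ^ k)" and \<nu>: "0 < \<nu>" "\<nu> < cmod \<mu>" and y: "l2 y"
  obtains z where "l2 z" "l2norm z \<le> (\<Sum>k. C * \<nu> ^ k / cmod \<mu> ^ Suc k) * l2norm y"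
    "\<And>i. \<mu> * z i = mapp B z i + y i"
proof -
  have B1: "op_bound B (C * \<nu>)" using B[of 1] by simp
  define w where "w k = mapp (mpow B k) y" for k
  define v where "v k i = w k i / \<mu> ^ Suc k" for k i
  have \<mu>: "\<mu> \<noteq> 0" using \<nu> by auto
  have lw: "l2 (w k)" "l2norm (w k) \<le> C * \<nu> ^ k * l2norm y" for k
    using l2_mapp[OF B y] l2norm_mapp[OF B y] by (auto simp: w_def)
  have w0: "w 0 = y"
  proof
    fix i show "w 0 i = y i"
      unfolding w_def mapp_def mpow_simps id_mat_def by (subst suminf_finite[of "{i}"]) auto
  qed
  have wS: "w (Suc k) = mapp B (w k)" for k
    unfolding w_def mpow_simps by (rule mapp_mmult[OF B1 B y])
  have veq: "v k = (\<lambda>i. inverse (\<mu> ^ Suc k) * w k i)" for k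
    by (auto simp: v_def divide_inverse mult.commute)
  define c where "c k = C * \<nu> ^ k / cmod \<mu> ^ Suc k * l2norm y" for k
  have lv: "l2 (v k)" "l2norm (v k) \<le> c k" for k
  proof -
    show "l2 (v k)" unfolding veq by (rule l2_mult[OF lw(1)])
    have "l2norm (v k) = norm (inverse (\<mu> ^ Suc k)) * l2norm (w k)"
      unfolding veq by (rule l2norm_mult[OF lw(1)])
    also have "\<dots> \<le> norm (inverse (\<mu> ^ Suc k)) * (C * \<nu> ^ k * l2norm y)"
      by (intro mult_left_mono lw) auto
    also have "\<dots> = c k"
      by (simp add: c_def norm_inverse norm_power norm_mult divide_inverse mult_ac)
    finally show "l2norm (v k) \<le> c k" .
  qed
  have sc: "summable c"
    unfolding c_def using \<nu> by (intro summable_mult2 summable_neumann_bound) auto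
  define z where "z i = (\<Sum>k. v k i)" for i
  note sv = summable_l2_series[OF lv sc]
  have z: "l2 z" "l2norm z \<le> (\<Sum>k. c k)"
    unfolding z_def by (rule l2_series[OF lv sc], rule l2norm_series[OF lv sc])
  have "(\<Sum>k. c k) = (\<Sum>k. C * \<nu> ^ k / cmod \<mu> ^ Suc k) * l2norm y"
    unfolding c_def by (rule suminf_mult2[symmetric], rule summable_neumann_bound) (use \<nu> in auto)
  with z have z2: "l2norm z \<le> (\<Sum>k. C * \<nu> ^ k / cmod \<mu> ^ Suc k) * l2norm y" by simp
  have lvn: "l2 (\<lambda>i. norm (v k i))" "l2norm (\<lambda>i. norm (v k i)) \<le> c k" for k
    using lv by (simp_all add: l2_norm_iff l2norm_norm)
  have lg: "l2 (\<lambda>i. \<Sum>k. norm (v k i))"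
    by (rule l2_series[OF lvn sc])
  have eq: "\<mu> * z i = mapp B z i + y i" for i
  proof -
    have Bn: "0 \<le> B i l" for l by (rule op_boundD(3)[OF B1])
    have s1: "summable (\<lambda>k. norm (B i l *\<^sub>R v k l))" for l
      using summable_mult[OF sv[of l], of "B i l"] Bn by simp
    have e1: "(\<Sum>k. norm (B i l *\<^sub>R v k l)) = B i l * (\<Sum>k. norm (v k l))" for l
      using suminf_mult[OF sv[of l], of "B i l"] Bn by simp
    have s2: "summable (\<lambda>l. \<Sum>k. norm (B i l *\<^sub>R v k l))"
      unfolding e1 using summable_norm_cancel[OF summable_mapp[OF B1 lg, of i]] by simp
    have "mapp B z i = (\<Sum>l. \<Sum>k. B i l *\<^sub>R v k l)"
      unfolding mapp_def z_def
      by (simp add: bounded_linear.suminf[OF bounded_linear_scaleR_right summable_norm_cancel[OF sv]])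
    also have "\<dots> = (\<Sum>k. \<Sum>l. B i l *\<^sub>R v k l)"
      by (rule suminf_swap_banach[OF s1 s2])
    also have "\<dots> = (\<Sum>k. mapp B (v k) i)"
      by (simp add: mapp_def)
    \<comment> \<open>B sends each term to \<mu> times the next one, so applying B only shifts the
      series.\<close>
    also have "(\<lambda>k. mapp B (v k) i) = (\<lambda>k. \<mu> * v (Suc k) i)"
    proof
      fix k
      have "mapp B (v k) i = inverse (\<mu> ^ Suc k) * w (Suc k) i"
        unfolding veq wS by (rule mapp_mult[OF B1 lw(1)])
      then show "mapp B (v k) i = \<mu> * v (Suc k) i"
        using \<mu> by (simp add: v_def field_simps)
    qed
    also have "(\<Sum>k. \<mu> * v (Suc k) i) = \<mu> * (\<Sum>k. v (Suc k) i)"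
      using summable_norm_cancel[OF sv[of i]] by (intro suminf_mult) (simp only: summable_Suc_iff[of "\<lambda>k. v k i"])
    also have "(\<Sum>k. v (Suc k) i) = z i - v 0 i"
      unfolding z_def using suminf_split_head[OF summable_norm_cancel[OF sv[of i]]] by simp
    finally show ?thesis
      using \<mu> w0 by (simp add: v_def algebra_simps)
  qed
  show ?thesis by (rule that[OF z(1) z2 eq])
qed

text \<open>From B^k x = \<mu>^k x the norm of x would be multiplied faster than the bound C \<nu>^k
  permits.\<close>

lemma eigenvector_zero:
  fixes \<mu> :: complex
  assumes B: "\<And>k. op_bound (mpow B k) (C * \<nu> ^ k)" and \<nu>: "0 < \<nu>" "\<nu> < cmod \<mu>"
    and x: "l2 x" "\<And>i. mapp B x i = \<mu> * x i"
  shows "x i = 0"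
proof -
  have B1: "op_bound B (C * \<nu>)" using B[of 1] by simp
  have eq: "mapp (mpow B k) x = (\<lambda>i. \<mu> ^ k * x i)" for k
  proof (induction k)
    case 0
    show ?case
    proof
      fix i show "mapp (mpow B 0) x i = \<mu> ^ 0 * x i"
        unfolding mapp_def mpow_simps id_mat_def by (subst suminf_finite[of "{i}"]) auto
    qed
  next
    case (Suc k)
    have "mapp (mpow B (Suc k)) x = mapp B (\<lambda>i. \<mu> ^ k * x i)"
      unfolding mpow_simps mapp_mmult[OF B1 B x(1)] Suc ..
    also have "\<dots> = (\<lambda>i. \<mu> ^ k * (\<mu> * x i))"
      using mapp_mult[OF B1 x(1)] x(2) by (auto simp: fun_eq_iff)
    finally show ?case by (simp add: mult_ac)
  qed
  have le: "cmod \<mu> ^ k * l2norm x \<le> C * \<nu> ^ k * l2norm x" for k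
    using l2norm_mapp[OF B x(1), of k] unfolding eq by (simp add: l2norm_mult[OF x(1)] norm_power)
  have "l2norm x \<le> 0"
  proof (rule ccontr)
    assume "\<not> ?thesis"
    then have "cmod \<mu> ^ k \<le> C * \<nu> ^ k" for k
      using le[of k] by simp
    then have "(cmod \<mu> / \<nu>) ^ k \<le> C" for k
      using \<nu> by (simp add: power_divide divide_le_eq)
    moreover obtain k where "C < (cmod \<mu> / \<nu>) ^ k"
      using real_arch_pow[of "cmod \<mu> / \<nu>" C] \<nu> by auto
    ultimately show False by (meson not_le)
  qed
  then show ?thesis by (rule l2norm_eq_0D[OF x(1)])
qed

section \<open>Finite-dimensional subspaces of complex sequences\<close>

definition csubspace :: "(nat \<Rightarrow> complex) set \<Rightarrow> bool" where
  "csubspace W \<longleftrightarrow> (\<lambda>i. 0) \<in> W \<and> (\<forall>x\<in>W. \<forall>y\<in>W. \<forall>a b. (\<lambda>i. a * x i + b * y i) \<in> W)"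

lemma csubspaceD:
  assumes "csubspace W"
  shows "(\<lambda>i. 0) \<in> W" "x \<in> W \<Longrightarrow> y \<in> W \<Longrightarrow> (\<lambda>i. a * x i + b * y i) \<in> W"
  using assms by (auto simp: csubspace_def)

text \<open>N functionals separating the points of W bound its dimension by N. The induction passes
  to the kernel of the last functional and adds at most one vector outside it.\<close>

lemma fin_dim_c_of_functionals:
  fixes N :: nat
  assumes "csubspace W"
    and "\<And>l x y a b. l < N \<Longrightarrow> x \<in> W \<Longrightarrow> y \<in> W \<Longrightarrow> \<phi> l (\<lambda>i. a * x i + b * y i) = a * \<phi> l x + b * \<phi> l y"
    and "\<And>x. x \<in> W \<Longrightarrow> (\<And>l. l < N \<Longrightarrow> \<phi> l x = 0) \<Longrightarrow> x = (\<lambda>i. 0)"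
  shows "fin_dim_c W"
  using assms
proof (induction N arbitrary: W)
  case 0
  then have "\<And>z. z \<in> W \<Longrightarrow> z = (\<lambda>i. 0)" by blast
  then show ?case
    unfolding fin_dim_c_def by (intro exI[of _ "{}"]) auto
next
  case (Suc N)
  note lin = Suc.prems(2)
  define W0 where "W0 = {x \<in> W. \<phi> N x = 0}"
  have z0: "\<phi> N (\<lambda>i. 0) = 0"
    using lin[of N "\<lambda>i. 0" "\<lambda>i. 0" 0 0] csubspaceD(1)[OF Suc.prems(1)] by simp
  have "csubspace W0"
    unfolding csubspace_def W0_def using csubspaceD[OF Suc.prems(1)] z0 lin by auto
  then have "fin_dim_c W0"
  proof (rule Suc.IH)
    show "\<phi> l (\<lambda>i. a * x i + b * y i) = a * \<phi> l x + b * \<phi> l y" if "l < N" "x \<in> W0" "y \<in> W0" for l x y a b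
      using that by (intro lin) (auto simp: W0_def)
    show "x = (\<lambda>i. 0)" if x: "x \<in> W0" "\<And>l. l < N \<Longrightarrow> \<phi> l x = 0" for x
      using x Suc.prems(3)[of x] by (auto simp: W0_def less_Suc_eq)
  qed
  then obtain F where F: "finite F" "F \<subseteq> W0" "\<And>z. z \<in> W0 \<Longrightarrow> \<exists>c. z = (\<lambda>i. \<Sum>f\<in>F. c f * f i)"
    unfolding fin_dim_c_def by blast
  show ?case
  proof (cases "W = W0")
    case True
    then show ?thesis using \<open>fin_dim_c W0\<close> by simp
  next
    case False
    then obtain w where w: "w \<in> W" "\<phi> N w \<noteq> 0" by (auto simp: W0_def)
    have wF: "w \<notin> F" using w F(2) by (auto simp: W0_def)
    have "\<exists>c. z = (\<lambda>i. \<Sum>f\<in>insert w F. c f * f i)" if z: "z \<in> W" for z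
    proof -
      define t where "t = \<phi> N z / \<phi> N w"
      have "(\<lambda>i. 1 * z i + (- t) * w i) \<in> W0"
        using csubspaceD(2)[OF Suc.prems(1) z w(1), of 1 "- t"] lin[of N z w 1 "- t"] z w
        by (simp add: W0_def t_def)
      then obtain c where c: "(\<lambda>i. 1 * z i + (- t) * w i) = (\<lambda>i. \<Sum>f\<in>F. c f * f i)"
        using F(3) by blast
      have "(\<Sum>f\<in>insert w F. (c(w := t)) f * f i) = z i" for i
      proof -
        have "(\<Sum>f\<in>F. (c(w := t)) f * f i) = (\<Sum>f\<in>F. c f * f i)"
          using wF by (intro sum.cong) auto
        then show ?thesis
          using fun_cong[OF c, of i] wF F(1) by (simp add: algebra_simps)
      qed
      then show ?thesis by (intro exI[of _ "c(w := t)"]) (simp add: fun_eq_iff)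
    qed
    then show ?thesis
      unfolding fin_dim_c_def using F(1,2) w by (intro exI[of _ "insert w F"]) (auto simp: W0_def)
  qed
qed

text \<open>Finite-dimensional subspaces are closed, here under coordinatewise convergence. A vector
  w of W with nonzero coordinate N eliminates that coordinate from the sequence; its multiple is
  restored in the limit.\<close>

lemma csubspace_finite_support_closed:
  assumes "csubspace W" "\<And>x i. x \<in> W \<Longrightarrow> N \<le> i \<Longrightarrow> x i = 0"
    and "\<And>n. s n \<in> W" "\<And>i. (\<lambda>n. s n i) \<longlonglongrightarrow> y i"
  shows "y \<in> W"
  using assms
proof (induction N arbitrary: W s y)
  case 0
  have "y i = 0" for i
    using LIMSEQ_unique[OF 0(4)[of i], of 0] 0(2)[OF 0(3)] by simp
  then have "y = (\<lambda>i. 0)" by auto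
  then show ?case using csubspaceD(1)[OF 0(1)] by simp
next
  case (Suc N)
  define W0 where "W0 = {x \<in> W. x N = 0}"
  have cs: "csubspace W0"
    unfolding csubspace_def W0_def using csubspaceD[OF Suc.prems(1)] by auto
  have supp: "x i = 0" if "x \<in> W0" "N \<le> i" for x i
    using that Suc.prems(2)[of x i] by (cases "i = N") (auto simp: W0_def)
  show ?case
  proof (cases "W = W0")
    case True
    have sW: "s n \<in> W0" for n
      using Suc.prems(3) True by simp
    have "y \<in> W0"
      by (rule Suc.IH[of W0 s y]) (fact cs, erule (1) supp, fact sW, fact Suc.prems(4))
    then show ?thesis
      using True by simp
  next
    case False
    then obtain w where w: "w \<in> W" "w N \<noteq> 0" by (auto simp: W0_def)
    define s' where "s' n i = 1 * s n i + (- (s n N / w N)) * w i" for n i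
    have s1: "s' n \<in> W0" for n
      using csubspaceD(2)[OF Suc.prems(1) Suc.prems(3)[of n] w(1), of 1 "- (s n N / w N)"] w(2)
      by (simp add: W0_def s'_def[abs_def])
    have s2: "(\<lambda>n. s' n i) \<longlonglongrightarrow> 1 * y i + (- (y N / w N)) * w i" for i
      unfolding s'_def using w(2) by (intro tendsto_intros Suc.prems(4)) auto
    have y': "(\<lambda>i. 1 * y i + (- (y N / w N)) * w i) \<in> W0"
      by (rule Suc.IH[of W0 s' "\<lambda>i. 1 * y i + (- (y N / w N)) * w i"])
        (fact cs, erule (1) supp, fact s1, fact s2)
    then have "(\<lambda>i. 1 * y i + (- (y N / w N)) * w i) \<in> W" by (simp add: W0_def)
    from csubspaceD(2)[OF Suc.prems(1) this w(1), of 1 "y N / w N"] show ?thesis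
      by simp
  qed
qed

lemma shifted_op_eq: "shifted_op A \<mu> z i = mapp A z i - \<mu> * z i"
  by (simp add: shifted_op_def capp_eq_mapp)

lemma shifted_op_linear:
  assumes A: "op_bound A K" and x: "l2 x" and y: "l2 y"
  shows "shifted_op A \<mu> (\<lambda>i. a * x i + b * y i) = (\<lambda>i. a * shifted_op A \<mu> x i + b * shifted_op A \<mu> y i)"
proof
  fix i
  have "mapp A (\<lambda>i. a * x i + b * y i) i = a * mapp A x i + b * mapp A y i"
    using mapp_add[OF A l2_mult[OF x, of a] l2_mult[OF y, of b]] mapp_mult[OF A x] mapp_mult[OF A y] by simp
  then show "shifted_op A \<mu> (\<lambda>i. a * x i + b * y i) i = a * shifted_op A \<mu> x i + b * shifted_op A \<mu> y i"
    by (simp add: shifted_op_eq algebra_simps)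
qed

lemma csubspace_op_range: "op_bound A K \<Longrightarrow> csubspace (op_range A \<mu>)"
  unfolding csubspace_def
proof (intro conjI ballI allI)
  assume A: "op_bound A K"
  show "(\<lambda>i. 0) \<in> op_range A \<mu>"
    unfolding op_range_def by (rule CollectI, rule exI[of _ "\<lambda>i. 0"]) (auto simp: shifted_op_eq mapp_def)
  fix x y :: "nat \<Rightarrow> complex" and a b :: complex assume "x \<in> op_range A \<mu>" "y \<in> op_range A \<mu>"
  then obtain u v where uv: "l2 u" "x = shifted_op A \<mu> u" "l2 v" "y = shifted_op A \<mu> v"
    by (auto simp: op_range_def)
  show "(\<lambda>i. a * x i + b * y i) \<in> op_range A \<mu>"
    unfolding op_range_def uv
    by (rule CollectI, rule exI[of _ "\<lambda>i. a * u i + b * v i"])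
      (use uv in \<open>auto simp: shifted_op_linear[OF A] intro!: l2_add l2_mult\<close>)
qed

text \<open>With \<open>B\<close> the matrix \<open>A\<close> with its first \<open>N\<close> rows deleted, \<open>B - \<mu>\<close> is invertible by a Neumann
  series, and \<open>A - \<mu>\<close> differs from it by an operator with values supported in \<open>{..<N}\<close>. Membership of \<open>y\<close>
  in the range of \<open>A - \<mu>\<close> thus reduces to a condition in a space of dimension \<open>N\<close>.\<close>

lemma fredholm_outside_rho:
  assumes A: "bop A" and \<mu>: "rho A < cmod \<mu>"
  shows "fredholm A \<mu>"
proof -
  obtain \<nu> where \<nu>: "rho A < \<nu>" "\<nu> < cmod \<mu>" using dense[OF \<mu>] by blast
  have \<nu>0: "0 < \<nu>" using \<nu> rho_nonneg[of A] by linarith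
  obtain N C where C: "0 < C" "\<And>M n. N \<le> M \<Longrightarrow> op_bound (mpow (rowtl M A) n) (C * \<nu> ^ n)"
    using rowtl_powers_geometric[OF A \<nu>(1)] by metis
  define B where "B = rowtl N A"
  have Bn: "op_bound (mpow B n) (C * \<nu> ^ n)" for n
    using C(2)[of N n] by (simp add: B_def)
  obtain K where K: "op_bound A K" using A by (auto simp: bop_def)
  define R where "R = (\<Sum>k. C * \<nu> ^ k / cmod \<mu> ^ Suc k)"
  have Bx: "mapp B x i = (if N \<le> i then mapp A x i else 0)" for x :: "nat \<Rightarrow> complex" and i
    by (simp add: B_def mapp_rowtl)
  \<comment> \<open>The deleted rows: A - \<mu> is B - \<mu> plus \<open>hd\<close>, whose values
    are supported in {..<N}.\<close>
  define hd where "hd z = (\<lambda>i. if i < N then mapp A z i else 0)" for z :: "nat \<Rightarrow> complex"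
  have solve: "\<exists>z. l2 z \<and> l2norm z \<le> R * l2norm y \<and> (\<forall>i. shifted_op A \<mu> z i = hd z i - y i)"
    if y: "l2 y" for y
  proof -
    obtain z where z: "l2 z" "l2norm z \<le> R * l2norm y" "\<And>i. \<mu> * z i = mapp B z i + y i"
      using neumann_solve[OF Bn \<nu>0 \<nu>(2) y] unfolding R_def by metis
    have "shifted_op A \<mu> z i = hd z i - y i" for i
      using z(3)[of i] by (auto simp: shifted_op_eq hd_def Bx split: if_splits)
    with z show ?thesis by blast
  qed
  have range: "csubspace (op_range A \<mu>)" by (rule csubspace_op_range[OF K])
  have kernel: "fin_dim_c (op_kernel A \<mu>)"
  \<comment> \<open>A kernel vector x for which the first N coordinates of A x vanish satisfies B x
    = \<mu> x and is therefore zero.\<close>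
  proof (rule fin_dim_c_of_functionals[of _ N "\<lambda>l x. mapp A x l"])
    show "csubspace (op_kernel A \<mu>)"
      unfolding csubspace_def op_kernel_def
      by (auto simp: shifted_op_linear[OF K] intro!: l2_add l2_mult) (auto simp: shifted_op_eq mapp_def)
    show "mapp A (\<lambda>i. a * x i + b * y i) l = a * mapp A x l + b * mapp A y l"
      if "x \<in> op_kernel A \<mu>" "y \<in> op_kernel A \<mu>" for l x y a b
      using that mapp_add[OF K l2_mult[of x a] l2_mult[of y b]] mapp_mult[OF K, of x a] mapp_mult[OF K, of y b]
      by (simp add: op_kernel_def)
    show "x = (\<lambda>i. 0)" if x: "x \<in> op_kernel A \<mu>" "\<And>l. l < N \<Longrightarrow> mapp A x l = 0" for x
    proof
      fix i
      have "l2 x" and eq: "mapp A x j = \<mu> * x j" for j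
        using x(1) shifted_op_eq[of A \<mu> x j] by (auto simp: op_kernel_def)
      have "mapp B x j = \<mu> * x j" for j
        using x(2)[of j] eq[of j] by (auto simp: Bx not_le)
      then show "x i = 0"
        by (rule eigenvector_zero[OF Bn \<nu>0 \<nu>(2) \<open>l2 x\<close>])
    qed
  qed
  have closed: "y \<in> op_range A \<mu>" if s: "\<And>n. s n \<in> op_range A \<mu>" and y: "l2 y"
    and lim: "(\<lambda>n. l2norm (\<lambda>i. s n i - y i)) \<longlonglongrightarrow> 0" for s y
  proof -
    have ls: "l2 (s n)" for n
    proof -
      obtain z where "l2 z" "s n = shifted_op A \<mu> z" using s[of n] by (auto simp: op_range_def)
      then show ?thesis
        using l2_diff[OF l2_mapp[OF K \<open>l2 z\<close>] l2_mult[OF \<open>l2 z\<close>, of \<mu>]] by (simp add: shifted_op_eq[abs_def])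
    qed
    have lsy: "l2 (\<lambda>i. s n i - y i)" for n by (intro l2_diff ls y)
    obtain z where z: "l2 z" "\<And>i. shifted_op A \<mu> z i = hd z i - y i"
      using solve[OF y] by blast
    have "\<forall>n. \<exists>d. l2 d \<and> l2norm d \<le> R * l2norm (\<lambda>i. s n i - y i) \<and>
        (\<forall>i. shifted_op A \<mu> d i = hd d i - (s n i - y i))"
      using solve[OF lsy] by blast
    from choice[OF this] obtain d where d: "\<And>n. l2 (d n)"
      "\<And>n. l2norm (d n) \<le> R * l2norm (\<lambda>i. s n i - y i)"
      "\<And>n i. shifted_op A \<mu> (d n) i = hd (d n) i - (s n i - y i)" by blast
    define W where "W = {x \<in> op_range A \<mu>. \<forall>i\<ge>N. x i = 0}"
    have "csubspace W"
      unfolding W_def csubspace_def using csubspaceD[OF range] by auto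
    moreover have "x i = 0" if "x \<in> W" "N \<le> i" for x i
      using that by (simp add: W_def)
    \<comment> \<open>This vector is the image of z + d n under A - \<mu>, plus s n: the occurrences
      of y and s n cancel.\<close>
    moreover have "(\<lambda>i. hd z i + hd (d n) i) \<in> W" for n
    proof -
      have "shifted_op A \<mu> (\<lambda>i. 1 * z i + 1 * d n i) \<in> op_range A \<mu>"
        unfolding op_range_def
        by (rule CollectI, rule exI[of _ "\<lambda>i. 1 * z i + 1 * d n i"]) (intro conjI refl l2_add l2_mult z d)
      from csubspaceD(2)[OF range this s[of n], of 1 1]
      have "(\<lambda>i. hd z i + hd (d n) i) \<in> op_range A \<mu>"
        unfolding shifted_op_linear[OF K z(1) d(1)] by (simp add: z(2) d(3))
      then show ?thesis by (simp add: W_def hd_def)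
    qed
    \<comment> \<open>The norm bound in \<open>solve\<close> makes d n tend to 0 with s n - y, so
      that only \<open>hd z\<close> survives.\<close>
    moreover have "(\<lambda>n. hd z i + hd (d n) i) \<longlonglongrightarrow> hd z i" for i
    proof -
      have "norm (hd (d n) i) \<le> norm (l2norm (\<lambda>i. s n i - y i)) * (K * R)" for n
      proof -
        have "norm (hd (d n) i) \<le> l2norm (mapp A (d n))"
          using norm_le_l2norm[OF l2_mapp[OF K d(1)], of n i] l2norm_nonneg[OF l2_mapp[OF K d(1)], of n]
          by (simp add: hd_def)
        also have "\<dots> \<le> K * (R * l2norm (\<lambda>i. s n i - y i))"
          by (rule order_trans[OF l2norm_mapp[OF K d(1)]]) (intro mult_left_mono d op_bound_nonneg[OF K])
        finally show ?thesis
          using l2norm_nonneg[OF lsy[of n]] by (simp add: mult_ac)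
      qed
      then have "(\<lambda>n. hd (d n) i) \<longlonglongrightarrow> 0"
        by (intro tendsto_0_le[OF lim]) (auto intro!: always_eventually)
      from tendsto_add[OF tendsto_const[of "hd z i"] this] show ?thesis by simp
    qed
    ultimately have "hd z \<in> W"
      by (rule csubspace_finite_support_closed)
    then have "hd z \<in> op_range A \<mu>" by (simp add: W_def)
    moreover have "shifted_op A \<mu> z \<in> op_range A \<mu>"
      unfolding op_range_def using z(1) by blast
    ultimately have "(\<lambda>i. 1 * hd z i + (- 1) * shifted_op A \<mu> z i) \<in> op_range A \<mu>"
      by (rule csubspaceD(2)[OF range])
    then show ?thesis by (simp add: z(2))
  qed
  define e where "e l = (\<lambda>i :: nat. if i = l then 1 else 0 :: complex)" for l :: nat
  \<comment> \<open>\<open>fredholm\<close> sums over a set of vectors; distinctness of the unit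
    vectors lets this sum be indexed by l.\<close>
  have inj: "inj_on e {..<N}"
    unfolding e_def by (rule inj_onI) (metis zero_neq_one)
  have coker: "\<exists>z c. l2 z \<and> y = (\<lambda>i. shifted_op A \<mu> z i + (\<Sum>f\<in>e ` {..<N}. c f * f i))" if y: "l2 y" for y
  proof -
    obtain z where z: "l2 z" "\<And>i. shifted_op A \<mu> z i = hd z i - y i"
      using solve[OF y] by blast
    define c where "c f = (\<Sum>l<N. hd z l * f l)" for f :: "nat \<Rightarrow> complex"
    have ce: "c (e l) = hd z l" if "l < N" for l
    proof -
      have "c (e l) = (\<Sum>k\<in>{l}. hd z k * e l k)"
        unfolding c_def using that by (intro sum.mono_neutral_right) (auto simp: e_def)
      then show ?thesis by (simp add: e_def)
    qed
    have "(\<Sum>f\<in>e ` {..<N}. c f * f i) = hd z i" for i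
    proof -
      have "(\<Sum>f\<in>e ` {..<N}. c f * f i) = (\<Sum>l<N. hd z l * e l i)"
        by (subst sum.reindex[OF inj]) (simp add: ce)
      also have "\<dots> = (if i < N then hd z i else 0)"
        by (simp add: e_def if_distrib[of "\<lambda>x. _ * x"] sum.delta' cong: if_cong)
      finally show ?thesis by (simp add: hd_def)
    qed
    moreover have "shifted_op A \<mu> (\<lambda>i. - z i) i = y i - hd z i" for i
      using fun_cong[OF shifted_op_linear[OF K z(1) z(1), of \<mu> "-1" 0], of i] z(2)[of i] by simp
    ultimately show ?thesis
      using l2_uminus[OF z(1)] by (intro exI[of _ "\<lambda>i. - z i"] exI[of _ c]) simp
  qed
  have le: "l2 (e l)" for l
    by (rule l2_finite_support[of "{l}"]) (auto simp: e_def)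
  show ?thesis
    unfolding fredholm_def
    using kernel closed coker le by (intro conjI exI[of _ "e ` {..<N}"]) auto
qed

lemma rho_ess_upper:
  assumes A: "bop A"
  shows "bdd_above (insert 0 (cmod ` ess_spectrum A))" and "rho_ess A \<le> rho A"
proof -
  have le: "x \<le> rho A" if "x \<in> insert 0 (cmod ` ess_spectrum A)" for x
    using that fredholm_outside_rho[OF A] rho_nonneg[of A] by (auto simp: ess_spectrum_def not_less[symmetric])
  then show "bdd_above (insert 0 (cmod ` ess_spectrum A))" by (rule bdd_aboveI)
  show "rho_ess A \<le> rho A"
    unfolding rho_ess_def using le by (intro cSup_least) auto
qed

section \<open>The essential growth rate belongs to the essential spectrum\<close>

lemma inner_add_left:
  fixes x y u :: "nat \<Rightarrow> real"
  assumes "l2 x" "l2 y" "l2 u"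
  shows "(\<Sum>i. (x i + y i) * u i) = (\<Sum>i. x i * u i) + (\<Sum>i. y i * u i)"
  using suminf_add[OF summable_inner_l2[OF assms(1,3)] summable_inner_l2[OF assms(2,3)]]
  by (simp add: distrib_right)

lemma inner_self_l2: "l2 u \<Longrightarrow> (\<Sum>i. u i * u i) = (l2norm u)\<^sup>2" for u :: "nat \<Rightarrow> real"
  by (simp add: l2norm_def l2_def suminf_nonneg power2_eq_square)

text \<open>Sokal's proof: signs are chosen so that the partial sums of \<open>\<Sum>k. \<plusminus> 3\<^sup>-\<^sup>k v\<^sub>k / \<parallel>v\<^sub>k\<parallel>\<close> satisfy
  \<open>\<bar>\<langle>s\<^sub>k\<^sub>+\<^sub>1, v\<^sub>k\<rangle>\<bar> \<ge> 3\<^sup>-\<^sup>k \<parallel>v\<^sub>k\<parallel>\<close>; the remaining terms can cancel at most half of this.\<close>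

lemma l2_uniform_boundedness:
  fixes u :: "nat \<Rightarrow> nat \<Rightarrow> real"
  assumes u: "\<And>n. l2 (u n)" and pw: "\<And>y. l2 y \<Longrightarrow> \<exists>K. \<forall>n. \<bar>\<Sum>i. y i * u n i\<bar> \<le> K"
  shows "\<exists>K. \<forall>n. l2norm (u n) \<le> K"
proof (rule ccontr)
  assume "\<not> ?thesis"
  then have "\<forall>k::nat. \<exists>n. 4 ^ k < l2norm (u n)"
    by (meson not_le)
  from choice[OF this] obtain f where f: "\<And>k. 4 ^ k < l2norm (u (f k))" by blast
  define v where "v k = u (f k)" for k
  have v: "l2 (v k)" and big: "4 ^ k < l2norm (v k)" for k
    using u f by (auto simp: v_def)
  have vpos: "0 < l2norm (v k)" for k
    by (rule less_trans[OF _ big]) simp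
  define a where "a k = (1/3) ^ k / l2norm (v k)" for k
  have a: "0 < a k" "a k * l2norm (v k) = (1/3) ^ k" for k
    using vpos[of k] by (simp_all add: a_def)
  define s where "s = rec_nat (\<lambda>i. 0) (\<lambda>k x i. x i + (if 0 \<le> (\<Sum>i. x i * v k i) then a k else - a k) * v k i)"
  define sg where "sg k = (if 0 \<le> (\<Sum>i. s k i * v k i) then a k else - a k)" for k
  define d where "d k i = sg k * v k i" for k i
  have s0: "s 0 = (\<lambda>i. 0)" and sS: "s (Suc k) = (\<lambda>i. s k i + d k i)" for k
    by (simp_all add: s_def d_def sg_def fun_eq_iff)
  have sgabs: "\<bar>sg k\<bar> = a k" for k
    using a(1)[of k] by (simp add: sg_def)
  have ld: "l2 (d k)" for k
    unfolding d_def[abs_def] by (rule l2_mult[OF v])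
  have nd: "l2norm (d k) \<le> (1/3) ^ k" for k
    using l2norm_mult[OF v[of k], of "sg k"] a(2)[of k] by (simp add: d_def[abs_def] sgabs)
  have sc: "summable (\<lambda>k. (1/3 :: real) ^ k)" by (simp add: summable_geometric)
  define x where "x i = (\<Sum>k. d k i)" for i
  have x: "l2 x" unfolding x_def by (rule l2_series[OF ld nd sc])
  have ssum: "s k = (\<lambda>i. \<Sum>j<k. d j i)" for k
    by (induction k) (auto simp: s0 sS)
  have ls: "l2 (s k)" for k
    unfolding ssum by (rule l2_sum) (rule ld)
  have low: "(1/3) ^ k * l2norm (v k) / 2 \<le> \<bar>\<Sum>i. x i * v k i\<bar>" for k
  proof -
    define r where "r i = (\<Sum>j. d (j + Suc k) i)" for i
    have sc': "summable (\<lambda>j. (1/3 :: real) ^ (j + Suc k))"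
      using sc by (rule summable_ignore_initial_segment)
    have r: "l2 r" "l2norm r \<le> (\<Sum>j. (1/3) ^ (j + Suc k))"
      unfolding r_def by (rule l2_series[OF ld nd sc'], rule l2norm_series[OF ld nd sc'])
    have "(\<Sum>j. (1/3 :: real) ^ (j + Suc k)) = (\<Sum>j. (1/3) ^ j * (1/3) ^ Suc k)"
      by (simp add: power_add mult_ac)
    also have "\<dots> = (\<Sum>j. (1/3) ^ j) * (1/3) ^ Suc k"
      by (rule suminf_mult2[symmetric, OF sc])
    also have "\<dots> = (1/3) ^ k / 2"
      by (simp add: suminf_geometric)
    finally have nr: "l2norm r \<le> (1/3) ^ k / 2" using r(2) by simp
    have xr: "x = (\<lambda>i. r i + s (Suc k) i)"
    proof
      fix i
      have "summable (\<lambda>j. d j i)"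
        by (rule summable_norm_cancel[OF summable_l2_series[OF ld nd sc]])
      from suminf_split_initial_segment[OF this, of "Suc k"] show "x i = r i + s (Suc k) i"
        by (simp add: x_def r_def ssum)
    qed
    have "(\<Sum>i. s (Suc k) i * v k i) = (\<Sum>i. s k i * v k i) + (\<Sum>i. d k i * v k i)"
      unfolding sS by (rule inner_add_left[OF ls ld v])
    also have "(\<Sum>i. d k i * v k i) = sg k * (l2norm (v k))\<^sup>2"
      using suminf_mult[OF summable_inner_l2[OF v v], of "sg k"] inner_self_l2[OF v[of k]]
      by (simp add: d_def mult_ac)
    finally have sv: "(\<Sum>i. s (Suc k) i * v k i) = (\<Sum>i. s k i * v k i) + sg k * (l2norm (v k))\<^sup>2" .
    have "0 \<le> a k * (l2norm (v k))\<^sup>2"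
      using a(1)[of k] by simp
    then have "\<bar>\<Sum>i. s (Suc k) i * v k i\<bar> \<ge> a k * (l2norm (v k))\<^sup>2"
      unfolding sv sg_def by (cases "0 \<le> (\<Sum>i. s k i * v k i)") simp_all
    moreover have "a k * (l2norm (v k))\<^sup>2 = (1/3) ^ k * l2norm (v k)"
      using a(2)[of k] by (simp add: power2_eq_square mult.assoc[symmetric])
    ultimately have l1: "(1/3) ^ k * l2norm (v k) \<le> \<bar>\<Sum>i. s (Suc k) i * v k i\<bar>" by simp
    have "\<bar>\<Sum>i. r i * v k i\<bar> \<le> (1/3) ^ k / 2 * l2norm (v k)"
      by (rule order_trans[OF abs_inner_l2_le[OF r(1) v] mult_right_mono[OF nr less_imp_le[OF vpos]]])
    then have "\<bar>\<Sum>i. r i * v k i\<bar> \<le> (1/3) ^ k * l2norm (v k) / 2"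
      by simp
    moreover have "(\<Sum>i. x i * v k i) = (\<Sum>i. r i * v k i) + (\<Sum>i. s (Suc k) i * v k i)"
      unfolding xr by (rule inner_add_left[OF r(1) ls v])
    ultimately show ?thesis using l1 by linarith
  qed
  obtain K where K: "\<And>n. \<bar>\<Sum>i. x i * u n i\<bar> \<le> K"
    using pw[OF x] by blast
  \<comment> \<open>The norms were chosen above 4^k in order to outgrow the weights (1/3)^k.\<close>
  have "(4/3) ^ k \<le> 2 * K" for k
  proof -
    have "(4/3) ^ k / 2 = (1/3 :: real) ^ k * 4 ^ k / 2"
      by (simp add: power_mult_distrib[symmetric])
    also have "\<dots> \<le> (1/3) ^ k * l2norm (v k) / 2"
      using big[of k] by (intro divide_right_mono mult_left_mono) auto
    also have "\<dots> \<le> \<bar>\<Sum>i. x i * u (f k) i\<bar>" using low[of k] by (simp add: v_def)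
    also have "\<dots> \<le> K" by (rule K)
    finally show ?thesis by simp
  qed
  moreover obtain k where "2 * K < (4/3) ^ k"
    using real_arch_pow[of "4/3" "2 * K"] by auto
  ultimately show False by (meson not_le)
qed

text \<open>A bilinear pairing, without conjugation. The second argument is real because the lower
  bound for the transpose of A - R is stated for real sequences, while cokernel vectors are
  complex.\<close>

definition cinner :: "(nat \<Rightarrow> complex) \<Rightarrow> (nat \<Rightarrow> real) \<Rightarrow> complex" where
  "cinner z u = (\<Sum>i. z i * complex_of_real (u i))"

lemma
  assumes "l2 z" "l2 u"
  shows summable_cinner: "summable (\<lambda>i. norm (z i * complex_of_real (u i)))"
    and norm_cinner_le: "norm (cinner z u) \<le> l2norm z * l2norm u"
proof -
  have z: "l2 (\<lambda>i. norm (z i))" using assms by (simp add: l2_norm_iff)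
  show 1: "summable (\<lambda>i. norm (z i * complex_of_real (u i)))"
    using summable_l2_mult[OF z assms(2)] by (simp add: norm_mult)
  show "norm (cinner z u) \<le> l2norm z * l2norm u"
    unfolding cinner_def using summable_norm[OF 1] suminf_l2_mult[OF z assms(2)]
    by (simp add: norm_mult l2norm_norm)
qed

lemma cinner_linear:
  assumes "l2 x" "l2 y" "l2 u"
  shows "cinner (\<lambda>i. a * x i + b * y i) u = a * cinner x u + b * cinner y u"
proof -
  note sx = summable_norm_cancel[OF summable_cinner[OF assms(1,3)]]
    and sy = summable_norm_cancel[OF summable_cinner[OF assms(2,3)]]
  have "cinner (\<lambda>i. a * x i + b * y i) u
      = (\<Sum>i. a * (x i * complex_of_real (u i)) + b * (y i * complex_of_real (u i)))"
    by (simp add: cinner_def algebra_simps)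
  also have "\<dots> = a * cinner x u + b * cinner y u"
    unfolding cinner_def by (simp add: suminf_add[symmetric] suminf_mult[symmetric] summable_mult sx sy)
  finally show ?thesis .
qed

lemma cinner_sum:
  assumes "finite F" "\<And>f. f \<in> F \<Longrightarrow> l2 f" "l2 u"
  shows "cinner (\<lambda>i. \<Sum>f\<in>F. c f * f i) u = (\<Sum>f\<in>F. c f * cinner f u)"
  using assms(1,2)
proof (induction F rule: finite_induct)
  case empty
  then show ?case by (simp add: cinner_def)
next
  case (insert g F)
  have "cinner (\<lambda>i. c g * g i + 1 * (\<Sum>f\<in>F. c f * f i)) u
      = c g * cinner g u + 1 * cinner (\<lambda>i. \<Sum>f\<in>F. c f * f i) u"
    using insert by (intro cinner_linear l2_sum l2_mult assms(3)) auto
  with insert show ?case by simp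
qed

lemma cinner_mapp:
  assumes A: "op_bound A K" and z: "l2 z" and u: "l2 u"
  shows "cinner (mapp A z) u = cinner z (mapp (mtrans A) u)"
proof -
  have A0: "0 \<le> A i j" for i j by (rule op_boundD(3)[OF A])
  have zn: "l2 (\<lambda>i. norm (z i))" using z by (simp add: l2_norm_iff)
  have un: "l2 (\<lambda>i. \<bar>u i\<bar>)" using u l2_norm_iff[of u] by simp
  have s1: "summable (\<lambda>j. norm ((A i j *\<^sub>R z j) * complex_of_real (u i)))" for i
    unfolding norm_mult by (intro summable_mult2 summable_mapp[OF A z])
  have e1: "(\<Sum>j. norm ((A i j *\<^sub>R z j) * complex_of_real (u i))) = mapp A (\<lambda>j. norm (z j)) i * \<bar>u i\<bar>" for i
    unfolding norm_mult using suminf_mult2[OF summable_mapp[OF A z, of i], of "\<bar>u i\<bar>"] A0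
    by (simp add: mapp_def)
  have s2: "summable (\<lambda>i. \<Sum>j. norm ((A i j *\<^sub>R z j) * complex_of_real (u i)))"
    unfolding e1 by (rule summable_inner_l2[OF l2_mapp[OF A zn] un])
  have "cinner (mapp A z) u = (\<Sum>i. \<Sum>j. (A i j *\<^sub>R z j) * complex_of_real (u i))"
    unfolding cinner_def mapp_def
    by (simp add: suminf_mult2[OF summable_norm_cancel[OF summable_mapp[OF A z]]])
  also have "\<dots> = (\<Sum>j. \<Sum>i. (A i j *\<^sub>R z j) * complex_of_real (u i))"
    by (rule suminf_swap_banach[OF s1 s2])
  also have "(\<lambda>j. \<Sum>i. (A i j *\<^sub>R z j) * complex_of_real (u i)) = (\<lambda>j. z j * complex_of_real (mapp (mtrans A) u j))"
  proof
    fix j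
    have s: "summable (\<lambda>i. A i j * u i)"
      by (rule summable_inner_l2[OF l2_col[OF A] u])
    have "(\<Sum>i. (A i j *\<^sub>R z j) * complex_of_real (u i)) = (\<Sum>i. z j * complex_of_real (A i j * u i))"
      by (simp add: scaleR_conv_of_real mult_ac)
    also have "\<dots> = z j * (\<Sum>i. complex_of_real (A i j * u i))"
      by (rule suminf_mult) (use s in \<open>simp only: summable_complex_of_real\<close>)
    also have "(\<Sum>i. complex_of_real (A i j * u i)) = complex_of_real (\<Sum>i. A i j * u i)"
      by (rule suminf_of_real[OF s, symmetric])
    finally show "(\<Sum>i. (A i j *\<^sub>R z j) * complex_of_real (u i)) = z j * complex_of_real (mapp (mtrans A) u j)"
      by (simp add: mapp_def mtrans_def)
  qed
  finally show ?thesis by (simp add: cinner_def)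
qed

text \<open>If \<open>u\<^sub>n\<close> had norm \<open>n + 1\<close> and made the right-hand side at most \<open>C\<close>, then \<open>\<langle>y, u\<^sub>n\<rangle>\<close> would be bounded
  in \<open>n\<close> for every \<open>y\<close> in the sum of the range of \<open>A - R\<close> and the span of \<open>F\<close>, hence for every \<open>y\<close>.\<close>

lemma adjoint_bounded_below:
  assumes A: "op_bound A K" and F: "finite F" "\<And>f. f \<in> F \<Longrightarrow> l2 f"
    and cok: "\<And>y. l2 y \<Longrightarrow> \<exists>z c. l2 z \<and> y = (\<lambda>i. shifted_op A (complex_of_real R) z i + (\<Sum>f\<in>F. c f * f i))"
  shows "\<exists>C>0. \<forall>u :: nat \<Rightarrow> real. l2 u \<longrightarrow>
    l2norm u \<le> C * (l2norm (\<lambda>i. mapp (mtrans A) u i - R * u i) + (\<Sum>f\<in>F. cmod (cinner f u)))"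
proof (rule ccontr)
  assume no: "\<not> ?thesis"
  have AT: "op_bound (mtrans A) K" by (rule op_bound_mtrans[OF A])
  define T where "T u = (\<lambda>i. mapp (mtrans A) u i - R * u i)" for u :: "nat \<Rightarrow> real"
  define q where "q u = l2norm (T u) + (\<Sum>f\<in>F. cmod (cinner f u))" for u :: "nat \<Rightarrow> real"
  have lT: "l2 (T u)" if "l2 u" for u
    unfolding T_def by (intro l2_diff l2_mapp[OF AT] l2_mult that)
  have q0: "0 \<le> q u" if "l2 u" for u
    unfolding q_def using l2norm_nonneg[OF lT[OF that]] by (intro add_nonneg_nonneg sum_nonneg) auto
  have qs: "q (\<lambda>i. t * u i) = t * q u" if u: "l2 u" and t: "0 < t" for u t
  proof -
    have "T (\<lambda>i. t * u i) = (\<lambda>i. t * T u i)"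
      using mapp_mult[OF AT u] by (auto simp: T_def fun_eq_iff algebra_simps)
    moreover have "cinner f (\<lambda>i. t * u i) = complex_of_real t * cinner f u" if "f \<in> F" for f
    proof -
      have "cinner f (\<lambda>i. t * u i) = (\<Sum>i. complex_of_real t * (f i * complex_of_real (u i)))"
        by (simp add: cinner_def mult_ac)
      also have "\<dots> = complex_of_real t * cinner f u"
        unfolding cinner_def
        by (rule suminf_mult[OF summable_norm_cancel[OF summable_cinner[OF F(2)[OF that] u]]])
      finally show ?thesis .
    qed
    ultimately show ?thesis
      using t by (simp add: q_def l2norm_mult[OF lT[OF u]] norm_mult distrib_left sum_distrib_left)
  qed
  have "\<exists>u. l2 u \<and> l2norm u = real (Suc n) \<and> q u \<le> 1" for n
  proof -
    \<comment> \<open>The bound fails in particular for the constant n + 1; scaling w to norm n + 1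
      then brings \<open>q\<close> down to at most 1.\<close>
    obtain w where w: "l2 w" "real (Suc n) * q w < l2norm w"
      using no unfolding q_def T_def by (meson not_le of_nat_0_less_iff zero_less_Suc)
    have pos: "0 < l2norm w"
      using w(2) q0[OF w(1)] by (meson le_less_trans mult_nonneg_nonneg of_nat_0_le_iff)
    define t where "t = real (Suc n) / l2norm w"
    have t: "0 < t" using pos by (simp add: t_def)
    have "q (\<lambda>i. t * w i) \<le> 1"
      using w(2) pos by (simp add: qs[OF w(1) t]) (simp add: t_def field_simps)
    moreover have "l2norm (\<lambda>i. t * w i) = real (Suc n)"
      using t pos by (simp add: l2norm_mult[OF w(1)]) (simp add: t_def)
    ultimately show ?thesis
      using l2_mult[OF w(1), of t] by blast
  qed
  then have "\<forall>n. \<exists>u. l2 u \<and> l2norm u = real (Suc n) \<and> q u \<le> 1" ..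
  from choice[OF this] obtain u :: "nat \<Rightarrow> nat \<Rightarrow> real"
    where u: "\<And>n. l2 (u n)" "\<And>n. l2norm (u n) = real (Suc n)" "\<And>n. q (u n) \<le> 1" by blast
  have "\<exists>K. \<forall>n. \<bar>\<Sum>i. y i * u n i\<bar> \<le> K" if y: "l2 y" for y :: "nat \<Rightarrow> real"
  proof -
    have "l2 (\<lambda>i. complex_of_real (y i))" using y by (simp add: l2_def)
    then obtain z c where z: "l2 z"
      and eq: "(\<lambda>i. complex_of_real (y i)) = (\<lambda>i. shifted_op A (complex_of_real R) z i + (\<Sum>f\<in>F. c f * f i))"
      using cok by blast
    have ls: "l2 (\<lambda>i. shifted_op A (complex_of_real R) z i)"
      unfolding shifted_op_eq by (intro l2_diff l2_mapp[OF A] l2_mult z)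
    have lF: "l2 (\<lambda>i. \<Sum>f\<in>F. c f * f i)"
      by (intro l2_sum l2_mult F)
    have "\<bar>\<Sum>i. y i * u n i\<bar> \<le> l2norm z + (\<Sum>f\<in>F. cmod (c f))" for n
    proof -
      have sy: "summable (\<lambda>i. y i * u n i)" by (rule summable_inner_l2[OF y u(1)])
      have lmz: "l2 (mapp A z)" by (rule l2_mapp[OF A z])
      have lmu: "l2 (mapp (mtrans A) (u n))" by (rule l2_mapp[OF AT u(1)])
      have "complex_of_real (\<Sum>i. y i * u n i) = cinner (\<lambda>i. complex_of_real (y i)) (u n)"
        unfolding cinner_def using suminf_of_real[OF sy, where 'a = complex] by simp
      also have "\<dots> = cinner (\<lambda>i. shifted_op A (complex_of_real R) z i) (u n) + cinner (\<lambda>i. \<Sum>f\<in>F. c f * f i) (u n)"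
        unfolding eq using cinner_linear[OF ls lF u(1)[of n], of 1 1] by simp
      also have "cinner (\<lambda>i. shifted_op A (complex_of_real R) z i) (u n)
          = cinner (mapp A z) (u n) - complex_of_real R * cinner z (u n)"
        using cinner_linear[OF lmz z u(1)[of n], of 1 "- complex_of_real R"] by (simp add: shifted_op_eq)
      also have "cinner (mapp A z) (u n) = cinner z (mapp (mtrans A) (u n))"
        by (rule cinner_mapp[OF A z u(1)])
      also have "\<dots> - complex_of_real R * cinner z (u n) = cinner z (T (u n))"
      proof -
        have "cinner z (T (u n)) = (\<Sum>i. z i * complex_of_real (mapp (mtrans A) (u n) i)
            - complex_of_real R * (z i * complex_of_real (u n i)))"
          by (simp add: cinner_def T_def algebra_simps)
        also have "\<dots> = cinner z (mapp (mtrans A) (u n)) - complex_of_real R * cinner z (u n)"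
          unfolding cinner_def
          using summable_norm_cancel[OF summable_cinner[OF z lmu]] summable_norm_cancel[OF summable_cinner[OF z u(1)[of n]]]
          by (simp add: suminf_diff[symmetric] suminf_mult[symmetric] summable_mult)
        finally show ?thesis by simp
      qed
      also have "cinner (\<lambda>i. \<Sum>f\<in>F. c f * f i) (u n) = (\<Sum>f\<in>F. c f * cinner f (u n))"
        by (rule cinner_sum[OF F u(1)])
      finally have "\<bar>\<Sum>i. y i * u n i\<bar> = cmod (cinner z (T (u n)) + (\<Sum>f\<in>F. c f * cinner f (u n)))"
        by (metis norm_of_real)
      also have "\<dots> \<le> l2norm z * l2norm (T (u n)) + (\<Sum>f\<in>F. cmod (c f) * cmod (cinner f (u n)))"
        by (intro order_trans[OF norm_triangle_ineq] add_mono norm_cinner_le z lT u order_trans[OF norm_sum])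
          (simp add: norm_mult)
      also have "\<dots> \<le> l2norm z * 1 + (\<Sum>f\<in>F. cmod (c f) * 1)"
      proof (intro add_mono sum_mono mult_left_mono)
        have nn: "0 \<le> (\<Sum>f\<in>F. cmod (cinner f (u n)))" by (intro sum_nonneg) auto
        show "l2norm (T (u n)) \<le> 1"
          using u(3)[of n] nn unfolding q_def by linarith
        fix f assume "f \<in> F"
        then have "cmod (cinner f (u n)) \<le> (\<Sum>f\<in>F. cmod (cinner f (u n)))"
          using F(1) by (intro member_le_sum) auto
        then show "cmod (cinner f (u n)) \<le> 1"
          using u(3)[of n] l2norm_nonneg[OF lT[OF u(1)[of n]]] unfolding q_def by linarith
      qed (use l2norm_nonneg[OF z] in auto)
      finally show ?thesis by simp
    qed
    then show ?thesis by blast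
  qed
  then obtain K' where "\<And>n. l2norm (u n) \<le> K'"
    using l2_uniform_boundedness[of u] u(1) by blast
  then have le: "real (Suc n) \<le> K'" for n unfolding u(2)[symmetric] .
  obtain n where "K' < real n" using reals_Archimedean2 by blast
  then show False using le[of n] by simp
qed

section \<open>Nonnegative resolvents and their powers\<close>

lemma op_bound_LIMSEQ:
  assumes A: "\<And>n. op_bound (A n) c" and lim: "\<And>i j. (\<lambda>n. A n i j) \<longlonglongrightarrow> B i j"
  shows "op_bound B c"
  unfolding op_bound_def
proof (intro conjI allI impI)
  show "nonneg_mat B"
    unfolding nonneg_mat_def using LIMSEQ_le_const[OF lim] op_boundD(3)[OF A] by blast
  fix I J :: "nat set" and x y :: "nat \<Rightarrow> real"
  assume *: "finite I" "finite J" "\<forall>i. 0 \<le> x i" "\<forall>i. 0 \<le> y i"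
  have "(\<lambda>n. \<Sum>i\<in>I. \<Sum>j\<in>J. y i * A n i j * x j) \<longlonglongrightarrow> (\<Sum>i\<in>I. \<Sum>j\<in>J. y i * B i j * x j)"
    by (intro tendsto_sum tendsto_mult tendsto_const lim)
  then show "(\<Sum>i\<in>I. \<Sum>j\<in>J. y i * B i j * x j) \<le> c * L2_set y I * L2_set x J"
    by (rule LIMSEQ_le_const2) (use op_boundD(2)[OF A *(1,2)] * in blast)
qed

text \<open>H is the sum of B^k / \<mu>^(k+1), a nonnegative right inverse of \<mu> - B. A matrix is
  wanted, not just a solution for each vector, because \<open>gamma\<close> of its powers is
  estimated.\<close>

lemma resolvent_exists:
  assumes B: "\<And>k. op_bound (mpow B k) (C * \<nu> ^ k)" and \<nu>: "0 < \<nu>" "\<nu> < \<mu>"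
  obtains H where "bop H" "\<And>i j. \<mu> * H i j = id_mat i j + mmult B H i j"
proof -
  have \<mu>: "0 < \<mu>" using \<nu> by simp
  have B1: "op_bound B (C * \<nu>)" using B[of 1] by simp
  have C0: "0 \<le> C" using op_bound_nonneg[OF B[of 0]] by simp
  define h where "h k i j = mpow B k i j / \<mu> ^ Suc k" for k i j
  note sm = summable_neumann_bound[of \<nu> \<mu> C, OF less_imp_le[OF \<nu>(1)] \<nu>(2)]
  have h0: "0 \<le> h k i j" for k i j
    using op_boundD(3)[OF B] \<mu> by (simp add: h_def)
  have sh: "summable (\<lambda>k. h k i j)" for i j
    by (rule summable_comparison_test'[OF sm, of 0])
      (use h0 op_bound_entry[OF B] \<mu> in \<open>auto simp: h_def abs_of_nonneg op_boundD(3)[OF B] intro!: divide_right_mono\<close>)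
  define H where "H i j = (\<Sum>k. h k i j)" for i j
  define S where "S = (\<Sum>k. C * \<nu> ^ k / \<mu> ^ Suc k)"
  have "op_bound (\<lambda>i j. \<Sum>k<n. h k i j) S" for n
  proof (rule op_bound_weaken)
    have "op_bound (\<lambda>i j. h k i j) (C * \<nu> ^ k / \<mu> ^ Suc k)" for k
      using op_bound_scale[OF B[of k], of "inverse (\<mu> ^ Suc k)"] \<mu>
      by (simp add: h_def divide_inverse mult_ac)
    then show "op_bound (\<lambda>i j. \<Sum>k<n. h k i j) (\<Sum>k<n. C * \<nu> ^ k / \<mu> ^ Suc k)"
      by (intro op_bound_sum) auto
    show "(\<Sum>k<n. C * \<nu> ^ k / \<mu> ^ Suc k) \<le> S"
      unfolding S_def by (rule sum_le_suminf[OF sm]) (use C0 \<nu> \<mu> in auto)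
  qed
  then have H: "op_bound H S"
    by (rule op_bound_LIMSEQ) (use summable_LIMSEQ[OF sh] in \<open>simp add: H_def\<close>)
  have "\<mu> * H i j = id_mat i j + mmult B H i j" for i j
  proof -
    have Bn: "0 \<le> B i l" for l by (rule op_boundD(3)[OF B1])
    have s1: "summable (\<lambda>k. norm (B i l * h k l j))" for l
      using summable_mult[OF sh[of l j], of "B i l"] Bn h0 by simp
    have e1: "(\<Sum>k. norm (B i l * h k l j)) = B i l * H l j" for l
      using suminf_mult[OF sh[of l j], of "B i l"] Bn h0 by (simp add: H_def)
    have s2: "summable (\<lambda>l. \<Sum>k. norm (B i l * h k l j))"
      unfolding e1 by (rule summable_mmult[OF B1 H])
    have "mmult B H i j = (\<Sum>l. \<Sum>k. B i l * h k l j)"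
      unfolding mmult_def H_def by (simp add: suminf_mult[OF sh])
    also have "\<dots> = (\<Sum>k. \<Sum>l. B i l * h k l j)"
      by (rule suminf_swap_banach[OF s1 s2])
    also have "(\<lambda>k. \<Sum>l. B i l * h k l j) = (\<lambda>k. \<mu> * h (Suc k) i j)"
    proof
      fix k
      have "(\<Sum>l. B i l * h k l j) = (\<Sum>l. B i l * mpow B k l j / \<mu> ^ Suc k)"
        by (simp add: h_def)
      also have "\<dots> = mpow B (Suc k) i j / \<mu> ^ Suc k"
        unfolding mpow_simps mmult_def by (rule suminf_divide[OF summable_mmult[OF B1 B]])
      finally show "(\<Sum>l. B i l * h k l j) = \<mu> * h (Suc k) i j"
        using \<mu> by (simp add: h_def)
    qed
    also have "(\<Sum>k. \<mu> * h (Suc k) i j) = \<mu> * (\<Sum>k. h (Suc k) i j)"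
      using sh[of i j] by (intro suminf_mult) (simp only: summable_Suc_iff[of "\<lambda>k. h k i j"])
    also have "(\<Sum>k. h (Suc k) i j) = H i j - h 0 i j"
      unfolding H_def using suminf_split_head[OF sh[of i j]] by simp
    finally show ?thesis
      using \<mu> by (simp add: h_def algebra_simps)
  qed
  then show ?thesis by (rule that[OF bopI[OF H]])
qed

text \<open>H^(k+1) is the sum over j of (j+k choose k) B^j / \<mu>^(j+k+1), and a single
  nonnegative term is kept. The induction on j + k combines \<mu> H^(k+1) = H^k + B H^(k+1) with
  Pascal's rule.\<close>

lemma resolvent_power_ge:
  assumes B: "bop B" and H: "bop H" and \<mu>: "0 < \<mu>"
    and eq: "\<And>i j. \<mu> * H i j = id_mat i j + mmult B H i j"
  shows "real ((j + k) choose k) * mpow B j i l \<le> \<mu> ^ (j + k + 1) * mpow H (Suc k) i l"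
proof -
  obtain b c where Bb: "op_bound B b" and Hc: "op_bound H c" using B H by (auto simp: bop_def)
  have bP: "bop (mpow H n)" "bop (mpow B n)" for n by (intro bop_mpow B H)+
  have rec: "\<mu> * mpow H (Suc k) i l = mpow H k i l + mmult B (mpow H (Suc k)) i l" for k i l
  proof -
    obtain d where d: "op_bound (mpow H k) d" using bP by (auto simp: bop_def)
    have "(\<lambda>i j. \<mu> * H i j) = (\<lambda>i j. id_mat i j + mmult B H i j)"
      by (simp add: eq)
    then have "mmult (\<lambda>i j. \<mu> * H i j) (mpow H k) = mmult (\<lambda>i j. id_mat i j + mmult B H i j) (mpow H k)"
      by simp
    moreover have "mmult (\<lambda>i j. \<mu> * H i j) (mpow H k) = (\<lambda>i j. \<mu> * mpow H (Suc k) i j)"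
      by (simp add: mmult_scale_left[OF Hc d])
    moreover have "mmult (\<lambda>i j. id_mat i j + mmult B H i j) (mpow H k)
        = (\<lambda>i j. mpow H k i j + mmult B (mpow H (Suc k)) i j)"
      by (simp add: mmult_add_left[OF op_bound_id op_bound_mmult[OF Bb Hc] d] mmult_assoc[OF Bb Hc d])
    ultimately show ?thesis by metis
  qed
  have nnB: "0 \<le> mmult B (mpow H n) i l" for n i l
    by (intro bop_nonneg bop_mmult B bP)
  have step: "t * mmult B (mpow B j) i l \<le> s * mmult B (mpow H n) i l"
    if "\<And>i l. t * mpow B j i l \<le> s * mpow H n i l" "0 \<le> t" "0 \<le> s" for t s j n i l
  proof -
    obtain d e where de: "op_bound (mpow B j) d" "op_bound (mpow H n) e"
      using bP(2)[of j] bP(1)[of n] by (auto simp: bop_def)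
    have "mle (mmult B (\<lambda>i l. t * mpow B j i l)) (mmult B (\<lambda>i l. s * mpow H n i l))"
      by (rule bop_mmult_mono) (use that B bP in \<open>auto intro: bop_scale simp: mle_def\<close>)
    then show ?thesis
      unfolding mmult_scale_right[OF Bb de(1)] mmult_scale_right[OF Bb de(2)] by (simp add: mle_def)
  qed
  show ?thesis
  proof (induction "j + k" arbitrary: j k i l rule: less_induct)
    case less
    have P: "\<mu> ^ (j + k + 1) * mpow H (Suc k) i l = \<mu> ^ (j + k) * mpow H k i l + \<mu> ^ (j + k) * mmult B (mpow H (Suc k)) i l"
    proof -
      have "\<mu> ^ (j + k + 1) * mpow H (Suc k) i l = \<mu> ^ (j + k) * (\<mu> * mpow H (Suc k) i l)"
        by simp
      then show ?thesis unfolding rec by (simp only: distrib_left)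
    qed
    have p1: "0 \<le> \<mu> ^ (j + k) * mpow H k i l" "0 \<le> \<mu> ^ (j + k) * mmult B (mpow H (Suc k)) i l"
      by (intro mult_nonneg_nonneg nnB bop_nonneg[OF bP(1)] zero_le_power less_imp_le[OF \<mu>])+
    show ?case
    proof (cases j)
      case 0
      show ?thesis
      proof (cases k)
        case 0
        with \<open>j = 0\<close> P p1 show ?thesis by simp
      next
        case (Suc k')
        have "real ((0 + k') choose k') * mpow B 0 i l \<le> \<mu> ^ (0 + k' + 1) * mpow H (Suc k') i l"
          by (rule less) (use Suc \<open>j = 0\<close> in simp)
        with P p1 show ?thesis using \<open>j = 0\<close> Suc by simp
      qed
    next
      case (Suc j')
      have IHj: "real ((j' + k) choose k) * mpow B j' i l \<le> \<mu> ^ (j + k) * mpow H (Suc k) i l" for i l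
        using less[of j' k i l] Suc by simp
      have 2: "real ((j' + k) choose k) * mpow B j i l \<le> \<mu> ^ (j + k) * mmult B (mpow H (Suc k)) i l"
        using step[OF IHj] \<mu> Suc by simp
      show ?thesis
      proof (cases k)
        case 0
        with P p1 2 show ?thesis by simp
      next
        case (Suc k')
        have 1: "real ((j + k') choose k') * mpow B j i l \<le> \<mu> ^ (j + k) * mpow H k i l"
          using less[of j k' i l] Suc by simp
        have "(j + k) choose k = ((j + k') choose k') + ((j' + k) choose k)"
          using \<open>j = Suc j'\<close> Suc by simp
        then have "real ((j + k) choose k) * mpow B j i l
            = real ((j + k') choose k') * mpow B j i l + real ((j' + k) choose k) * mpow B j i l"
          by (simp add: distrib_right)
        with 1 2 show ?thesis unfolding P by linarith
      qed
    qed
  qed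
qed

section \<open>Perturbation by finitely many rows\<close>

definition rowhd :: "nat \<Rightarrow> mat \<Rightarrow> mat" where
  "rowhd N A = (\<lambda>i j. if i < N then A i j else 0)"

lemma bop_rowhd: "bop A \<Longrightarrow> bop (rowhd N A)"
  using bop_nonneg[of A] by (auto elim!: bop_mono simp: nonneg_mat_def mle_def rowhd_def)

text \<open>The corner from N on is zero.\<close>

lemma gamma_rowhd: "bop A \<Longrightarrow> gamma (rowhd N A) = 0"
  using gamma_leI[OF bop_rowhd, of A N N 0] gamma_nonneg[OF bop_rowhd, of A N] op_bound_zero
  by (simp add: cortl_def rowhd_def if_distrib cong: if_cong)

lemma rowtl_plus_rowhd: "A = (\<lambda>i j. rowtl N A i j + rowhd N A i j)"
  by (auto simp: rowtl_def rowhd_def fun_eq_iff)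

lemma gamma_mmult_zero:
  assumes "bop A" "bop B" "gamma A = 0 \<or> gamma B = 0"
  shows "gamma (mmult A B) = 0"
  using gamma_mmult[OF assms(1,2)] gamma_nonneg[OF bop_mmult[OF assms(1,2)]] assms(3) by auto

text \<open>Matrices with \<open>gamma\<close> 0 are stable under sums and under products with
  bounded matrices, and A^k agrees with the power of the tail up to such a matrix. The remainder
  appears as a summand, so that all matrices stay nonnegative.\<close>

lemma mpow_eq_mpow_rowtl_plus:
  assumes A: "bop A"
  shows "\<exists>K. bop K \<and> gamma K = 0 \<and> mpow A k = (\<lambda>i j. mpow (rowtl N A) k i j + K i j)"
proof (induction k)
  case 0
  have "bop (\<lambda>i j. 0)" "gamma (\<lambda>i j. 0) = 0"
    using bopI[OF op_bound_zero] gamma_le[OF op_bound_zero] gamma_nonneg[OF bopI[OF op_bound_zero]] by auto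
  then show ?case by (intro exI[of _ "\<lambda>i j. 0"]) simp
next
  case (Suc k)
  then obtain K where K: "bop K" "gamma K = 0" "mpow A k = (\<lambda>i j. mpow (rowtl N A) k i j + K i j)"
    by blast
  let ?B = "rowtl N A" and ?P = "rowhd N A"
  let ?K = "\<lambda>i j. mmult ?B K i j + mmult ?P (mpow A k) i j"
  have B: "bop ?B" and P: "bop ?P" by (intro bop_tails bop_rowhd A)+
  have bb: "bop (mmult ?B K)" "bop (mmult ?P (mpow A k))" by (intro bop_mmult B P K bop_mpow A)+
  have g: "gamma (mmult ?B K) = 0" "gamma (mmult ?P (mpow A k)) = 0"
    by (intro gamma_mmult_zero B P K disjI2; fact K)
      (intro gamma_mmult_zero P bop_mpow A disjI1 gamma_rowhd)
  obtain b p c d e where o: "op_bound ?B b" "op_bound ?P p" "op_bound (mpow A k) c"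
      "op_bound (mpow ?B k) d" "op_bound K e"
    using B P bop_mpow[OF A, of k] bop_mpow[OF B, of k] K(1) unfolding bop_def by blast
  have "mpow A (Suc k) = mmult (\<lambda>i j. ?B i j + ?P i j) (mpow A k)"
    using rowtl_plus_rowhd[of A N] by simp
  also have "\<dots> = (\<lambda>i j. mmult ?B (mpow A k) i j + mmult ?P (mpow A k) i j)"
    by (rule mmult_add_left[OF o(1-3)])
  also have "mmult ?B (mpow A k) = (\<lambda>i j. mmult ?B (mpow ?B k) i j + mmult ?B K i j)"
    unfolding K(3) by (rule mmult_add_right[OF o(4,5,1)])
  finally have "mpow A (Suc k) = (\<lambda>i j. mpow ?B (Suc k) i j + ?K i j)"
    by (simp add: add.assoc)
  moreover have "gamma ?K = 0"
    using gamma_add[OF bb] gamma_nonneg[OF bop_add[OF bb]] g by simp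
  ultimately show ?case using bop_add[OF bb] by blast
qed

lemma gamma_mpow_rowtl:
  assumes A: "bop A"
  shows "gamma (mpow A k) \<le> gamma (mpow (rowtl N A) k)"
proof -
  obtain K where K: "bop K" "gamma K = 0" "mpow A k = (\<lambda>i j. mpow (rowtl N A) k i j + K i j)"
    using mpow_eq_mpow_rowtl_plus[OF A] by blast
  have "gamma (\<lambda>i j. mpow (rowtl N A) k i j + K i j) \<le> gamma (mpow (rowtl N A) k) + gamma K"
    by (rule gamma_add[OF bop_mpow[OF bop_tails(1)[OF A]] K(1)])
  then show ?thesis using K by simp
qed

lemma gamma_mpow_le: "bop A \<Longrightarrow> gamma (mpow A (Suc k)) \<le> gamma A ^ Suc k"
proof (induction k)
  case (Suc k)
  have "gamma (mpow A (Suc (Suc k))) \<le> gamma A * gamma (mpow A (Suc k))"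
    using gamma_mmult[OF Suc.prems bop_mpow[OF Suc.prems], of "Suc k"] by simp
  also have "\<dots> \<le> gamma A * gamma A ^ Suc k"
    by (intro mult_left_mono Suc gamma_nonneg)
  finally show ?case by simp
qed simp

text \<open>The point is that \<open>8 * C\<close> does not depend on \<open>\<mu>\<close>: the \<open>F\<close>-terms are absorbed by choosing \<open>N\<close> large,
  since \<open>H x\<close> vanishes below \<open>N\<close>, and the first \<open>N\<close> rows of \<open>B0\<close> by restricting \<open>x\<close> to a tail.\<close>

lemma resolvent_gamma_bound:
  assumes B0: "bop B0" and C: "0 < C" and F: "finite F" "\<And>f. f \<in> F \<Longrightarrow> l2 f"
    and below: "\<And>u :: nat \<Rightarrow> real. l2 u \<Longrightarrow>
      l2norm u \<le> C * (l2norm (\<lambda>i. mapp B0 u i - R * u i) + (\<Sum>f\<in>F. cmod (cinner f u)))"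
    and \<mu>: "rho B0 < \<mu>" "R < \<mu>" "C * (\<mu> - R) \<le> 1/4"
  obtains N H where "bop H" "\<And>i j. \<mu> * H i j = id_mat i j + mmult (rowtl N B0) H i j" "gamma H \<le> 8 * C"
proof -
  obtain \<nu> where \<nu>: "rho B0 < \<nu>" "\<nu> < \<mu>" using dense[OF \<mu>(1)] by blast
  have \<nu>0: "0 < \<nu>" using \<nu> rho_nonneg[of B0] by linarith
  obtain N0 C' where C': "0 < C'" "\<And>M n. N0 \<le> M \<Longrightarrow> op_bound (mpow (rowtl M B0) n) (C' * \<nu> ^ n)"
    using rowtl_powers_geometric[OF B0 \<nu>(1)] by metis
  \<comment> \<open>Chosen so that the functionals from F together contribute at most
    \<open>l2norm u / (4 * C)\<close>; the added 1 covers an empty F.\<close>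
  define \<epsilon> where "\<epsilon> = 1 / (4 * C * (real (card F) + 1))"
  have \<epsilon>: "0 < \<epsilon>" using C by (simp add: \<epsilon>_def)
  have "\<forall>f\<in>F. eventually (\<lambda>L. l2norm (\<lambda>i. if L \<le> i then f i else 0) \<le> \<epsilon>) sequentially"
  proof
    fix f assume "f \<in> F"
    from l2_tail_small[OF F(2)[OF this] \<epsilon>] obtain L where
      "\<And>M. L \<le> M \<Longrightarrow> l2norm (\<lambda>i. if M \<le> i then f i else 0) \<le> \<epsilon>" by metis
    then show "eventually (\<lambda>L. l2norm (\<lambda>i. if L \<le> i then f i else 0) \<le> \<epsilon>) sequentially"
      by (auto simp: eventually_sequentially)
  qed
  then have "eventually (\<lambda>L. \<forall>f\<in>F. l2norm (\<lambda>i. if L \<le> i then f i else 0) \<le> \<epsilon>) sequentially"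
    by (rule eventually_ball_finite[OF F(1)])
  then obtain N1 where N1: "\<And>L f. N1 \<le> L \<Longrightarrow> f \<in> F \<Longrightarrow> l2norm (\<lambda>i. if L \<le> i then f i else 0) \<le> \<epsilon>"
    by (auto simp: eventually_sequentially)
  define N where "N = max N0 N1"
  define B where "B = rowtl N B0"
  have Bn: "op_bound (mpow B n) (C' * \<nu> ^ n)" for n
    unfolding B_def by (rule C'(2)) (simp add: N_def)
  obtain H where H: "bop H" "\<And>i j. \<mu> * H i j = id_mat i j + mmult B H i j"
    using resolvent_exists[OF Bn \<nu>0 \<nu>(2)] by metis
  have \<mu>0: "0 < \<mu>" using \<nu> \<nu>0 by simp
  obtain h where h: "op_bound H h" using H by (auto simp: bop_def)
  obtain b where b: "op_bound B0 b" using B0 by (auto simp: bop_def)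
  have B1: "op_bound B (C' * \<nu>)" using Bn[of 1] by simp
  define P where "P = rowhd N B0"
  have P: "bop P" unfolding P_def by (rule bop_rowhd[OF B0])
  obtain p where p: "op_bound P p" using P by (auto simp: bop_def)
  have "gamma (mmult P H) = 0"
    unfolding P_def by (intro gamma_mmult_zero bop_rowhd B0 H disjI1 gamma_rowhd)
  \<comment> \<open>P has finitely many nonzero rows, so P H has \<open>gamma\<close> 0 and some
    column tail of it has norm at most 1.\<close>
  then obtain L where L: "op_bound (coltl L (mmult P H)) 1"
    using gamma_lessD_coltl[OF bop_mmult[OF P H(1)], of 1] by auto
  \<comment> \<open>Starting x' at L bounds P u by the norm of x'; starting it at N makes u vanish
    below N.\<close>
  define M where "M = max L N"
  have cb: "bop (coltl M H)" by (rule bop_tails[OF H(1)])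
  have "op_bound (coltl M H) (8 * C)"
  proof (rule op_boundI_l2[OF bop_nonneg_mat[OF cb]])
    fix x :: "nat \<Rightarrow> real" and J
    assume x: "\<And>j. 0 \<le> x j" "finite J" "\<And>j. j \<notin> J \<Longrightarrow> x j = 0"
    have lx: "l2 x" using x by (intro l2_finite_support[of J]) auto
    define x' where "x' j = (if M \<le> j then x j else 0)" for j
    have x': "l2 x'" "l2norm x' \<le> l2norm x"
      by (rule l2_mono[OF lx] l2norm_mono[OF lx]; simp add: x'_def)+
    define u where "u = mapp H x'"
    have cu: "mapp (coltl M H) x = u"
      unfolding u_def mapp_def coltl_def x'_def by (intro ext arg_cong[of _ _ suminf]) auto
    have lu: "l2 u" unfolding u_def by (rule l2_mapp[OF h x'(1)])
    have ueq: "\<mu> * u i = x' i + mapp B u i" for i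
    proof -
      have "\<mu> * u i = (\<Sum>j. (\<mu> * H i j) *\<^sub>R x' j)"
        unfolding u_def mapp_def
        using suminf_mult[OF summable_norm_cancel[OF summable_mapp[OF h x'(1)]], of \<mu> i] by (simp add: mult_ac)
      also have "\<dots> = (\<Sum>j. id_mat i j *\<^sub>R x' j + mmult B H i j *\<^sub>R x' j)"
        unfolding H(2) by (simp only: scaleR_left_distrib)
      also have "\<dots> = mapp id_mat x' i + mapp (mmult B H) x' i"
        unfolding mapp_def
        by (rule suminf_add[symmetric]; rule summable_norm_cancel, rule summable_mapp[OF _ x'(1)])
          (rule op_bound_id, rule op_bound_mmult[OF B1 h])
      also have "mapp id_mat x' i = x' i"
        unfolding mapp_def id_mat_def by (subst suminf_finite[of "{i}"]) auto
      finally show ?thesis by (simp add: u_def mapp_mmult[OF B1 h x'(1)])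
    qed
    have usupp: "u i = 0" if "i < N" for i
      using ueq[of i] that \<mu>0 by (simp add: B_def mapp_rowtl x'_def M_def)
    have Pu: "l2 (mapp P u)" "l2norm (mapp P u) \<le> l2norm x'"
    proof -
      show "l2 (mapp P u)" by (rule l2_mapp[OF p lu])
      have "mapp P u = mapp (mmult P H) x'"
        unfolding u_def by (rule mapp_mmult[OF p h x'(1), symmetric])
      also have "\<dots> = mapp (coltl L (mmult P H)) x'"
        unfolding mapp_def coltl_def by (intro ext arg_cong[of _ _ suminf]) (auto simp: x'_def M_def)
      finally show "l2norm (mapp P u) \<le> l2norm x'"
        using l2norm_mapp[OF L x'(1)] by simp
    qed
    have B0u: "mapp B0 u i = mapp B u i + mapp P u i" for i
      unfolding B_def P_def by (simp add: mapp_rowtl) (simp add: mapp_def rowhd_def)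
    \<comment> \<open>Two identities combine here: \<mu> u - B u = x' by the resolvent equation, and
      B0 = B + P.\<close>
    have "mapp B0 u i - R * u i = (\<mu> - R) * u i + (mapp P u i - x' i)" for i
      using ueq[of i] by (simp add: B0u algebra_simps)
    then have "l2norm (\<lambda>i. mapp B0 u i - R * u i) \<le> l2norm (\<lambda>i. (\<mu> - R) * u i) + l2norm (\<lambda>i. mapp P u i - x' i)"
      using l2norm_add[OF l2_mult[OF lu, of "\<mu> - R"] l2_diff[OF Pu(1) x'(1)]] by simp
    also have "\<dots> \<le> (\<mu> - R) * l2norm u + 2 * l2norm x'"
      using l2norm_diff[OF Pu(1) x'(1)] Pu(2) \<mu>(2) by (simp add: l2norm_mult[OF lu])
    finally have n1: "l2norm (\<lambda>i. mapp B0 u i - R * u i) \<le> (\<mu> - R) * l2norm u + 2 * l2norm x'" .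
    have n2: "(\<Sum>f\<in>F. cmod (cinner f u)) \<le> l2norm u / (4 * C)"
    proof -
      have "cmod (cinner f u) \<le> \<epsilon> * l2norm u" if f: "f \<in> F" for f
      proof -
        have "cinner f u = cinner (\<lambda>i. if N \<le> i then f i else 0) u"
          unfolding cinner_def by (intro arg_cong[of _ _ suminf] ext) (auto simp: usupp)
        also have "cmod \<dots> \<le> l2norm (\<lambda>i. if N \<le> i then f i else 0) * l2norm u"
          by (intro norm_cinner_le lu l2_mono[OF F(2)[OF f]]) auto
        also have "\<dots> \<le> \<epsilon> * l2norm u"
          by (intro mult_right_mono N1 f l2norm_nonneg lu) (simp add: N_def)
        finally show ?thesis .
      qed
      then have "(\<Sum>f\<in>F. cmod (cinner f u)) \<le> real (card F) * (\<epsilon> * l2norm u)"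
        by (rule sum_bounded_above)
      also have "\<dots> \<le> (real (card F) + 1) * (\<epsilon> * l2norm u)"
        using \<epsilon> l2norm_nonneg[OF lu] by (intro mult_right_mono) auto
      also have "\<dots> = l2norm u / (4 * C)"
      proof -
        have "m * (1 / (4 * C * m) * x) = x / (4 * C)" if "0 < m" for m x :: real
          using C that by (simp add: field_simps)
        from this[of "real (card F) + 1"] show ?thesis
          unfolding \<epsilon>_def by simp
      qed
      finally show ?thesis .
    qed
    \<comment> \<open>The terms from \<mu> - R and from F each take at most a quarter of the norm of
      u and are absorbed on the left.\<close>
    have "l2norm u \<le> C * ((\<mu> - R) * l2norm u + 2 * l2norm x' + l2norm u / (4 * C))"
      by (rule order_trans[OF below[OF lu]]) (intro mult_left_mono add_mono n1 n2 less_imp_le[OF C])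
    also have "\<dots> = (C * (\<mu> - R)) * l2norm u + 2 * C * l2norm x' + l2norm u / 4"
      using C by (simp add: field_simps)
    also have "\<dots> \<le> 1/4 * l2norm u + 2 * C * l2norm x + l2norm u / 4"
      using \<mu>(3) x'(2) C l2norm_nonneg[OF lu] by (intro add_mono mult_right_mono mult_left_mono) auto
    finally have "l2norm u \<le> 4 * C * l2norm x" by simp
    also have "\<dots> \<le> 8 * C * l2norm x"
      using C l2norm_nonneg[OF lx] by (intro mult_right_mono) auto
    finally show "l2 (mapp (coltl M H) x) \<and> l2norm (mapp (coltl M H) x) \<le> 8 * C * l2norm x"
      using lu by (simp add: cu)
  qed
  then have "op_bound (cortl M H) (8 * C)"
    by (rule op_bound_mono) (use bop_nonneg[OF H(1)] in \<open>auto simp: nonneg_mat_def mle_def cortl_def coltl_def\<close>)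
  then have "gamma H \<le> 8 * C" by (rule gamma_leI[OF H(1)])
  then show ?thesis using that[of H N] H unfolding B_def by blast
qed

text \<open>Comparing \<open>H\<^sup>k\<^sup>+\<^sup>1\<close> with a single term of its power series turns the bound on \<open>gamma H\<close> into
  \<open>(n choose k) R\<^sup>n\<^sup>-\<^sup>k \<le> \<mu>\<^sup>n\<^sup>+\<^sup>1 c\<^sup>k\<^sup>+\<^sup>1\<close>, and summation over \<open>k\<close> gives \<open>(R + 1/c)\<^sup>n \<le> (n+1) c \<mu>\<^sup>n\<^sup>+\<^sup>1\<close>.\<close>

lemma not_fredholm_at_rho:
  assumes A: "bop A" and R0: "0 < rho A"
  shows "\<not> fredholm A (complex_of_real (rho A))"
proof
  define R where "R = rho A"
  assume "fredholm A (complex_of_real (rho A))"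
  then obtain F where F: "finite F" "\<And>f. f \<in> F \<Longrightarrow> l2 f"
    and cok: "\<And>y. l2 y \<Longrightarrow> \<exists>z c. l2 z \<and> y = (\<lambda>i. shifted_op A (complex_of_real R) z i + (\<Sum>f\<in>F. c f * f i))"
    unfolding fredholm_def R_def by blast
  obtain K where K: "op_bound A K" using A by (auto simp: bop_def)
  \<comment> \<open>The lower bound concerns the transpose, so the argument runs for it; its
    \<open>rho\<close> is the same.\<close>
  define B0 where "B0 = mtrans A"
  have B0: "bop B0" unfolding B0_def by (rule bop_mtrans[OF A])
  have rB0: "rho B0 = R" unfolding B0_def R_def by (rule rho_mtrans[OF A])
  obtain C where C: "0 < C" "\<And>u :: nat \<Rightarrow> real. l2 u \<Longrightarrow>
      l2norm u \<le> C * (l2norm (\<lambda>i. mapp B0 u i - R * u i) + (\<Sum>f\<in>F. cmod (cinner f u)))"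
    using adjoint_bounded_below[OF K F cok] unfolding B0_def by blast
  define c where "c = 8 * C"
  \<comment> \<open>The increment is half of 1 / c: the final contradiction needs \<mu> < R + 1 / c,
    and the resolvent bound needs C (\<mu> - R) \<le> 1/4.\<close>
  define \<mu> where "\<mu> = R + 1 / (16 * C)"
  have c: "0 < c" using C by (simp add: c_def)
  have \<mu>: "R < \<mu>" "C * (\<mu> - R) \<le> 1/4" "\<mu> < R + 1 / c"
    using C(1) by (auto simp: \<mu>_def c_def field_simps)
  have Rpos: "0 < R" using R0 by (simp add: R_def)
  then have \<mu>0: "0 < \<mu>" using \<mu> by simp
  obtain N H where H: "bop H" "\<And>i j. \<mu> * H i j = id_mat i j + mmult (rowtl N B0) H i j" "gamma H \<le> c"
    using resolvent_gamma_bound[OF B0 C(1) F C(2), of \<mu>] \<mu> rB0 unfolding c_def by metis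
  define B where "B = rowtl N B0"
  have B: "bop B" unfolding B_def by (rule bop_tails[OF B0])
  have gB: "R ^ j \<le> gamma (mpow B j)" for j
  proof (cases j)
    case 0
    \<comment> \<open>R > 0 makes \<open>gamma B0\<close> positive, and B0 = B0 I then forces
      \<open>gamma id_mat\<close> to be at least 1.\<close>
    have "R \<le> gamma B0" using rho_le_gamma[OF B0] rB0 by simp
    moreover have "gamma B0 \<le> gamma B0 * gamma id_mat"
      using gamma_mmult[OF B0 bop_id] by simp
    ultimately have "1 \<le> gamma id_mat"
      using Rpos by (simp add: mult_le_cancel_left1 not_less[symmetric])
    then show ?thesis using 0 by simp
  next
    case (Suc n)
    have "R ^ j \<le> gamma (mpow B0 j)"
      using rho_power_le[OF B0, of j] rB0 Suc by simp
    also have "\<dots> \<le> gamma (mpow B j)"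
      unfolding B_def by (rule gamma_mpow_rowtl[OF B0])
    finally show ?thesis .
  qed
  have bin: "real (n choose k) * R ^ (n - k) \<le> \<mu> ^ (n + 1) * c ^ (k + 1)" if k: "k \<le> n" for n k
  proof -
    define j where "j = n - k"
    have n: "n = j + k" using k by (simp add: j_def)
    have ch: "0 < real (n choose k)" using k by simp
    have "real (n choose k) * R ^ j \<le> real (n choose k) * gamma (mpow B j)"
      using gB ch by (intro mult_left_mono) auto
    also have "\<dots> = gamma (\<lambda>i l. real (n choose k) * mpow B j i l)"
      by (rule gamma_scale[symmetric, OF bop_mpow[OF B] ch])
    also have "\<dots> \<le> gamma (\<lambda>i l. \<mu> ^ (n + 1) * mpow H (Suc k) i l)"
    proof (rule gamma_mono)
      show "bop (\<lambda>i l. \<mu> ^ (n + 1) * mpow H (Suc k) i l)"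
        using \<mu>0 by (intro bop_scale bop_mpow H) auto
      show "nonneg_mat (\<lambda>i l. real (n choose k) * mpow B j i l)"
        using bop_nonneg[OF bop_mpow[OF B]] by (simp add: nonneg_mat_def)
      show "mle (\<lambda>i l. real (n choose k) * mpow B j i l) (\<lambda>i l. \<mu> ^ (n + 1) * mpow H (Suc k) i l)"
        unfolding mle_def n
        using resolvent_power_ge[OF B H(1) \<mu>0 H(2)[folded B_def], of j k] by blast
    qed
    also have "\<dots> = \<mu> ^ (n + 1) * gamma (mpow H (Suc k))"
      using \<mu>0 by (intro gamma_scale bop_mpow H) auto
    also have "\<dots> \<le> \<mu> ^ (n + 1) * c ^ (k + 1)"
      using \<mu>0 order_trans[OF gamma_mpow_le[OF H(1), of k] power_mono[OF H(3) gamma_nonneg[OF H(1)], of "Suc k"]]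
      by (intro mult_left_mono) auto
    finally show ?thesis by (simp add: j_def)
  qed
  \<comment> \<open>q > 1 by the choice of \<mu>, while the binomial sum bounds q^n linearly in
    n.\<close>
  define q where "q = (R + 1 / c) / \<mu>"
  have q: "1 < q" using \<mu> \<mu>0 by (simp add: q_def)
  have qn: "q ^ n \<le> (real n + 1) * (c * \<mu>)" for n
  proof -
    have "(1 / c + R) ^ n = (\<Sum>k\<le>n. real (n choose k) * (1 / c) ^ k * R ^ (n - k))"
      by (rule binomial_ring)
    also have "\<dots> \<le> (\<Sum>k\<le>n. c * \<mu> ^ (n + 1))"
    proof (rule sum_mono)
      fix k assume "k \<in> {..n}"
      then have "real (n choose k) * R ^ (n - k) * (1 / c) ^ k \<le> \<mu> ^ (n + 1) * c ^ (k + 1) * (1 / c) ^ k"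
        using c by (intro mult_right_mono bin) auto
      also have "\<dots> = c * \<mu> ^ (n + 1)"
        using c by (simp add: power_one_over field_simps)
      finally show "real (n choose k) * (1 / c) ^ k * R ^ (n - k) \<le> c * \<mu> ^ (n + 1)"
        by (simp add: mult_ac)
    qed
    also have "\<dots> = (real n + 1) * (c * \<mu>) * \<mu> ^ n" by (simp add: algebra_simps)
    finally show ?thesis
      using \<mu>0 by (simp add: q_def power_divide divide_le_eq add.commute)
  qed
  define x where "x = 1 / q"
  have x: "0 < x" "x < 1" using q by (simp_all add: x_def)
  have "1 \<le> (real n * x ^ n + x ^ n) * (c * \<mu>)" for n
  proof -
    have "1 = q ^ n * x ^ n" using q by (simp add: x_def power_one_over)
    also have "\<dots> \<le> (real n + 1) * (c * \<mu>) * x ^ n"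
      using x by (intro mult_right_mono qn) auto
    finally show ?thesis by (simp add: algebra_simps)
  qed
  moreover have "(\<lambda>n. (real n * x ^ n + x ^ n) * (c * \<mu>)) \<longlonglongrightarrow> (0 + 0) * (c * \<mu>)"
    using x by (intro tendsto_intros powser_times_n_limit_0 LIMSEQ_power_zero) auto
  ultimately have "1 \<le> (0 + 0) * (c * \<mu>)"
    by (intro LIMSEQ_le_const[of "\<lambda>n. (real n * x ^ n + x ^ n) * (c * \<mu>)"]) auto
  then show False by simp
qed

lemma rho_ess_eq_rho:
  assumes A: "bop A"
  shows "rho_ess A = rho A"
proof (rule antisym)
  show "rho_ess A \<le> rho A" by (rule rho_ess_upper(2)[OF A])
  show "rho A \<le> rho_ess A"
  proof (cases "rho A = 0")
    case True
    then show ?thesis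
      unfolding rho_ess_def using rho_ess_upper(1)[OF A] by (auto intro: cSup_upper)
  next
    case False
    then have "0 < rho A" using rho_nonneg[of A] by simp
    then have "complex_of_real (rho A) \<in> ess_spectrum A"
      using not_fredholm_at_rho[OF A] by (simp add: ess_spectrum_def)
    then have "cmod (complex_of_real (rho A)) \<in> insert 0 (cmod ` ess_spectrum A)" by blast
    then have "cmod (complex_of_real (rho A)) \<le> rho_ess A"
      unfolding rho_ess_def by (rule cSup_upper[OF _ rho_ess_upper(1)[OF A]])
    then show ?thesis using rho_nonneg[of A] by simp
  qed
qed

section \<open>Essential growth rates of sets of matrices\<close>

lemma submult_set_pow:
  assumes S: "bdd_mats S"
  shows "submult (\<lambda>k. gamma_set (set_pow S k))"
  unfolding submult_def
proof (intro conjI allI impI)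
  note bd = bdd_above_gamma[OF bdd_mats_set_pow[OF S]]
  show nn: "0 \<le> gamma_set (set_pow S k)" for k
    unfolding gamma_set_eq by (rule sup0_nonneg[OF bd])
  fix j k :: nat
  show "gamma_set (set_pow S (j + k)) \<le> gamma_set (set_pow S j) * gamma_set (set_pow S k)"
    unfolding gamma_set_eq
  proof (rule sup0_least)
    show "0 \<le> sup0 gamma (set_pow S j) * sup0 gamma (set_pow S k)"
      using nn by (simp add: gamma_set_eq)
    fix X assume "X \<in> set_pow S (j + k)"
    moreover have "set_pow S (j + k) = set_mult (set_pow S j) (set_pow S k)"
      unfolding set_pow_def replicate_add by (rule set_prod_list_append) (use S in auto)
    ultimately obtain Y Z where YZ: "X = mmult Y Z" "Y \<in> set_pow S j" "Z \<in> set_pow S k"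
      by (auto simp: set_mult_def)
    have b: "bop Y" "bop Z"
      using YZ bdd_matsD[OF bdd_mats_set_pow[OF S]] by auto
    have "gamma X \<le> gamma Y * gamma Z"
      unfolding YZ by (rule gamma_mmult[OF b])
    also have "\<dots> \<le> sup0 gamma (set_pow S j) * sup0 gamma (set_pow S k)"
      by (intro mult_mono sup0_upper[OF bd] YZ sup0_nonneg[OF bd] gamma_nonneg b)
    finally show "gamma X \<le> sup0 gamma (set_pow S j) * sup0 gamma (set_pow S k)" .
  qed
qed

lemma rho_hat_ess_set_eq:
  "bdd_mats S \<Longrightarrow> rho_hat_ess_set S = growth_rate (\<lambda>k. gamma_set (set_pow S k))"
  unfolding rho_hat_ess_set_def by (rule limI[OF growth_rate_LIMSEQ[OF submult_set_pow]])

text \<open>Together these facts characterise \<open>rho_ess_set S\<close> as the least c \<ge> 0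
  with \<open>rho X \<le> c ^ k\<close> for all X in the k-th power of S, k \<ge> 1. Here
  \<open>rho_ess\<close> is replaced by \<open>rho\<close>, and the suprema and roots of the
  definition disappear from the later arguments.\<close>

lemma
  assumes S: "bdd_mats S"
  shows rho_ess_set_nonneg: "0 \<le> rho_ess_set S"
    and rho_le_rho_ess_set_power: "1 \<le> k \<Longrightarrow> X \<in> set_pow S k \<Longrightarrow> rho X \<le> rho_ess_set S ^ k"
    and rho_ess_set_leI: "0 \<le> c \<Longrightarrow> (\<And>k X. 1 \<le> k \<Longrightarrow> X \<in> set_pow S k \<Longrightarrow> rho X \<le> c ^ k) \<Longrightarrow> rho_ess_set S \<le> c"
proof -
  have rho_eq: "rho_ess X = rho X" if "X \<in> set_pow S k" for X k
    by (rule rho_ess_eq_rho[OF bdd_matsD[OF bdd_mats_set_pow[OF S] that]])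
  define s where "s k = Sup (insert 0 (rho_ess ` set_pow S k))" for k
  have s: "s k = sup0 rho (set_pow S k)" for k
    using rho_eq[of _ k] by (simp add: s_def sup0_def cong: image_cong)
  have eq: "rho_ess_set S = (SUP k\<in>{1..}. s k powr (1 / real k))"
    by (simp add: rho_ess_set_def s_def)
  obtain M0 where M0: "\<And>A. A \<in> S \<Longrightarrow> op_bound A M0"
    using S by (auto simp: bdd_mats_def)
  \<comment> \<open>The absolute value makes M nonnegative also when S is empty.\<close>
  define M where "M = \<bar>M0\<bar>"
  have M: "op_bound A M" if "A \<in> S" for A
    by (rule op_bound_weaken[OF M0[OF that]]) (simp add: M_def)
  have rM: "rho X \<le> M ^ k" if X: "X \<in> set_pow S k" for X k
  proof -
    obtain As where As: "X = mprod As" "length As = k" "set As \<subseteq> S"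
      using X unfolding set_pow_eq by blast
    have "op_bound X (M ^ k)"
      unfolding As(1) As(2)[symmetric] by (rule op_bound_mprod) (use M As(3) in blast)
    then have "gamma X \<le> M ^ k" "bop X" by (auto intro: gamma_le bopI)
    then show ?thesis using rho_le_gamma[of X] by linarith
  qed
  have bd: "bdd_above (rho ` set_pow S k)" for k
    using rM by (auto intro: bdd_aboveI[of _ "M ^ k"])
  have s0: "0 \<le> s k" for k
    unfolding s by (rule sup0_nonneg[OF bd])
  have sM: "s k \<le> M ^ k" for k
    unfolding s by (rule sup0_least) (use rM in \<open>auto simp: M_def\<close>)
  have bdd: "bdd_above ((\<lambda>k. s k powr (1 / real k)) ` {1..})"
  proof (rule bdd_aboveI2)
    fix k :: nat assume "k \<in> {1..}"
    then show "s k powr (1 / real k) \<le> M"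
      using sM s0 by (subst powr_inverse_le_iff) (auto simp: M_def)
  qed
  have up: "s k powr (1 / real k) \<le> rho_ess_set S" if "1 \<le> k" for k
    unfolding eq using that by (intro cSUP_upper[OF _ bdd]) auto
  show r0: "0 \<le> rho_ess_set S"
    by (rule order_trans[OF _ up[of 1]]) auto
  show "rho X \<le> rho_ess_set S ^ k" if k: "1 \<le> k" "X \<in> set_pow S k" for k X
  proof -
    have "rho X \<le> s k" unfolding s by (rule sup0_upper[OF bd k(2)])
    also have "s k \<le> rho_ess_set S ^ k"
      using up[OF k(1)] powr_inverse_le_iff[OF s0 r0 k(1)] by blast
    finally show ?thesis .
  qed
  show "rho_ess_set S \<le> c" if c: "0 \<le> c" "\<And>k X. 1 \<le> k \<Longrightarrow> X \<in> set_pow S k \<Longrightarrow> rho X \<le> c ^ k" for c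
    unfolding eq
  proof (rule cSUP_least)
    fix k :: nat assume k: "k \<in> {1..}"
    have "s k \<le> c ^ k"
      unfolding s by (rule sup0_least) (use c k in auto)
    then show "s k powr (1 / real k) \<le> c"
      using powr_inverse_le_iff[OF s0 c(1), of k] k by simp
  qed simp
qed

section \<open>Hadamard products of sets of matrices\<close>

definition hadset :: "real \<Rightarrow> 'i set \<Rightarrow> ('i \<Rightarrow> mat set) \<Rightarrow> mat set" where
  "hadset \<alpha> F S = {had \<alpha> F C |C. \<forall>l\<in>F. C l \<in> S l}"

lemma hadamard_sets_eq: "hadamard_sets \<alpha> m S = hadset \<alpha> {1..m} S"
  by (simp add: hadamard_sets_def hadset_def had_def)

text \<open>\<open>0 powr \<alpha>\<close> is 0 for every exponent, so one factor suffices to make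
  the off-diagonal entries vanish.\<close>

lemma had_id: "finite F \<Longrightarrow> F \<noteq> {} \<Longrightarrow> had \<alpha> F (\<lambda>l. id_mat) = id_mat"
  by (auto simp: had_def id_mat_def fun_eq_iff)

locale hadamard_exponent =
  fixes F :: "'i set" and \<alpha> :: real
  assumes F: "finite F" "F \<noteq> {}" and \<alpha>: "1 \<le> real (card F) * \<alpha>"
begin

lemma \<alpha>_pos: "0 < \<alpha>"
proof (rule ccontr)
  assume "\<not> 0 < \<alpha>"
  then have "real (card F) * \<alpha> \<le> 0" by (intro mult_nonneg_nonpos) auto
  with \<alpha> show False by linarith
qed

lemma bdd_mats_hadset:
  assumes S: "\<And>l. l \<in> F \<Longrightarrow> bdd_mats (S l)"
  shows "bdd_mats (hadset \<alpha> F S)"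
proof -
  have "\<forall>l\<in>F. \<exists>M. \<forall>A\<in>S l. op_bound A M" using S by (auto simp: bdd_mats_def)
  from bchoice[OF this] obtain M where M: "\<And>l A. l \<in> F \<Longrightarrow> A \<in> S l \<Longrightarrow> op_bound A (M l)" by blast
  have "op_bound (had \<alpha> F C) (\<Prod>l\<in>F. (\<bar>M l\<bar> + 1) powr \<alpha>)" if "\<forall>l\<in>F. C l \<in> S l" for C
    by (rule op_bound_had[OF F \<alpha>]) (use that in \<open>auto intro: op_bound_weaken[OF M]\<close>)
  then show ?thesis unfolding bdd_mats_def hadset_def by blast
qed

text \<open>Iterates \<open>mle_mmult_had\<close>: p runs over the positions in the matrix product,
  l over the Hadamard factors.\<close>

lemma mle_mprod_had:
  assumes X: "\<And>l p. l \<in> F \<Longrightarrow> p \<in> set ps \<Longrightarrow> bop (X l p)"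
  shows "mle (mprod (map (\<lambda>p. had \<alpha> F (\<lambda>l. X l p)) ps)) (had \<alpha> F (\<lambda>l. mprod (map (X l) ps)))"
  using X
proof (induction ps)
  case Nil
  then show ?case by (simp add: had_id[OF F])
next
  case (Cons p ps)
  have b: "bop (had \<alpha> F (\<lambda>l. X l q))" if "q \<in> set (p # ps)" for q
    by (rule bop_had[OF F \<alpha>]) (use that Cons.prems in auto)
  have b1: "bop (mprod (map (\<lambda>p. had \<alpha> F (\<lambda>l. X l p)) ps))"
    by (rule bop_mprod) (use b in auto)
  have b2: "bop (mprod (map (X l) ps))" if "l \<in> F" for l
    by (rule bop_mprod) (use that Cons.prems in auto)
  have b3: "bop (had \<alpha> F (\<lambda>l. mprod (map (X l) ps)))"
    by (rule bop_had[OF F \<alpha> b2])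
  have "mle (mmult (had \<alpha> F (\<lambda>l. X l p)) (mprod (map (\<lambda>p. had \<alpha> F (\<lambda>l. X l p)) ps)))
      (mmult (had \<alpha> F (\<lambda>l. X l p)) (had \<alpha> F (\<lambda>l. mprod (map (X l) ps))))"
    by (rule bop_mmult_mono[OF b b1 b b3]) (use Cons in auto)
  moreover have "mle (mmult (had \<alpha> F (\<lambda>l. X l p)) (had \<alpha> F (\<lambda>l. mprod (map (X l) ps))))
      (had \<alpha> F (\<lambda>l. mmult (X l p) (mprod (map (X l) ps))))"
    by (rule mle_mmult_had[OF F \<alpha>]) (use Cons.prems b2 in auto)
  ultimately show ?case by (auto intro: mle_trans)
qed

lemma rho_had:
  assumes A: "\<And>l. l \<in> F \<Longrightarrow> bop (A l)"
  shows "rho (had \<alpha> F A) \<le> (\<Prod>l\<in>F. rho (A l) powr \<alpha>)"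
  unfolding rho_def
proof (rule growth_rate_prod)
  fix k :: nat
  have hA: "bop (had \<alpha> F A)" by (rule bop_had[OF F \<alpha> A])
  have pA: "bop (mpow (A l) k)" if "l \<in> F" for l by (rule bop_mpow[OF A[OF that]])
  have "mle (mpow (had \<alpha> F A) k) (had \<alpha> F (\<lambda>l. mpow (A l) k))"
    using mle_mprod_had[of "[0..<k]" "\<lambda>l p. A l"] A by (simp add: mpow_def map_replicate_const)
  then have "gamma (mpow (had \<alpha> F A) k) \<le> gamma (had \<alpha> F (\<lambda>l. mpow (A l) k))"
    by (intro gamma_mono bop_had[OF F \<alpha> pA] bop_nonneg_mat bop_mpow hA)
  also have "\<dots> \<le> (\<Prod>l\<in>F. gamma (mpow (A l) k) powr \<alpha>)"
    by (rule gamma_had[OF F \<alpha> pA])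
  finally show "gamma (mpow (had \<alpha> F A) k) \<le> (\<Prod>l\<in>F. gamma (mpow (A l) k) powr \<alpha>)" .
qed (auto intro: submult_mpow bop_had[OF F \<alpha>] A \<alpha>_pos)

text \<open>X is a matrix product over i of Hadamard products over l of matrices
  \<open>C i l\<close>. Taking the product over i first gives some \<open>D l\<close> in the k-th
  power of \<open>S l\<close>, and the Hadamard product of the \<open>D l\<close> dominates
  X.\<close>

lemma set_pow_hadset:
  assumes S: "\<And>l. l \<in> F \<Longrightarrow> bdd_mats (S l)" and X: "X \<in> set_pow (hadset \<alpha> F S) k"
  obtains D where "\<And>l. l \<in> F \<Longrightarrow> D l \<in> set_pow (S l) k" "\<And>l. l \<in> F \<Longrightarrow> bop (D l)"
    "bop X" "bop (had \<alpha> F D)" "mle X (had \<alpha> F D)"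
proof -
  obtain As where As: "X = mprod As" "length As = k" "set As \<subseteq> hadset \<alpha> F S"
    using X unfolding set_pow_eq by blast
  have "\<forall>i. \<exists>C. i < k \<longrightarrow> As ! i = had \<alpha> F C \<and> (\<forall>l\<in>F. C l \<in> S l)"
    using As(2,3) nth_mem[of _ As] unfolding hadset_def by blast
  from choice[OF this] obtain C where C: "\<And>i. i < k \<Longrightarrow> As ! i = had \<alpha> F (C i)"
    "\<And>i l. i < k \<Longrightarrow> l \<in> F \<Longrightarrow> C i l \<in> S l" by blast
  have As_eq: "As = map (\<lambda>i. had \<alpha> F (\<lambda>l. C i l)) [0..<k]"
    using As(2) C(1) by (intro nth_equalityI) auto
  define D where "D l = mprod (map (\<lambda>i. C i l) [0..<k])" for l
  have b: "bop (C i l)" if "i < k" "l \<in> F" for i l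
    by (rule bdd_matsD[OF S[OF that(2)] C(2)[OF that]])
  have 1: "D l \<in> set_pow (S l) k" if "l \<in> F" for l
    unfolding set_pow_eq D_def using C(2) that
    by (intro CollectI exI[of _ "map (\<lambda>i. C i l) [0..<k]"]) auto
  have 2: "bop (D l)" if "l \<in> F" for l
    by (rule bdd_matsD[OF bdd_mats_set_pow[OF S[OF that]] 1[OF that]])
  have 3: "mle X (had \<alpha> F D)"
    unfolding As(1) As_eq D_def by (rule mle_mprod_had) (use b in auto)
  have 4: "bop X"
    by (rule bdd_matsD[OF bdd_mats_set_pow[OF bdd_mats_hadset[OF S]] X])
  show ?thesis by (rule that[OF 1 2 4 bop_had[OF F \<alpha> 2] 3])
qed

end

section \<open>Properties shared by the two joint radii\<close>

lemma set_pow_set_mult_Suc: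
  assumes S: "bdd_mats S" and T: "bdd_mats T"
  shows "X \<in> set_pow (set_mult S T) (Suc k) \<Longrightarrow>
    \<exists>A\<in>S. \<exists>B\<in>T. \<exists>Z\<in>set_pow (set_mult T S) k. X = mmult A (mmult Z B)"
proof (induction k arbitrary: X)
  case 0
  then show ?case by (auto simp: set_pow_def set_mult_def)
next
  case (Suc k)
  have "set_pow (set_mult S T) (Suc (Suc k)) = set_mult (set_mult S T) (set_pow (set_mult S T) (Suc k))"
    unfolding set_pow_def by (simp add: set_prod_list_Cons)
  with Suc.prems obtain A0 B0 X' where X: "X = mmult (mmult A0 B0) X'" "A0 \<in> S" "B0 \<in> T"
    "X' \<in> set_pow (set_mult S T) (Suc k)" by (auto simp: set_mult_def)
  obtain A B Z where *: "A \<in> S" "B \<in> T" "Z \<in> set_pow (set_mult T S) k" "X' = mmult A (mmult Z B)"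
    using Suc.IH[OF X(4)] by blast
  have "bop A0" "bop B0" "bop A" "bop B" "bop Z"
    using X * bdd_matsD[OF S] bdd_matsD[OF T] bdd_matsD[OF bdd_mats_set_pow[OF bdd_mats_set_mult[OF T S]]] by auto
  then have "X = mmult A0 (mmult (mmult (mmult B0 A) Z) B)"
    unfolding X *(4) by (simp add: bop_mmult_assoc bop_mmult)
  moreover have "mmult (mmult B0 A) Z \<in> set_pow (set_mult T S) (Suc k)"
    using * X by (auto simp: set_pow_def set_prod_list_Cons set_mult_def)
  ultimately show ?case using X *(2) by blast
qed

lemma set_pow_adjs:
  assumes "bdd_mats S"
  shows "set_pow (adjs S) k = adjs (set_pow S k)"
proof -
  have "adjs (set_prod_list (replicate k S)) = set_prod_list (rev (map adjs (replicate k S)))"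
    by (rule adjs_set_prod_list) (use assms in auto)
  then show ?thesis by (simp add: set_pow_def map_replicate)
qed

text \<open>All that the main argument uses of \<open>r\<close>. Single matrices enter through
  \<open>rho\<close>, which both radii bound. Commutation and adjoints are stated as inequalities,
  since exchanging the roles of the two sides turns them into equalities.\<close>

locale joint_radius =
  fixes r :: "mat set \<Rightarrow> real"
  assumes nonneg: "bdd_mats S \<Longrightarrow> 0 \<le> r S"
    and upper: "bdd_mats S \<Longrightarrow> A \<in> S \<Longrightarrow> rho A \<le> r S"
    and hadset_le: "hadamard_exponent {1..m} \<alpha> \<Longrightarrow> (\<And>l. l \<in> {1..m} \<Longrightarrow> bdd_mats (U l)) \<Longrightarrow>
      r (hadset \<alpha> {1..m::nat} U) \<le> (\<Prod>l\<in>{1..m}. r (U l) powr \<alpha>)"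
    and mult_commute_le: "bdd_mats S \<Longrightarrow> bdd_mats T \<Longrightarrow> r (set_mult S T) \<le> r (set_mult T S)"
    and adjs_le: "bdd_mats S \<Longrightarrow> r (adjs S) \<le> r S"

lemma joint_radius_rho_ess_set: "joint_radius rho_ess_set"
proof
  fix S :: "mat set" assume S: "bdd_mats S"
  show "0 \<le> rho_ess_set S" by (rule rho_ess_set_nonneg[OF S])
  show "rho A \<le> rho_ess_set S" if "A \<in> S" for A
    using rho_le_rho_ess_set_power[OF S, of 1 A] that by (simp add: set_pow_1)
  show "rho_ess_set (adjs S) \<le> rho_ess_set S"
  proof (rule rho_ess_set_leI[OF bdd_mats_adjs[OF S] rho_ess_set_nonneg[OF S]])
    fix k X assume k: "1 \<le> k" "X \<in> set_pow (adjs S) k"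
    then obtain Y where Y: "Y \<in> set_pow S k" "X = mtrans Y"
      unfolding set_pow_adjs[OF S] by (auto simp: adjs_def)
    then show "rho X \<le> rho_ess_set S ^ k"
      using rho_le_rho_ess_set_power[OF S k(1) Y(1)] rho_mtrans[OF bdd_matsD[OF bdd_mats_set_pow[OF S] Y(1)]]
      by simp
  qed
  fix T :: "mat set" assume T: "bdd_mats T"
  note TS = bdd_mats_set_mult[OF T S]
  show "rho_ess_set (set_mult S T) \<le> rho_ess_set (set_mult T S)"
  proof (rule rho_ess_set_leI[OF bdd_mats_set_mult[OF S T] rho_ess_set_nonneg[OF TS]])
    fix k X assume k: "1 \<le> k" "X \<in> set_pow (set_mult S T) k"
    then obtain n where n: "k = Suc n" by (cases k) auto
    obtain A B Z where *: "A \<in> S" "B \<in> T" "Z \<in> set_pow (set_mult T S) n" "X = mmult A (mmult Z B)"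
      using set_pow_set_mult_Suc[OF S T k(2)[unfolded n]] by blast
    have b: "bop A" "bop B" "bop Z"
      using * bdd_matsD[OF S] bdd_matsD[OF T] bdd_matsD[OF bdd_mats_set_pow[OF TS]] by auto
    have "rho X = rho (mmult (mmult Z B) A)"
      unfolding *(4) by (rule rho_mmult_commute) (intro b bop_mmult)+
    also have "mmult (mmult Z B) A = mmult Z (mmult B A)"
      by (rule bop_mmult_assoc) (fact b)+
    also have "rho \<dots> = rho (mmult (mmult B A) Z)"
      by (rule rho_mmult_commute) (intro b bop_mmult)+
    also have "mmult (mmult B A) Z \<in> set_pow (set_mult T S) k"
      using * by (auto simp: n set_pow_def set_prod_list_Cons set_mult_def)
    then have "rho (mmult (mmult B A) Z) \<le> rho_ess_set (set_mult T S) ^ k"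
      by (rule rho_le_rho_ess_set_power[OF TS k(1)])
    finally show "rho X \<le> rho_ess_set (set_mult T S) ^ k" .
  qed
next
  fix m :: nat and \<alpha> :: real and U :: "nat \<Rightarrow> mat set"
  assume h: "hadamard_exponent {1..m} \<alpha>" and U: "\<And>l. l \<in> {1..m} \<Longrightarrow> bdd_mats (U l)"
  interpret hadamard_exponent "{1..m}" \<alpha> by (rule h)
  let ?F = "{1..m}"
  show "rho_ess_set (hadset \<alpha> ?F U) \<le> (\<Prod>l\<in>?F. rho_ess_set (U l) powr \<alpha>)"
  proof (rule rho_ess_set_leI[OF bdd_mats_hadset[OF U]])
    show "0 \<le> (\<Prod>l\<in>?F. rho_ess_set (U l) powr \<alpha>)" by (rule prod_nonneg) simp
    fix k X assume k: "1 \<le> k" "X \<in> set_pow (hadset \<alpha> ?F U) k"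
    obtain D where D: "\<And>l. l \<in> ?F \<Longrightarrow> D l \<in> set_pow (U l) k" "\<And>l. l \<in> ?F \<Longrightarrow> bop (D l)"
      "bop X" "bop (had \<alpha> ?F D)" "mle X (had \<alpha> ?F D)"
      using set_pow_hadset[OF U k(2)] by metis
    have "rho X \<le> rho (had \<alpha> ?F D)" by (rule rho_mono[OF D(3-5)])
    also have "\<dots> \<le> (\<Prod>l\<in>?F. rho (D l) powr \<alpha>)" by (rule rho_had[OF D(2)])
    also have "\<dots> \<le> (\<Prod>l\<in>?F. (rho_ess_set (U l) ^ k) powr \<alpha>)"
      by (intro prod_mono conjI powr_mono2 rho_le_rho_ess_set_power[OF U k(1) D(1)] rho_nonneg)
        (use \<alpha>_pos in auto)
    also have "\<dots> = (\<Prod>l\<in>?F. (rho_ess_set (U l) powr \<alpha>) ^ k)"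
    proof (rule prod.cong[OF refl])
      fix l assume l: "l \<in> ?F"
      show "(rho_ess_set (U l) ^ k) powr \<alpha> = (rho_ess_set (U l) powr \<alpha>) ^ k"
        by (induction k) (simp_all add: powr_mult)
    qed
    also have "\<dots> = (\<Prod>l\<in>?F. rho_ess_set (U l) powr \<alpha>) ^ k" by (rule prod_power_distrib[symmetric])
    finally show "rho X \<le> (\<Prod>l\<in>?F. rho_ess_set (U l) powr \<alpha>) ^ k" .
  qed
qed

lemma joint_radius_rho_hat_ess_set: "joint_radius rho_hat_ess_set"
proof
  fix S :: "mat set" assume S: "bdd_mats S"
  note bd = bdd_above_gamma[OF bdd_mats_set_pow[OF S]]
  show "0 \<le> rho_hat_ess_set S"
    unfolding rho_hat_ess_set_eq[OF S] by (rule growth_rate_nonneg)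
  show "rho A \<le> rho_hat_ess_set S" if A: "A \<in> S" for A
    unfolding rho_hat_ess_set_eq[OF S] rho_def
  proof (rule growth_rate_mono)
    fix k :: nat
    show "0 \<le> gamma (mpow A k)" by (intro gamma_nonneg bop_mpow bdd_matsD[OF S A])
    have "mpow A k \<in> set_pow S k"
      unfolding set_pow_eq mpow_def using A by (intro CollectI exI[of _ "replicate k A"]) auto
    then show "gamma (mpow A k) \<le> gamma_set (set_pow S k)"
      unfolding gamma_set_eq by (rule sup0_upper[OF bd])
  qed
  have gadj: "gamma ` adjs U = gamma ` U" if U: "bdd_mats U" for U
    unfolding adjs_def image_image using gamma_mtrans[OF bdd_matsD[OF U]] by (auto cong: image_cong)
  show "rho_hat_ess_set (adjs S) \<le> rho_hat_ess_set S"
    using gadj[OF bdd_mats_set_pow[OF S]]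
    by (simp add: rho_hat_ess_set_eq S bdd_mats_adjs set_pow_adjs gamma_set_def)
  fix T :: "mat set" assume T: "bdd_mats T"
  note TS = bdd_mats_set_mult[OF T S] and ST = bdd_mats_set_mult[OF S T]
  note bS = bdd_above_gamma[OF S] and bT = bdd_above_gamma[OF T]
    and bTS = bdd_above_gamma[OF bdd_mats_set_pow[OF TS]]
  show "rho_hat_ess_set (set_mult S T) \<le> rho_hat_ess_set (set_mult T S)"
    unfolding rho_hat_ess_set_eq[OF TS] rho_hat_ess_set_eq[OF ST]
  proof (rule growth_rate_shift[OF submult_set_pow[OF ST] submult_set_pow[OF TS]])
    show "0 \<le> sup0 gamma S * sup0 gamma T"
      by (intro mult_nonneg_nonneg sup0_nonneg bS bT)
    fix k :: nat
    show "gamma_set (set_pow (set_mult S T) (Suc k)) \<le> sup0 gamma S * sup0 gamma T * gamma_set (set_pow (set_mult T S) k)"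
      unfolding gamma_set_eq
    proof (rule sup0_least)
      show "0 \<le> sup0 gamma S * sup0 gamma T * sup0 gamma (set_pow (set_mult T S) k)"
        by (intro mult_nonneg_nonneg sup0_nonneg bS bT bTS)
      fix X assume X: "X \<in> set_pow (set_mult S T) (Suc k)"
      obtain A B Z where *: "A \<in> S" "B \<in> T" "Z \<in> set_pow (set_mult T S) k" "X = mmult A (mmult Z B)"
        using set_pow_set_mult_Suc[OF S T X] by blast
      have b: "bop A" "bop B" "bop Z"
        using * bdd_matsD[OF S] bdd_matsD[OF T] bdd_matsD[OF bdd_mats_set_pow[OF TS]] by auto
      have "gamma X \<le> gamma A * (gamma Z * gamma B)"
        unfolding *(4) by (intro order_trans[OF gamma_mmult] mult_left_mono gamma_mmult gamma_nonneg bop_mmult b)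
      also have "\<dots> \<le> sup0 gamma S * (sup0 gamma (set_pow (set_mult T S) k) * sup0 gamma T)"
        by (intro mult_mono sup0_upper bS bT bTS * sup0_nonneg mult_nonneg_nonneg gamma_nonneg b)
      finally show "gamma X \<le> sup0 gamma S * sup0 gamma T * sup0 gamma (set_pow (set_mult T S) k)"
        by (simp add: mult_ac)
    qed
  qed
next
  fix m :: nat and \<alpha> :: real and U :: "nat \<Rightarrow> mat set"
  assume h: "hadamard_exponent {1..m} \<alpha>" and U: "\<And>l. l \<in> {1..m} \<Longrightarrow> bdd_mats (U l)"
  interpret hadamard_exponent "{1..m}" \<alpha> by (rule h)
  let ?F = "{1..m}"
  have sm1: "submult (\<lambda>k. gamma_set (set_pow (hadset \<alpha> ?F U) k))"
    by (rule submult_set_pow[OF bdd_mats_hadset[OF U]])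
  have sm2: "submult (\<lambda>k. gamma_set (set_pow (U l) k))" if "l \<in> ?F" for l
    by (rule submult_set_pow[OF U[OF that]])
  have "(\<Prod>l\<in>?F. rho_hat_ess_set (U l) powr \<alpha>) = (\<Prod>l\<in>?F. growth_rate (\<lambda>k. gamma_set (set_pow (U l) k)) powr \<alpha>)"
    by (intro prod.cong refl) (simp add: rho_hat_ess_set_eq U)
  moreover have "growth_rate (\<lambda>k. gamma_set (set_pow (hadset \<alpha> ?F U) k))
      \<le> (\<Prod>l\<in>?F. growth_rate (\<lambda>k. gamma_set (set_pow (U l) k)) powr \<alpha>)"
  proof (rule growth_rate_prod[OF sm1 sm2 \<alpha>_pos])
    fix k :: nat
    show "gamma_set (set_pow (hadset \<alpha> ?F U) k) \<le> (\<Prod>l\<in>?F. gamma_set (set_pow (U l) k) powr \<alpha>)"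
      unfolding gamma_set_eq
    proof (rule sup0_least)
      show "0 \<le> (\<Prod>l\<in>?F. sup0 gamma (set_pow (U l) k) powr \<alpha>)" by (rule prod_nonneg) simp
      fix X assume X: "X \<in> set_pow (hadset \<alpha> ?F U) k"
      obtain D where D: "\<And>l. l \<in> ?F \<Longrightarrow> D l \<in> set_pow (U l) k" "\<And>l. l \<in> ?F \<Longrightarrow> bop (D l)"
        "bop X" "bop (had \<alpha> ?F D)" "mle X (had \<alpha> ?F D)"
        using set_pow_hadset[OF U X] by metis
      have "gamma X \<le> gamma (had \<alpha> ?F D)"
        by (rule gamma_mono[OF D(4) bop_nonneg_mat[OF D(3)] D(5)])
      also have "\<dots> \<le> (\<Prod>l\<in>?F. gamma (D l) powr \<alpha>)" by (rule gamma_had[OF F \<alpha> D(2)])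
      also have "\<dots> \<le> (\<Prod>l\<in>?F. sup0 gamma (set_pow (U l) k) powr \<alpha>)"
        by (intro prod_mono conjI powr_mono2 sup0_upper[OF bdd_above_gamma[OF bdd_mats_set_pow[OF U]] D(1)] gamma_nonneg D(2))
          (use \<alpha>_pos in auto)
      finally show "gamma X \<le> (\<Prod>l\<in>?F. sup0 gamma (set_pow (U l) k) powr \<alpha>)" .
    qed
  qed
  ultimately show "rho_hat_ess_set (hadset \<alpha> ?F U) \<le> (\<Prod>l\<in>?F. rho_hat_ess_set (U l) powr \<alpha>)"
    using rho_hat_ess_set_eq[OF bdd_mats_hadset[OF U]] by simp
qed

text \<open>Moving the head of the list to its end exchanges two factors, the head and the product
  of the rest.\<close>

lemma (in joint_radius) rotate_invariant:
  assumes "\<And>S. S \<in> set Ss \<Longrightarrow> bdd_mats S"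
  shows "r (set_prod_list (rotate k Ss)) = r (set_prod_list Ss)"
proof (induction k)
  case (Suc k)
  have "r (set_prod_list (rotate1 Ts)) = r (set_prod_list Ts)" if T: "\<And>S. S \<in> set Ts \<Longrightarrow> bdd_mats S" for Ts
  proof (cases Ts)
    case (Cons S Us)
    have b: "bdd_mats S" "bdd_mats (set_prod_list Us)"
      using T Cons by (auto intro: bdd_mats_set_prod_list)
    have "set_prod_list (Us @ [S]) = set_mult (set_prod_list Us) (set_prod_list [S])"
      by (rule set_prod_list_append) (use T Cons in auto)
    then show ?thesis
      using mult_commute_le[OF b] mult_commute_le[OF b(2,1)] Cons
      by (simp add: set_prod_list_Cons[of S Us])
  qed simp
  from this[of "rotate k Ss"] Suc assms show ?case by simp
qed simp

lemma (in joint_radius) adjs_eq: "bdd_mats S \<Longrightarrow> r (adjs S) = r S"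
  using adjs_le[of S] adjs_le[OF bdd_mats_adjs, of S] by simp

section \<open>Alternating products\<close>

text \<open>For symmetric Y, \<open>gamma_square_le\<close> bounds the square of
  \<open>gamma Y\<close> by \<open>gamma\<close> of Y^2, and repeated squaring extends this to the
  exponents 2^n. It is the equality of norm and spectral radius for self-adjoint elements, read
  modulo compact operators.\<close>

lemma gamma_le_rho_of_symmetric:
  assumes Y: "bop Y" "mtrans Y = Y"
  shows "gamma Y \<le> rho Y"
proof (rule dense_ge)
  fix t assume t: "rho Y < t"
  have t0: "0 < t" using t rho_nonneg[of Y] by linarith
  obtain C where C: "0 < C" "\<And>n. 1 \<le> n \<Longrightarrow> gamma (mpow Y n) \<le> C * t ^ n"
    using rho_growth[OF Y(1) t] by metis
  have sq: "gamma Y ^ (2 ^ n) \<le> gamma (mpow Y (2 ^ n))" for n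
  proof (induction n)
    case (Suc n)
    have sym: "mtrans (mpow Y (2 ^ n)) = mpow Y (2 ^ n)"
      using mtrans_mpow[OF Y(1)] Y(2) by simp
    have "gamma Y ^ (2 ^ Suc n) = (gamma Y ^ (2 ^ n))\<^sup>2"
      by (simp add: power_mult[symmetric] mult.commute)
    also have "\<dots> \<le> (gamma (mpow Y (2 ^ n)))\<^sup>2"
      by (intro power_mono Suc zero_le_power gamma_nonneg Y)
    also have "\<dots> \<le> gamma (mmult (mtrans (mpow Y (2 ^ n))) (mpow Y (2 ^ n)))"
      by (intro gamma_square_le bop_mpow Y)
    also have "\<dots> = gamma (mpow Y (2 ^ Suc n))"
      unfolding sym by (simp add: mpow_add[OF Y(1), symmetric] mult_2)
    finally show ?case .
  qed simp
  show "gamma Y \<le> t"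
  proof (rule ccontr)
    assume "\<not> gamma Y \<le> t"
    then have x: "1 < gamma Y / t" using t0 by simp
    have "(gamma Y / t) ^ n \<le> C" for n
    proof -
      have "(gamma Y / t) ^ n \<le> (gamma Y / t) ^ (2 ^ n)"
        using x by (intro power_increasing) (auto intro: less_imp_le less_exp)
      also have "\<dots> \<le> C"
        using order_trans[OF sq[of n] C(2)[of "2 ^ n"]] t0 by (simp add: power_divide divide_le_eq)
      finally show ?thesis .
    qed
    moreover obtain n where "C < (gamma Y / t) ^ n" using real_arch_pow[OF x] by blast
    ultimately show False by (meson not_le)
  qed
qed

text \<open>Powers of \<open>mpow Y q\<close> are the powers of Y with exponent q k, and an infimum
  over fewer exponents is no smaller.\<close>

lemma rho_power_le_rho_mpow:
  assumes Y: "bop Y" and q: "1 \<le> q"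
  shows "rho Y ^ q \<le> rho (mpow Y q)"
  unfolding rho_def[of "mpow Y q"] growth_rate_def
proof (rule cINF_greatest)
  fix k :: nat assume "k \<in> {1..}"
  then have k: "1 \<le> k" by simp
  have "(rho Y ^ q) ^ k \<le> gamma (mpow (mpow Y q) k)"
    using rho_power_le[OF Y, of "q * k"] k q by (simp add: power_mult mpow_mult[OF Y])
  then have "((rho Y ^ q) ^ k) powr (1 / real k) \<le> gamma (mpow (mpow Y q) k) powr (1 / real k)"
    using rho_nonneg[of Y] by (intro powr_mono2) auto
  moreover have "((rho Y ^ q) ^ k) powr (1 / real k) = rho Y ^ q"
    by (rule powr_root_of_power) (use k rho_nonneg[of Y] in auto)
  ultimately show "rho Y ^ q \<le> gamma (mpow (mpow Y q) k) powr (1 / real k)" by simp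
qed simp

section \<open>Cyclic indices and rotations\<close>

definition idx :: "nat \<Rightarrow> nat \<Rightarrow> nat" where
  "idx m k = (k - 1) mod m + 1"

lemma cyc_eq: "cyc m \<Psi> k = \<Psi> (idx m k)"
  by (simp add: cyc_def idx_def)

lemma idx_in: "1 \<le> m \<Longrightarrow> idx m k \<in> {1..m}"
  by (simp add: idx_def Suc_leI)

lemma idx_id: "j \<in> {1..m} \<Longrightarrow> idx m j = j"
  by (auto simp: idx_def)

lemma bij_betw_idx_shift:
  assumes m: "1 \<le> m"
  shows "bij_betw (\<lambda>j. idx m (j + k)) {1..m} {1..m}"
proof -
  have le: "j \<le> i" if ij: "i \<in> {1..m}" "j \<in> {1..m}" "idx m (i + k) = idx m (j + k)" for i j
  proof (rule ccontr)
    assume "\<not> j \<le> i"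
    then have "((j - 1) + k) mod m = ((i - 1) + k) mod m"
      using ij by (simp add: idx_def)
    then have "m dvd ((j - 1) + k) - ((i - 1) + k)"
      using \<open>\<not> j \<le> i\<close> by (subst (asm) mod_eq_dvd_iff_nat) auto
    then have "m dvd j - i" using ij \<open>\<not> j \<le> i\<close> by simp
    then have "m \<le> j - i" using \<open>\<not> j \<le> i\<close> by (intro dvd_imp_le) auto
    then show False using ij by auto
  qed
  have "inj_on (\<lambda>j. idx m (j + k)) {1..m}"
    by (rule inj_onI) (metis le antisym)
  moreover have "(\<lambda>j. idx m (j + k)) ` {1..m} \<subseteq> {1..m}" using idx_in[OF m] by blast
  ultimately show ?thesis
    by (intro bij_betw_imageI endo_inj_surj) auto
qed

text \<open>Entrywise multiplication is commutative, so the factors may be taken in cyclically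
  shifted order.\<close>

lemma had_reindex:
  assumes m: "1 \<le> m"
  shows "had \<alpha> {1..m} (\<lambda>j. A (idx m (j + k))) = had \<alpha> {1..m} A"
  unfolding had_def
proof (intro ext)
  fix i l
  show "(\<Prod>j\<in>{1..m}. A (idx m (j + k)) i l powr \<alpha>) = (\<Prod>j\<in>{1..m}. A j i l powr \<alpha>)"
    by (rule prod.reindex_bij_betw[OF bij_betw_idx_shift[OF m], of "\<lambda>j. A j i l powr \<alpha>"])
qed

lemma mtrans_had: "mtrans (had \<alpha> F A) = had \<alpha> F (\<lambda>l. mtrans (A l))"
  by (simp add: mtrans_def had_def)

lemma mprod_alternating:
  assumes A: "bop A"
  shows "mprod (map (\<lambda>i. if even i then mtrans A else A) [0..<2 * q]) = mpow (mmult (mtrans A) A) q"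
proof (induction q)
  case (Suc q)
  have "mprod (map (\<lambda>i. if even i then mtrans A else A) [0..<2 * q] @ [mtrans A, A])
      = mmult (mpow (mmult (mtrans A) A) q) (mmult (mtrans A) A)"
    using Suc A by (subst mprod_append) (auto intro: bop_mtrans split: if_splits)
  also have "\<dots> = mpow (mmult (mtrans A) A) (q + 1)"
    using mpow_add[OF bop_mmult[OF bop_mtrans[OF A] A], of q 1] by simp
  finally show ?case by simp
qed simp

text \<open>Positions count from 0, and \<open>b\<close> fixes the parity of the adjoints;
  \<open>alt_prod\<close> is the case b = 0. Start index and parity are separate parameters because
  they wrap around differently, though a rotation by k shifts both by k.\<close>

definition alt_list :: "nat \<Rightarrow> (nat \<Rightarrow> mat set) \<Rightarrow> nat \<Rightarrow> nat \<Rightarrow> nat \<Rightarrow> mat set list" where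
  "alt_list m \<Psi> b j n = map (\<lambda>i. if even (i + b) then adjs (cyc m \<Psi> (j + i)) else cyc m \<Psi> (j + i)) [0..<n]"

lemma map_upt_1: "map f [1..<n + 1] = map (\<lambda>i. f (Suc i)) [0..<n]"
  by (simp add: map_Suc_upt[symmetric] del: upt_Suc)

lemma nth_alt_list: "i < n \<Longrightarrow> alt_list m \<Psi> b j n ! i =
    (if even (i + b) then adjs (cyc m \<Psi> (j + i)) else cyc m \<Psi> (j + i))"
  by (simp add: alt_list_def)

lemma alt_prod_eq: "alt_prod m \<Psi> j n = set_prod_list (alt_list m \<Psi> 0 j n)"
  unfolding alt_prod_def alt_list_def map_upt_1 by (rule arg_cong[of _ _ set_prod_list]) simp

lemma alt_list_cong:
  assumes "even b \<longleftrightarrow> even b'" "1 \<le> j" "1 \<le> j'" "(j - 1) mod m = (j' - 1) mod m"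
  shows "alt_list m \<Psi> b j n = alt_list m \<Psi> b' j' n"
proof -
  have "cyc m \<Psi> (j + i) = cyc m \<Psi> (j' + i)" for i
  proof -
    have "((j - 1) + i) mod m = ((j' - 1) + i) mod m"
      using assms(4) by (metis mod_add_left_eq)
    then show ?thesis using assms by (simp add: cyc_def)
  qed
  then show ?thesis using assms(1) by (simp add: alt_list_def)
qed

text \<open>A rotated position is reduced modulo n. Evenness of n preserves its parity, and
  divisibility of n by m preserves its index.\<close>

lemma rotate_alt_list:
  assumes n: "even n" "m dvd n" and j: "1 \<le> j"
  shows "rotate k (alt_list m \<Psi> b j n) = alt_list m \<Psi> (b + k) (j + k) n"
proof (rule nth_equalityI)
  show "length (rotate k (alt_list m \<Psi> b j n)) = length (alt_list m \<Psi> (b + k) (j + k) n)"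
    by (simp add: alt_list_def)
  fix i assume "i < length (rotate k (alt_list m \<Psi> b j n))"
  then have i: "i < n" by (simp add: alt_list_def)
  define i' where "i' = (k + i) mod n"
  have i': "i' < n" using i by (simp add: i'_def)
  have "even i' \<longleftrightarrow> even (k + i)"
    unfolding i'_def using n(1) by (metis dvd_mod_iff)
  then have "even (i' + b) \<longleftrightarrow> even (i + (b + k))"
    by auto
  moreover have "((j - 1) + i') mod m = ((j - 1) + (k + i)) mod m"
    unfolding i'_def using n(2) by (metis mod_add_right_eq mod_mod_cancel)
  then have "cyc m \<Psi> (j + i') = cyc m \<Psi> (j + k + i)"
    using j by (simp add: cyc_def add.assoc)
  moreover have "rotate k (alt_list m \<Psi> b j n) ! i = alt_list m \<Psi> b j n ! i'"
    using i by (simp add: nth_rotate alt_list_def i'_def)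
  ultimately show "rotate k (alt_list m \<Psi> b j n) ! i = alt_list m \<Psi> (b + k) (j + k) n ! i"
    unfolding nth_alt_list[OF i] by (simp only: nth_alt_list[OF i'])
qed

lemma prod_alternating: "(\<Prod>j=1..2 * q. if odd j then x else y) = (x * y) ^ q" for x y :: real
  by (induction q) (simp_all add: mult_ac)

section \<open>The two inequalities for a family of bounded sets\<close>

locale bounded_family = joint_radius r for r +
  fixes \<Psi> :: "nat \<Rightarrow> mat set" and m :: nat and \<alpha> :: real
  assumes m: "1 \<le> m" and \<Psi>: "\<And>j. j \<in> {1..m} \<Longrightarrow> bdd_mats (\<Psi> j)" and \<alpha>: "1 \<le> real m * \<alpha>"
begin

sublocale hadamard_exponent "{1..m}" \<alpha>
  by unfold_locales (use m \<alpha> in auto)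

lemma bdd_cyc: "bdd_mats (cyc m \<Psi> k)"
  unfolding cyc_eq by (rule \<Psi>[OF idx_in[OF m]])

lemma bdd_alt_list: "S \<in> set (alt_list m \<Psi> b j n) \<Longrightarrow> bdd_mats S"
  by (auto simp: alt_list_def bdd_cyc bdd_mats_adjs split: if_splits)

lemma bdd_alt_prod: "bdd_mats (alt_prod m \<Psi> j n)"
  unfolding alt_prod_eq by (rule bdd_mats_set_prod_list) (rule bdd_alt_list)

text \<open>With \<open>A\<close> the Hadamard product and \<open>n = 2 q\<close>, the \<open>C\<^sup>*\<close>-identity gives
  \<open>gamma A ^ n \<le> rho ((A\<^sup>* A)\<^sup>q)\<close>; writing the factors of \<open>A\<close> in the \<open>p\<close>-th copy in cyclically shifted
  order, \<open>(A\<^sup>* A)\<^sup>q\<close> is dominated by an element of the Hadamard product of the alternating products.\<close>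

lemma gamma_hadset_le:
  assumes n: "even n" "1 \<le> n"
  shows "gamma_set (hadset \<alpha> {1..m} \<Psi>)
    \<le> r (hadset \<alpha> {1..m} (\<lambda>j. alt_prod m \<Psi> j n)) powr (1 / real n)"
  unfolding gamma_set_eq
proof (rule sup0_least)
  let ?F = "{1..m}" and ?S = "hadset \<alpha> {1..m} (\<lambda>j. alt_prod m \<Psi> j n)"
  fix X assume "X \<in> hadset \<alpha> ?F \<Psi>"
  then obtain A where A: "X = had \<alpha> ?F A" "\<And>j. j \<in> ?F \<Longrightarrow> A j \<in> \<Psi> j"
    by (auto simp: hadset_def)
  have bA: "bop (A j)" if "j \<in> ?F" for j by (rule bdd_matsD[OF \<Psi>[OF that] A(2)[OF that]])
  have bX: "bop X" unfolding A(1) by (rule bop_had[OF F \<alpha>[folded card_atLeastAtMost]]) (use bA \<alpha> in auto)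
  obtain q where q: "n = 2 * q" using n(1) by blast
  then have q1: "1 \<le> q" using n(2) by simp
  define Y where "Y = mmult (mtrans X) X"
  have bY: "bop Y" unfolding Y_def by (intro bop_mmult bop_mtrans bX)
  have sY: "mtrans Y = Y" by (simp add: Y_def mtrans_mmult)
  \<comment> \<open>Factor i of the j-th alternating product. For fixed i, every A occurs exactly
    once as j varies, so the Hadamard product over j is X or its transpose.\<close>
  define Z where "Z j i = (if even i then mtrans (A (idx m (j + i))) else A (idx m (j + i)))" for j i :: nat
  have bZ: "bop (Z j i)" for j i
    using bA[OF idx_in[OF m]] by (simp add: Z_def bop_mtrans)
  define C where "C j = mprod (map (Z j) [0..<n])" for j
  have C: "C j \<in> alt_prod m \<Psi> j n" for j
    unfolding alt_prod_eq set_prod_list_eq C_def alt_list_def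
    by (intro CollectI exI[of _ "map (Z j) [0..<n]"])
      (auto simp: list_all2_map1 list_all2_map2 list_all2_same Z_def cyc_eq adjs_def A(2)[OF idx_in[OF m]])
  have bC: "bop (C j)" for j by (rule bdd_matsD[OF bdd_alt_prod C])
  have hZ: "had \<alpha> ?F (\<lambda>j. Z j i) = (if even i then mtrans X else X)" for i
    using had_reindex[OF m, of \<alpha> A i] had_reindex[OF m, of \<alpha> "\<lambda>j. mtrans (A j)" i]
    by (simp add: Z_def A(1) mtrans_had)
  have "mle (mpow Y q) (had \<alpha> ?F C)"
    using mle_mprod_had[of "[0..<n]" Z] bZ unfolding hZ C_def q mprod_alternating[OF bX] Y_def by blast
  moreover have bhC: "bop (had \<alpha> ?F C)"
    using bop_had[OF F _ bC] \<alpha> by simp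
  ultimately have "rho (mpow Y q) \<le> rho (had \<alpha> ?F C)"
    by (intro rho_mono bop_mpow bY)
  also have "\<dots> \<le> r ?S"
    by (rule upper[OF bdd_mats_hadset[OF bdd_alt_prod]]) (use C in \<open>auto simp: hadset_def\<close>)
  finally have 1: "rho (mpow Y q) \<le> r ?S" .
  have "gamma X ^ n = ((gamma X)\<^sup>2) ^ q" by (simp add: q power_mult)
  also have "\<dots> \<le> gamma Y ^ q"
    unfolding Y_def by (intro power_mono gamma_square_le bX) auto
  also have "\<dots> \<le> rho Y ^ q"
    by (intro power_mono gamma_le_rho_of_symmetric bY sY gamma_nonneg)
  also have "\<dots> \<le> rho (mpow Y q)" by (rule rho_power_le_rho_mpow[OF bY q1])
  finally have "gamma X ^ n \<le> r ?S" using 1 by simp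
  then have "(gamma X ^ n) powr (1 / real n) \<le> r ?S powr (1 / real n)"
    using gamma_nonneg[OF bX] by (intro powr_mono2) auto
  moreover have "(gamma X ^ n) powr (1 / real n) = gamma X"
    by (rule powr_root_of_power[OF gamma_nonneg[OF bX] n(2)])
  ultimately show "gamma X \<le> r ?S powr (1 / real n)" by simp
qed simp

lemma hadset_alt_prod_le:
  "r (hadset \<alpha> {1..m} (\<lambda>j. alt_prod m \<Psi> j n)) \<le> (\<Prod>j\<in>{1..m}. r (alt_prod m \<Psi> j n) powr \<alpha>)"
  by (rule hadset_le[OF hadamard_exponent_axioms bdd_alt_prod])

lemma r_alt_list_shift:
  assumes "even n" "m dvd n" "1 \<le> j"
  shows "r (set_prod_list (alt_list m \<Psi> (b + k) (j + k) n)) = r (set_prod_list (alt_list m \<Psi> b j n))"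
  using rotate_invariant[of "alt_list m \<Psi> b j n" k] bdd_alt_list unfolding rotate_alt_list[OF assms] by blast

text \<open>A rotation by j - 1 places relates \<open>alt_prod\<close> at j to a product starting at
  index 1. The parity of j decides whether the adjoints of that product sit on odd or on even
  positions, so half of the m radii equal the first factor on the right and half the second.\<close>

lemma even_case:
  assumes m2: "even m"
  shows "r (hadset \<alpha> {1..m} (\<lambda>j. alt_prod m \<Psi> j m)) powr (1 / real m)
    \<le> (r (alt_prod m \<Psi> 1 m) *
        r (set_prod_list (map (\<lambda>p. if even p then adjs (\<Psi> (m + 1 - p)) else \<Psi> (m + 1 - p)) [1..<m+1]))) powr (\<alpha> / 2)"
proof -
  define L where "L = map (\<lambda>p. if even p then adjs (\<Psi> (m + 1 - p)) else \<Psi> (m + 1 - p)) [1..<m+1]"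
  define a where "a = r (alt_prod m \<Psi> 1 m)"
  define b where "b = r (set_prod_list L)"
  obtain q where q: "m = 2 * q" using m2 by blast
  have bL: "bdd_mats S" if "S \<in> set L" for S
  proof -
    have "S \<in> (\<lambda>p. if even p then adjs (\<Psi> (m + 1 - p)) else \<Psi> (m + 1 - p)) ` {1..<m+1}"
      using that unfolding L_def set_map set_upt .
    then obtain p where p: "p \<in> {1..<m+1}" "S = (if even p then adjs (\<Psi> (m + 1 - p)) else \<Psi> (m + 1 - p))"
      by blast
    have "bdd_mats (\<Psi> (m + 1 - p))"
      by (rule \<Psi>) (use p(1) in auto)
    then show ?thesis using p(2) by (simp add: bdd_mats_adjs)
  qed
  \<comment> \<open>Taking adjoints reverses the descending product into the ascending one with
    adjoints on even positions, and \<open>r\<close> is invariant under adjoints.\<close>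
  have "rev (map adjs L) = alt_list m \<Psi> 1 1 m"
  proof (rule nth_equalityI)
    show "length (rev (map adjs L)) = length (alt_list m \<Psi> 1 1 m)"
      by (simp add: L_def alt_list_def del: upt_Suc)
    fix i assume "i < length (rev (map adjs L))"
    then have i: "i < m" by (simp add: L_def del: upt_Suc)
    have "rev (map adjs L) ! i = adjs (L ! (m - Suc i))"
      using i by (simp add: rev_nth L_def del: upt_Suc)
    also have "L ! (m - Suc i) = (if even (m - i) then adjs (\<Psi> (i + 1)) else \<Psi> (i + 1))"
      using i unfolding L_def map_upt_1 by (simp add: Suc_diff_Suc)
    also have "even (m - i) \<longleftrightarrow> even i"
      using i m2 by simp
    finally show "rev (map adjs L) ! i = alt_list m \<Psi> 1 1 m ! i"
      using i idx_id[of "Suc i" m] by (simp add: alt_list_def cyc_eq)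
  qed
  then have b_alt: "b = r (set_prod_list (alt_list m \<Psi> 1 1 m))"
    unfolding b_def using adjs_eq[of "set_prod_list L", OF bdd_mats_set_prod_list[OF bL]]
      adjs_set_prod_list[of L, OF bL] by simp
  have r_eq: "r (alt_prod m \<Psi> j m) = (if odd j then a else b)" if j: "j \<in> {1..m}" for j
  proof (cases "odd j")
    case True
    have "r (set_prod_list (alt_list m \<Psi> (0 + (j - 1)) (1 + (j - 1)) m)) = a"
      unfolding a_def alt_prod_eq by (rule r_alt_list_shift) (use m2 in auto)
    moreover have "alt_list m \<Psi> (0 + (j - 1)) (1 + (j - 1)) m = alt_list m \<Psi> 0 j m"
      by (rule alt_list_cong) (use j True in auto)
    ultimately show ?thesis using True by (simp add: alt_prod_eq)
  next
    case False
    have "r (set_prod_list (alt_list m \<Psi> (1 + (j - 1)) (1 + (j - 1)) m)) = b"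
      unfolding b_alt by (rule r_alt_list_shift) (use m2 in auto)
    moreover have "alt_list m \<Psi> (1 + (j - 1)) (1 + (j - 1)) m = alt_list m \<Psi> 0 j m"
      by (rule alt_list_cong) (use j False in auto)
    ultimately show ?thesis using False by (simp add: alt_prod_eq)
  qed
  have "r (hadset \<alpha> {1..m} (\<lambda>j. alt_prod m \<Psi> j m)) \<le> (\<Prod>j\<in>{1..m}. r (alt_prod m \<Psi> j m) powr \<alpha>)"
    by (rule hadset_alt_prod_le)
  also have "\<dots> = (\<Prod>j=1..2 * q. if odd j then a powr \<alpha> else b powr \<alpha>)"
    unfolding q[symmetric] by (intro prod.cong refl) (simp add: r_eq)
  also have "\<dots> = ((a * b) powr \<alpha>) ^ q"
    unfolding prod_alternating powr_mult ..
  finally have "r (hadset \<alpha> {1..m} (\<lambda>j. alt_prod m \<Psi> j m)) powr (1 / real m)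
      \<le> (((a * b) powr \<alpha>) ^ q) powr (1 / real m)"
    using nonneg[OF bdd_mats_hadset[OF bdd_alt_prod]] by (intro powr_mono2) auto
  also have "\<dots> = (a * b) powr (\<alpha> / 2)"
  proof (cases "a * b = 0")
    case True
    then show ?thesis using q m by (cases q) auto
  next
    case False
    then have "0 < (a * b) powr \<alpha>" by simp
    then have "((a * b) powr \<alpha>) ^ q = (a * b) powr (\<alpha> * real q)"
      by (simp add: powr_powr flip: powr_realpow)
    then show ?thesis using q m by (simp add: powr_powr)
  qed
  finally show ?thesis unfolding a_def b_def L_def .
qed

text \<open>A rotation by m places keeps all indices modulo m and, m being odd, moves the adjoints
  to the other positions. Hence all m products are rotations of a single one.\<close>

lemma odd_case:
  assumes m2: "odd m"
  shows "r (hadset \<alpha> {1..m} (\<lambda>j. alt_prod m \<Psi> j (2 * m))) powr (1 / real (2 * m))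
    \<le> r (set_prod_list (map (\<lambda>p. if even p then adjs (cyc m \<Psi> p) else cyc m \<Psi> p) [1..<2*m+1])) powr (\<alpha> / 2)"
proof -
  define a where "a = r (set_prod_list (alt_list m \<Psi> 1 1 (2 * m)))"
  have L: "map (\<lambda>p. if even p then adjs (cyc m \<Psi> p) else cyc m \<Psi> p) [1..<2*m+1] = alt_list m \<Psi> 1 1 (2 * m)"
    unfolding map_upt_1 alt_list_def by simp
  have r_eq: "r (alt_prod m \<Psi> j (2 * m)) = a" if j: "j \<in> {1..m}" for j
  proof -
    \<comment> \<open>k is odd in both cases, so the parity offset 1 + k agrees with 0, and k is
      congruent to j - 1 modulo m.\<close>
    define k where "k = (if even j then j - 1 else j - 1 + m)"
    have ra: "r (set_prod_list (alt_list m \<Psi> (1 + k) (1 + k) (2 * m))) = a"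
      unfolding a_def by (rule r_alt_list_shift) auto
    have per: "(j + m - Suc 0) mod m = (j - Suc 0) mod m"
    proof -
      have "j + m - Suc 0 = (j - Suc 0) + m" using j by simp
      then show ?thesis by simp
    qed
    have "alt_list m \<Psi> (1 + k) (1 + k) (2 * m) = alt_list m \<Psi> 0 j (2 * m)"
      by (rule alt_list_cong) (use j m2 per in \<open>auto simp: k_def\<close>)
    with ra show ?thesis by (simp add: alt_prod_eq)
  qed
  have "r (hadset \<alpha> {1..m} (\<lambda>j. alt_prod m \<Psi> j (2 * m))) \<le> (\<Prod>j\<in>{1..m}. r (alt_prod m \<Psi> j (2 * m)) powr \<alpha>)"
    by (rule hadset_alt_prod_le)
  also have "\<dots> = (a powr \<alpha>) ^ m"
    by (simp add: r_eq)
  finally have "r (hadset \<alpha> {1..m} (\<lambda>j. alt_prod m \<Psi> j (2 * m))) powr (1 / real (2 * m))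
      \<le> ((a powr \<alpha>) ^ m) powr (1 / real (2 * m))"
    using nonneg[OF bdd_mats_hadset[OF bdd_alt_prod]] by (intro powr_mono2) auto
  also have "\<dots> = a powr (\<alpha> / 2)"
  proof (cases "a = 0")
    case True
    then show ?thesis using m by (cases m) auto
  next
    case False
    then have "0 < a powr \<alpha>" by simp
    then have "(a powr \<alpha>) ^ m = a powr (\<alpha> * real m)"
      by (simp add: powr_powr flip: powr_realpow)
    then show ?thesis using m by (simp add: powr_powr)
  qed
  finally show ?thesis unfolding a_def L .
qed

end

theorem theorem5p7:
  fixes \<Psi> :: "nat \<Rightarrow> mat set" and m :: nat and \<alpha> :: real and r :: "mat set \<Rightarrow> real"
  assumes m_pos: "m \<ge> 1"
    and bdd: "\<forall>j\<in>{1..m}. bounded_op_set (\<Psi> j)"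
    and alpha: "\<alpha> \<ge> 1 / real m"
    and r: "r \<in> {rho_ess_set, rho_hat_ess_set}"
  shows
    "(even m \<longrightarrow>
       gamma_set (hadamard_sets \<alpha> m \<Psi>)
         \<le> r (hadamard_sets \<alpha> m (\<lambda>j. alt_prod m \<Psi> j m)) powr (1 / real m) \<and>
       r (hadamard_sets \<alpha> m (\<lambda>j. alt_prod m \<Psi> j m)) powr (1 / real m)
         \<le> (r (alt_prod m \<Psi> 1 m) *
             r (set_prod_list (map (\<lambda>p. if even p then adjs (\<Psi> (m + 1 - p)) else \<Psi> (m + 1 - p))
                                   [1..<m+1]))) powr (\<alpha> / 2)) \<and>
     (odd m \<longrightarrow>
       gamma_set (hadamard_sets \<alpha> m \<Psi>)
         \<le> r (hadamard_sets \<alpha> m (\<lambda>j. alt_prod m \<Psi> j (2 * m))) powr (1 / real (2 * m)) \<and>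
       r (hadamard_sets \<alpha> m (\<lambda>j. alt_prod m \<Psi> j (2 * m))) powr (1 / real (2 * m))
         \<le> r (set_prod_list (map (\<lambda>p. if even p then adjs (cyc m \<Psi> p) else cyc m \<Psi> p)
                                 [1..<2*m+1])) powr (\<alpha> / 2))"
proof -
  have "joint_radius r"
    using r joint_radius_rho_ess_set joint_radius_rho_hat_ess_set by auto
  then interpret joint_radius r .
  interpret bounded_family r \<Psi> m \<alpha>
  proof unfold_locales
    show "1 \<le> real m * \<alpha>" using alpha m_pos by (simp add: field_simps)
    show "bdd_mats (\<Psi> j)" if "j \<in> {1..m}" for j
      using bdd that by (intro bounded_op_set_imp_bdd_mats) blast
  qed (fact m_pos)
  show ?thesis
    unfolding hadamard_sets_eq
    using gamma_hadset_le[of m] gamma_hadset_le[of "2 * m"] even_case odd_case m_pos by simp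
qed

end
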